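(* Let $\tilde{A}$ be a semi-free DG ring, and let $v : \tilde{B} \to B$ be a surjective quasi-isomorphism of DG rings. Then the map of groupoids \[ \operatorname{SHom}_{\leq 1}(\tilde{A}, \tilde{B}) \to \operatorname{SHom}_{\leq 1}(\tilde{A}, B) \] induced by $v$ is a surjective equivalence.
   Context: A DG ring is a graded ring $A = \bigoplus_{i \in \mathbb{Z}} A^i$ (associative, unital) with a differential $\mathrm{d}$ of degree $1$ satisfying $\mathrm{d} \circ \mathrm{d} = 0$ and $\mathrm{d}(a b) = \mathrm{d}(a) b + (-1)^i a\, \mathrm{d}(b)$ for $a \in A^i$. DG ring homomorphisms are unital, degree $0$, and commute with differentials; $\mathsf{DGRng}$ is the category of DG rings. Semi-free: a filtered graded set $(X,F)$ is a graded set $X = \coprod_{i \in \mathbb{Z}} X^i$ with an ascending filtration $\{F_j(X)\}_{j \geq -1}$ by graded subsets, such that $F_{-1}(X) = \varnothing$ and $X = \bigcup_j F_j(X)$. Let $\mathbb{Z}\langle X \rangle$ be the noncommutative graded polynomial ring on $X$, filtered by $F_j(\mathbb{Z}\langle X\rangle) := \mathbb{Z}\langle F_j(X)\rangle$ for $j \geq 0$ and $F_{-1}(\mathbb{Z}\langle X \rangle) := 0$. A DG ring $\tilde{A}$ is (noncommutative) semi-free if there are a filtered graded set $(X,F)$ and an isomorphism of graded rings $\tilde{A} \cong \mathbb{Z}\langle X\rangle$ (forgetting differentials) under which $\mathrm{d}(F_j(X)) \subseteq F_{j-1}(\mathbb{Z}\langle X\rangle)$ for all $j \geq 0$. The DG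 rings $\operatorname{N}(X,B)$: for a simplicial set $X$, with face maps $\partial_i$, let $\operatorname{N}^p(X,\mathbb{Z})$ be the group of functions $\phi : X_p \to \mathbb{Z}$ vanishing on degenerate simplices, and $\operatorname{N}(X,\mathbb{Z}) := \bigoplus_{p \geq 0} \operatorname{N}^p(X,\mathbb{Z})$. It is a DG ring with differential $(\mathrm{d}\phi)(x) = \sum_{i=0}^{p+1} (-1)^i \phi(\partial_i x)$ for $\phi\in \operatorname{N}^p$, and Alexander-Whitney multiplication $(\phi * \psi)(x) = \phi(\partial_{>p}(x)) \cdot \psi(\partial_{<p}(x))$ for $\phi \in \operatorname{N}^p$, $\psi \in \operatorname{N}^q$, $x \in X_{p+q}$, where $\partial_{>p}(x) \in X_p$ is the front face of $x$ (induced by $[p] \to [p+q]$, $i \mapsto i$) and $\partial_{<p}(x) \in X_q$ is the back face (induced by $[q] \to [p+q]$, $i \mapsto p+i$). For a DG ring $B$ set $\operatorname{N}(X,B) := \operatorname{N}(X,\mathbb{Z}) \otimes_{\mathbb{Z}} B$, the tensor product of DG rings with the usual Koszul signs. This is contravariantly functorial in $X$ and covariantly functorial in $B$. Cylinders: $\operatorname{Cyl}_q(B) := \operatorname{N}(\Delta^q, B)$, where $\Delta^q$ is the standard $q$-simplex; the cosimplicial structure of $\{\Delta^q\}_{q}$ makes $\{\operatorname{Cyl}_q(B)\}_{q \in \mathbb{N}}$ a simplicial DG ring. $\operatorname{SHom}(A,B)$ is the simplicial set with $\operatorname{SHom}_q(A,B) := \operatorname{Hom}_{\mathsf{DGRng}}(A,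 \operatorname{Cyl}_q(B))$. When $\tilde{A}$ is semi-free, the simplicial set $S := \operatorname{SHom}(\tilde{A},B)$ is a Kan complex, and $\operatorname{SHom}_{\leq 1}(\tilde{A},B)$ denotes its fundamental groupoid $\pi_{\leq 1}(S)$. Explicitly: the objects are the elements of $S_0$, i.e. the DG ring homomorphisms $f : \tilde{A} \to B$; the morphisms $f_0 \to f_1$ are the classes $[g]$ of elements $g \in S_1$ with $\partial_1(g) = f_0$, $\partial_0(g) = f_1$, where $[g] = [g']$ iff there is $h \in S_2$ with $\partial_0(h) = \operatorname{s}_0(f_1)$, $\partial_1(h) = g'$, $\partial_2(h) = g$; the composition satisfies $[g_{02}] = [g_{12}] \cdot [g_{01}]$ iff there is $h \in S_2$ with $\partial_0(h) = g_{12}$, $\partial_1(h) = g_{02}$, $\partial_2(h) = g_{01}$; the identity of $f$ is $[\operatorname{s}_0(f)]$. A surjective equivalence of groupoids is a functor that is an equivalence (full, faithful and essentially surjective) and is surjective on objects. *)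

theory Defs
  imports "HOL-Algebra.QuotRing" "HOL-Algebra.Generated_Groups" "HOL-Algebra.Free_Abelian_Groups"
begin

section \<open>Graded rings and DG rings\<close>

record 'a gring = "'a ring" +
  grading :: "int \<Rightarrow> 'a set"

record 'a dgring = "'a gring" +
  differential :: "'a \<Rightarrow> 'a"

definition homogeneous_decomposition ::
    "('a, 'm) gring_scheme \<Rightarrow> 'a \<Rightarrow> (int \<Rightarrow> 'a) \<Rightarrow> bool" where
  "homogeneous_decomposition R x c \<longleftrightarrow>
     (\<forall>i. c i \<in> grading R i) \<and> finite {i. c i \<noteq> \<zero>\<^bsub>R\<^esub>} \<and>
     x = finsum R c {i. c i \<noteq> \<zero>\<^bsub>R\<^esub>}"

definition homogeneous_part :: "('a, 'm) gring_scheme \<Rightarrow> 'a \<Rightarrow> int \<Rightarrow> 'a" where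
  "homogeneous_part R x = (THE c. homogeneous_decomposition R x c)"

definition homogeneous_support :: "('a, 'm) gring_scheme \<Rightarrow> 'a \<Rightarrow> int set" where
  "homogeneous_support R x = {i. homogeneous_part R x i \<noteq> \<zero>\<^bsub>R\<^esub>}"

text \<open>The last axiom says that the underlying group is the internal direct sum of the
  homogeneous parts.\<close>

locale graded_ring = ring R for R :: "('a, 'm) gring_scheme" (structure) +
  assumes grading_subgroup: "subgroup (grading R i) (add_monoid R)"
    and one_degree: "\<one> \<in> grading R 0"
    and mult_degree: "\<lbrakk>x \<in> grading R i; y \<in> grading R j\<rbrakk> \<Longrightarrow> x \<otimes> y \<in> grading R (i + j)"
    and direct_sum: "x \<in> carrier R \<Longrightarrow> \<exists>!c. homogeneous_decomposition R x c"

definition koszul_sign :: "int \<Rightarrow> int" where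
  "koszul_sign i = (if even i then 1 else -1)"

locale dg_ring = graded_ring A for A :: "('a, 'm) dgring_scheme" (structure) +
  assumes differential_add:
      "\<lbrakk>x \<in> carrier A; y \<in> carrier A\<rbrakk> \<Longrightarrow>
         differential A (x \<oplus> y) = differential A x \<oplus> differential A y"
    and differential_degree:
      "x \<in> grading A i \<Longrightarrow> differential A x \<in> grading A (i + 1)"
    and differential_square:
      "x \<in> carrier A \<Longrightarrow> differential A (differential A x) = \<zero>"
    and leibniz:
      "\<lbrakk>x \<in> grading A i; y \<in> carrier A\<rbrakk> \<Longrightarrow>
         differential A (x \<otimes> y) =
           (differential A x \<otimes> y) \<oplus> [koszul_sign i] \<cdot> (x \<otimes> differential A y)"

definition dg_hom ::
    "('a, 'm) dgring_scheme \<Rightarrow> ('b, 'n) dgring_scheme \<Rightarrow> ('a \<Rightarrow> 'b) \<Rightarrow> bool" where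
  "dg_hom A B f \<longleftrightarrow>
     f \<in> ring_hom A B \<and>
     (\<forall>i. f ` grading A i \<subseteq> grading B i) \<and>
     (\<forall>x\<in>carrier A. f (differential A x) = differential B (f x))"

text \<open>In Hom sets, homomorphisms are represented by functions that are \<^const>\<open>undefined\<close> outside
  the carrier, so that equality of functions is equality of homomorphisms.\<close>

definition dg_Hom ::
    "('a, 'm) dgring_scheme \<Rightarrow> ('b, 'n) dgring_scheme \<Rightarrow> ('a \<Rightarrow> 'b) set" where
  "dg_Hom A B = {f \<in> extensional (carrier A). dg_hom A B f}"


section \<open>Cohomology and quasi-isomorphisms\<close>

definition cocycles :: "('a, 'm) dgring_scheme \<Rightarrow> int \<Rightarrow> 'a set" where
  "cocycles A i = {x \<in> grading A i. differential A x = \<zero>\<^bsub>A\<^esub>}"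

definition coboundaries :: "('a, 'm) dgring_scheme \<Rightarrow> int \<Rightarrow> 'a set" where
  "coboundaries A i = differential A ` grading A (i - 1)"

definition cocycle_group :: "('a, 'm) dgring_scheme \<Rightarrow> int \<Rightarrow> 'a monoid" where
  "cocycle_group A i = \<lparr>carrier = cocycles A i, monoid.mult = add A, one = \<zero>\<^bsub>A\<^esub>\<rparr>"

definition cohomology :: "('a, 'm) dgring_scheme \<Rightarrow> int \<Rightarrow> 'a set monoid" where
  "cohomology A i = cocycle_group A i Mod coboundaries A i"

definition cohomology_map ::
    "('b, 'n) dgring_scheme \<Rightarrow> ('a \<Rightarrow> 'b) \<Rightarrow> int \<Rightarrow> 'a set \<Rightarrow> 'b set" where
  "cohomology_map B f i C = coboundaries B i <#>\<^bsub>cocycle_group B i\<^esub> (f ` C)"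

definition quasi_iso ::
    "('a, 'm) dgring_scheme \<Rightarrow> ('b, 'n) dgring_scheme \<Rightarrow> ('a \<Rightarrow> 'b) \<Rightarrow> bool" where
  "quasi_iso A B f \<longleftrightarrow>
     dg_hom A B f \<and> (\<forall>i. cohomology_map B f i \<in> iso (cohomology A i) (cohomology B i))"


section \<open>Semi-free DG rings\<close>

text \<open>A graded set is a set \<open>X\<close> with a degree function; each of its subsets is then graded.\<close>

definition filtered_graded_set :: "'x set \<Rightarrow> ('x \<Rightarrow> int) \<Rightarrow> (int \<Rightarrow> 'x set) \<Rightarrow> bool" where
  "filtered_graded_set X dg F \<longleftrightarrow>
     F (-1) = {} \<and>
     (\<forall>i j. -1 \<le> i \<and> i \<le> j \<longrightarrow> F i \<subseteq> F j) \<and>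
     X = (\<Union>j\<in>{-1..}. F j)"

text \<open>The free ring on \<open>X\<close>: integral linear combinations of words in \<open>X\<close>, multiplied by
  concatenation of words.\<close>

definition free_ring :: "'x set \<Rightarrow> ('x \<Rightarrow> int) \<Rightarrow> ('x list \<Rightarrow>\<^sub>0 int) gring" where
  "free_ring X dg =
     \<lparr>carrier = {p. Poly_Mapping.keys p \<subseteq> lists X},
      monoid.mult = (\<lambda>p q. frag_extend (\<lambda>u. frag_extend (\<lambda>w. frag_of (u @ w)) q) p),
      one = frag_of [],
      ring.zero = 0,
      add = (+),
      grading = (\<lambda>i. {p. \<forall>w\<in>Poly_Mapping.keys p.
                             w \<in> lists X \<and> sum_list (map dg w) = i})\<rparr>"

definition free_ring_filtration :: "(int \<Rightarrow> 'x set) \<Rightarrow> int \<Rightarrow> ('x list \<Rightarrow>\<^sub>0 int) set" where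
  "free_ring_filtration F j =
     (if j < 0 then {0} else {p. Poly_Mapping.keys p \<subseteq> lists (F j)})"

text \<open>The generating set may be taken of the same type as the elements of \<open>A\<close>: an isomorphism
  from the free ring on \<open>X\<close> to \<open>A\<close> embeds \<open>X\<close> into \<open>A\<close>.\<close>

definition semi_free :: "('a, 'm) dgring_scheme \<Rightarrow> bool" where
  "semi_free A \<longleftrightarrow>
     (\<exists>(X :: 'a set) dg F \<psi>.
        filtered_graded_set X dg F \<and>
        \<psi> \<in> ring_iso (free_ring X dg) A \<and>
        (\<forall>i. \<psi> ` grading (free_ring X dg) i = grading A i) \<and>
        (\<forall>j\<ge>0. \<forall>x\<in>F j.
           differential A (\<psi> (frag_of [x])) \<in> \<psi> ` free_ring_filtration F (j - 1)))"


section \<open>Tensor products of DG rings\<close>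

text \<open>The tensor product over the integers is the free abelian group on pairs of elements,
  modulo the subgroup generated by the biadditivity relations; its elements are cosets.\<close>

definition tensor_free ::
    "('a, 'm) ring_scheme \<Rightarrow> ('b, 'n) ring_scheme \<Rightarrow> (('a \<times> 'b) \<Rightarrow>\<^sub>0 int) monoid" where
  "tensor_free A B = free_Abelian_group (carrier A \<times> carrier B)"

definition tensor_relations ::
    "('a, 'm) ring_scheme \<Rightarrow> ('b, 'n) ring_scheme \<Rightarrow> (('a \<times> 'b) \<Rightarrow>\<^sub>0 int) set" where
  "tensor_relations A B = generate (tensor_free A B)
     ({frag_of (a \<oplus>\<^bsub>A\<^esub> a', b) - frag_of (a, b) - frag_of (a', b) | a a' b.
         a \<in> carrier A \<and> a' \<in> carrier A \<and> b \<in> carrier B} \<union>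
      {frag_of (a, b \<oplus>\<^bsub>B\<^esub> b') - frag_of (a, b) - frag_of (a, b') | a b b'.
         a \<in> carrier A \<and> b \<in> carrier B \<and> b' \<in> carrier B})"

definition tensor_group ::
    "('a, 'm) ring_scheme \<Rightarrow> ('b, 'n) ring_scheme \<Rightarrow> (('a \<times> 'b) \<Rightarrow>\<^sub>0 int) set monoid" where
  "tensor_group A B = tensor_free A B Mod tensor_relations A B"

definition tensor_class ::
    "('a, 'm) ring_scheme \<Rightarrow> ('b, 'n) ring_scheme \<Rightarrow>
       (('a \<times> 'b) \<Rightarrow>\<^sub>0 int) \<Rightarrow> (('a \<times> 'b) \<Rightarrow>\<^sub>0 int) set" where
  "tensor_class A B c = tensor_relations A B #>\<^bsub>tensor_free A B\<^esub> c"

text \<open>Bilinear extension of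
  \<open>(a \<otimes> b) (a' \<otimes> b') = (-1)^(i * j) (a a') \<otimes> (b b')\<close> for \<open>b\<close> of degree \<open>i\<close> and \<open>a'\<close> of degree \<open>j\<close>.\<close>

definition tensor_mult_rep ::
    "('a, 'm) dgring_scheme \<Rightarrow> ('b, 'n) dgring_scheme \<Rightarrow>
       (('a \<times> 'b) \<Rightarrow>\<^sub>0 int) \<Rightarrow> (('a \<times> 'b) \<Rightarrow>\<^sub>0 int) \<Rightarrow> (('a \<times> 'b) \<Rightarrow>\<^sub>0 int)" where
  "tensor_mult_rep A B c c' =
     frag_extend (\<lambda>(a, b). frag_extend (\<lambda>(a', b').
       \<Sum>i\<in>homogeneous_support B b. \<Sum>j\<in>homogeneous_support A a'.
         frag_cmul (koszul_sign (i * j))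
           (frag_of (a \<otimes>\<^bsub>A\<^esub> homogeneous_part A a' j, homogeneous_part B b i \<otimes>\<^bsub>B\<^esub> b'))) c') c"

text \<open>Linear extension of
  \<open>d (a \<otimes> b) = d a \<otimes> b + (-1)^i a \<otimes> d b\<close> for \<open>a\<close> of degree \<open>i\<close>.\<close>

definition tensor_differential_rep ::
    "('a, 'm) dgring_scheme \<Rightarrow> ('b, 'n) dgring_scheme \<Rightarrow>
       (('a \<times> 'b) \<Rightarrow>\<^sub>0 int) \<Rightarrow> (('a \<times> 'b) \<Rightarrow>\<^sub>0 int)" where
  "tensor_differential_rep A B c =
     frag_extend (\<lambda>(a, b).
       frag_of (differential A a, b) +
       (\<Sum>i\<in>homogeneous_support A a.
          frag_cmul (koszul_sign i) (frag_of (homogeneous_part A a i, differential B b)))) c"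

text \<open>An operation on representatives that respects classes induces the operation on cosets
  below: all members of the union are then the same coset.\<close>

definition dg_tensor ::
    "('a, 'm) dgring_scheme \<Rightarrow> ('b, 'n) dgring_scheme \<Rightarrow> (('a \<times> 'b) \<Rightarrow>\<^sub>0 int) set dgring" where
  "dg_tensor A B =
     \<lparr>carrier = carrier (tensor_group A B),
      monoid.mult = (\<lambda>C D. \<Union>c\<in>C. \<Union>c'\<in>D. tensor_class A B (tensor_mult_rep A B c c')),
      one = tensor_class A B (frag_of (\<one>\<^bsub>A\<^esub>, \<one>\<^bsub>B\<^esub>)),
      ring.zero = \<one>\<^bsub>tensor_group A B\<^esub>,
      add = (\<lambda>C D. C \<otimes>\<^bsub>tensor_group A B\<^esub> D),
      grading = (\<lambda>n. generate (tensor_group A B)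
        {tensor_class A B (frag_of (a, b)) | i j a b.
           i + j = n \<and> a \<in> grading A i \<and> b \<in> grading B j}),
      differential = (\<lambda>C. \<Union>c\<in>C. tensor_class A B (tensor_differential_rep A B c))\<rparr>"

definition dg_tensor_map ::
    "('c, 'm) dgring_scheme \<Rightarrow> ('d, 'n) dgring_scheme \<Rightarrow> ('a \<Rightarrow> 'c) \<Rightarrow> ('b \<Rightarrow> 'd) \<Rightarrow>
       (('a \<times> 'b) \<Rightarrow>\<^sub>0 int) set \<Rightarrow> (('c \<times> 'd) \<Rightarrow>\<^sub>0 int) set" where
  "dg_tensor_map A' B' f g C =
     (\<Union>c\<in>C. tensor_class A' B' (frag_extend (\<lambda>(a, b). frag_of (f a, g b)) c))"


section \<open>Simplicial sets\<close>

text \<open>A monotone map from \<open>[m]\<close> to \<open>[n]\<close> is represented by its list of values, a sorted list of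
  length \<open>m + 1\<close> with entries at most \<open>n\<close>.\<close>

definition monotone_maps :: "nat \<Rightarrow> nat \<Rightarrow> nat list set" where
  "monotone_maps m n = {\<theta>. length \<theta> = Suc m \<and> sorted \<theta> \<and> set \<theta> \<subseteq> {..n}}"

definition monotone_comp :: "nat list \<Rightarrow> nat list \<Rightarrow> nat list" where
  "monotone_comp \<theta> \<eta> = map (\<lambda>i. \<theta> ! i) \<eta>"

text \<open>\<open>simplicial_op X n \<theta>\<close> is the map from \<open>n\<close>-simplices to \<open>m\<close>-simplices induced by
  \<open>\<theta> : [m] \<rightarrow> [n]\<close>; here \<open>m\<close> is determined by the length of \<open>\<theta>\<close>.\<close>

record 's sset =
  simplices :: "nat \<Rightarrow> 's set"
  simplicial_op :: "nat \<Rightarrow> nat list \<Rightarrow> 's \<Rightarrow> 's"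

locale simplicial_set =
  fixes X :: "'s sset"
  assumes op_closed: "\<lbrakk>\<theta> \<in> monotone_maps m n; x \<in> simplices X n\<rbrakk> \<Longrightarrow>
      simplicial_op X n \<theta> x \<in> simplices X m"
    and op_id: "x \<in> simplices X n \<Longrightarrow> simplicial_op X n [0..<Suc n] x = x"
    and op_comp: "\<lbrakk>\<theta> \<in> monotone_maps m n; \<eta> \<in> monotone_maps l m; x \<in> simplices X n\<rbrakk> \<Longrightarrow>
      simplicial_op X n (monotone_comp \<theta> \<eta>) x = simplicial_op X m \<eta> (simplicial_op X n \<theta> x)"

text \<open>\<open>face X n i\<close> goes from \<open>n\<close>-simplices to \<open>(n - 1)\<close>-simplices and is induced by the injection
  omitting \<open>i\<close>; \<open>degen X n i\<close> goes from \<open>n\<close>-simplices to \<open>(n + 1)\<close>-simplices and is induced by the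
  surjection taking the value \<open>i\<close> twice.\<close>

definition face :: "'s sset \<Rightarrow> nat \<Rightarrow> nat \<Rightarrow> 's \<Rightarrow> 's" where
  "face X n i = simplicial_op X n ([0..<i] @ [Suc i..<Suc n])"

definition degen :: "'s sset \<Rightarrow> nat \<Rightarrow> nat \<Rightarrow> 's \<Rightarrow> 's" where
  "degen X n i = simplicial_op X n ([0..<Suc i] @ [i..<Suc n])"

definition degenerate :: "'s sset \<Rightarrow> nat \<Rightarrow> 's \<Rightarrow> bool" where
  "degenerate X n x \<longleftrightarrow> (\<exists>m i y. n = Suc m \<and> i \<le> m \<and> y \<in> simplices X m \<and> x = degen X m i y)"

definition front_face :: "'s sset \<Rightarrow> nat \<Rightarrow> nat \<Rightarrow> 's \<Rightarrow> 's" where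
  "front_face X p q = simplicial_op X (p + q) [0..<Suc p]"

definition back_face :: "'s sset \<Rightarrow> nat \<Rightarrow> nat \<Rightarrow> 's \<Rightarrow> 's" where
  "back_face X p q = simplicial_op X (p + q) [p..<Suc (p + q)]"

definition std_simplex :: "nat \<Rightarrow> nat list sset" where
  "std_simplex q =
     \<lparr>simplices = (\<lambda>p. monotone_maps p q), simplicial_op = (\<lambda>n \<theta> x. monotone_comp x \<theta>)\<rparr>"

lemma monotone_comp_closed:
  assumes "x \<in> monotone_maps n q" "\<theta> \<in> monotone_maps m n"
  shows "monotone_comp x \<theta> \<in> monotone_maps m q"
  using assms unfolding monotone_maps_def monotone_comp_def
  by (auto simp: sorted_iff_nth_mono subset_iff all_set_conv_all_nth less_Suc_eq_le)

lemma simplicial_set_std_simplex: "simplicial_set (std_simplex q)"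
proof
  fix \<theta> m n x
  assume "\<theta> \<in> monotone_maps m n" "x \<in> simplices (std_simplex q) n"
  then show "simplicial_op (std_simplex q) n \<theta> x \<in> simplices (std_simplex q) m"
    by (simp add: std_simplex_def monotone_comp_closed)
next
  fix x n
  assume "x \<in> simplices (std_simplex q) n"
  then have "length x = Suc n"
    by (simp add: std_simplex_def monotone_maps_def)
  then show "simplicial_op (std_simplex q) n [0..<Suc n] x = x"
    using map_nth[of x] by (simp add: std_simplex_def monotone_comp_def)
next
  fix \<theta> m n \<eta> l x
  assume "\<theta> \<in> monotone_maps m n" "\<eta> \<in> monotone_maps l m" "x \<in> simplices (std_simplex q) n"
  then show "simplicial_op (std_simplex q) n (monotone_comp \<theta> \<eta>) x =
      simplicial_op (std_simplex q) m \<eta> (simplicial_op (std_simplex q) n \<theta> x)"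
    by (auto simp: std_simplex_def monotone_comp_def monotone_maps_def subset_iff less_Suc_eq_le)
qed


section \<open>Normalized cochains and cylinders\<close>

text \<open>An element is a family \<open>\<phi> p\<close> of cochains, almost all zero; the component \<open>\<phi> p\<close> takes the value
  0 off the set of \<open>p\<close>-simplices.\<close>

definition normalized_cochains :: "'s sset \<Rightarrow> (nat \<Rightarrow> 's \<Rightarrow> int) set" where
  "normalized_cochains X =
     {\<phi>. (\<forall>p x. x \<notin> simplices X p \<or> degenerate X p x \<longrightarrow> \<phi> p x = 0) \<and>
         finite {p. \<phi> p \<noteq> (\<lambda>_. 0)}}"

definition cochain_ring :: "'s sset \<Rightarrow> (nat \<Rightarrow> 's \<Rightarrow> int) dgring" where
  "cochain_ring X =
     \<lparr>carrier = normalized_cochains X,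
      monoid.mult = (\<lambda>\<phi> \<psi> n x. if x \<in> simplices X n
                then \<Sum>p\<le>n. \<phi> p (front_face X p (n - p) x) * \<psi> (n - p) (back_face X p (n - p) x)
                else 0),
      one = (\<lambda>n x. if n = 0 \<and> x \<in> simplices X 0 then 1 else 0),
      ring.zero = (\<lambda>n x. 0),
      add = (\<lambda>\<phi> \<psi> n x. \<phi> n x + \<psi> n x),
      grading = (\<lambda>i. {\<phi> \<in> normalized_cochains X. \<forall>p. int p \<noteq> i \<longrightarrow> \<phi> p = (\<lambda>_. 0)}),
      differential = (\<lambda>\<phi> n x. case n of 0 \<Rightarrow> 0
                | Suc p \<Rightarrow> if x \<in> simplices X (Suc p)
                     then \<Sum>i\<le>Suc p. (-1) ^ i * \<phi> p (face X (Suc p) i x)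
                     else 0)\<rparr>"

text \<open>Pullback of cochains along a simplicial map \<open>f\<close> with source \<open>X\<close>.\<close>

definition cochain_map ::
    "'s sset \<Rightarrow> (nat \<Rightarrow> 's \<Rightarrow> 't) \<Rightarrow> (nat \<Rightarrow> 't \<Rightarrow> int) \<Rightarrow> (nat \<Rightarrow> 's \<Rightarrow> int)" where
  "cochain_map X f \<phi> = (\<lambda>p x. if x \<in> simplices X p then \<phi> p (f p x) else 0)"

definition cochain_dgring ::
    "'s sset \<Rightarrow> ('b, 'n) dgring_scheme \<Rightarrow> (((nat \<Rightarrow> 's \<Rightarrow> int) \<times> 'b) \<Rightarrow>\<^sub>0 int) set dgring" where
  "cochain_dgring X B = dg_tensor (cochain_ring X) B"

type_synonym 'b cyl = "(((nat \<Rightarrow> nat list \<Rightarrow> int) \<times> 'b) \<Rightarrow>\<^sub>0 int) set"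

definition Cyl :: "nat \<Rightarrow> ('b, 'n) dgring_scheme \<Rightarrow> 'b cyl dgring" where
  "Cyl q B = cochain_dgring (std_simplex q) B"

text \<open>The simplicial operator from \<open>Cyl q B\<close> to \<open>Cyl p B\<close> induced by \<open>\<theta> : [p] \<rightarrow> [q]\<close>, that is, by
  the simplicial map \<open>x \<mapsto> \<theta> \<circ> x\<close> of standard simplices.\<close>

definition Cyl_op :: "('b, 'n) dgring_scheme \<Rightarrow> nat list \<Rightarrow> 'b cyl \<Rightarrow> 'b cyl" where
  "Cyl_op B \<theta> =
     (let \<Delta> = std_simplex (length \<theta> - 1)
      in dg_tensor_map (cochain_ring \<Delta>) B
           (cochain_map \<Delta> (\<lambda>r x. monotone_comp \<theta> x)) (\<lambda>b. b))"

definition Cyl_map :: "nat \<Rightarrow> ('c, 'n) dgring_scheme \<Rightarrow> ('b \<Rightarrow> 'c) \<Rightarrow> 'b cyl \<Rightarrow> 'c cyl" where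
  "Cyl_map q C v = dg_tensor_map (cochain_ring (std_simplex q)) C (\<lambda>\<phi>. \<phi>) v"

definition SHom ::
    "('a, 'm) dgring_scheme \<Rightarrow> ('b, 'n) dgring_scheme \<Rightarrow> ('a \<Rightarrow> 'b cyl) sset" where
  "SHom A B =
     \<lparr>simplices = (\<lambda>q. dg_Hom A (Cyl q B)),
      simplicial_op = (\<lambda>q \<theta> g. compose (carrier A) (Cyl_op B \<theta>) g)\<rparr>"

definition SHom_map ::
    "('a, 'm) dgring_scheme \<Rightarrow> ('c, 'n) dgring_scheme \<Rightarrow> ('b \<Rightarrow> 'c) \<Rightarrow>
       nat \<Rightarrow> ('a \<Rightarrow> 'b cyl) \<Rightarrow> ('a \<Rightarrow> 'c cyl)" where
  "SHom_map A C v q g = compose (carrier A) (Cyl_map q C v) g"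


section \<open>Groupoids\<close>

record ('o, 'm) cat =
  Obj :: "'o set"
  Hom :: "'o \<Rightarrow> 'o \<Rightarrow> 'm set"
  Comp :: "'m \<Rightarrow> 'm \<Rightarrow> 'm"
  Idt :: "'o \<Rightarrow> 'm"

locale groupoid =
  fixes C :: "('o, 'm) cat"
  assumes Hom_disjoint:
      "\<lbrakk>x \<in> Obj C; y \<in> Obj C; x' \<in> Obj C; y' \<in> Obj C; f \<in> Hom C x y; f \<in> Hom C x' y'\<rbrakk> \<Longrightarrow>
         x = x' \<and> y = y'"
    and Comp_closed:
      "\<lbrakk>x \<in> Obj C; y \<in> Obj C; z \<in> Obj C; f \<in> Hom C x y; g \<in> Hom C y z\<rbrakk> \<Longrightarrow>
         Comp C g f \<in> Hom C x z"
    and Comp_assoc: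
      "\<lbrakk>w \<in> Obj C; x \<in> Obj C; y \<in> Obj C; z \<in> Obj C;
        f \<in> Hom C w x; g \<in> Hom C x y; h \<in> Hom C y z\<rbrakk> \<Longrightarrow>
         Comp C h (Comp C g f) = Comp C (Comp C h g) f"
    and Idt_closed: "x \<in> Obj C \<Longrightarrow> Idt C x \<in> Hom C x x"
    and Idt_left: "\<lbrakk>x \<in> Obj C; y \<in> Obj C; f \<in> Hom C x y\<rbrakk> \<Longrightarrow> Comp C (Idt C y) f = f"
    and Idt_right: "\<lbrakk>x \<in> Obj C; y \<in> Obj C; f \<in> Hom C x y\<rbrakk> \<Longrightarrow> Comp C f (Idt C x) = f"
    and inverses:
      "\<lbrakk>x \<in> Obj C; y \<in> Obj C; f \<in> Hom C x y\<rbrakk> \<Longrightarrow>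
         \<exists>g\<in>Hom C y x. Comp C g f = Idt C x \<and> Comp C f g = Idt C y"

locale groupoid_functor = C: groupoid C + D: groupoid D
  for C :: "('o, 'm) cat" and D :: "('p, 'n) cat" +
  fixes Fo :: "'o \<Rightarrow> 'p" and Fm :: "'m \<Rightarrow> 'n"
  assumes Fo_closed: "x \<in> Obj C \<Longrightarrow> Fo x \<in> Obj D"
    and Fm_closed:
      "\<lbrakk>x \<in> Obj C; y \<in> Obj C; f \<in> Hom C x y\<rbrakk> \<Longrightarrow> Fm f \<in> Hom D (Fo x) (Fo y)"
    and Fm_Idt: "x \<in> Obj C \<Longrightarrow> Fm (Idt C x) = Idt D (Fo x)"
    and Fm_Comp:
      "\<lbrakk>x \<in> Obj C; y \<in> Obj C; z \<in> Obj C; f \<in> Hom C x y; g \<in> Hom C y z\<rbrakk> \<Longrightarrow>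
         Fm (Comp C g f) = Comp D (Fm g) (Fm f)"

text \<open>In a groupoid every morphism is an isomorphism, so two objects are isomorphic iff there is a
  morphism between them.\<close>

definition surjective_equivalence ::
    "('o, 'm) cat \<Rightarrow> ('p, 'n) cat \<Rightarrow> ('o \<Rightarrow> 'p) \<Rightarrow> ('m \<Rightarrow> 'n) \<Rightarrow> bool" where
  "surjective_equivalence C D Fo Fm \<longleftrightarrow>
     groupoid_functor C D Fo Fm \<and>
     (\<forall>x\<in>Obj C. \<forall>y\<in>Obj C. Fm ` Hom C x y = Hom D (Fo x) (Fo y)) \<and>
     (\<forall>x\<in>Obj C. \<forall>y\<in>Obj C. inj_on Fm (Hom C x y)) \<and>
     (\<forall>z\<in>Obj D. \<exists>x\<in>Obj C. Hom D (Fo x) z \<noteq> {}) \<and>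
     Fo ` Obj C = Obj D"


section \<open>The fundamental groupoid of a Kan complex\<close>

definition edges :: "'s sset \<Rightarrow> 's \<Rightarrow> 's \<Rightarrow> 's set" where
  "edges S f0 f1 = {g \<in> simplices S 1. face S 1 1 g = f0 \<and> face S 1 0 g = f1}"

definition edge_homotopy :: "'s sset \<Rightarrow> ('s \<times> 's) set" where
  "edge_homotopy S = {(g, g'). \<exists>f0\<in>simplices S 0. \<exists>f1\<in>simplices S 0.
     g \<in> edges S f0 f1 \<and> g' \<in> edges S f0 f1 \<and>
     (\<exists>h\<in>simplices S 2. face S 2 0 h = degen S 0 0 f1 \<and> face S 2 1 h = g' \<and> face S 2 2 h = g)}"

text \<open>The composite of two classes is the set of all \<open>g02\<close> that complete representatives \<open>g12\<close> and
  \<open>g01\<close> to the boundary of a 2-simplex. For a Kan complex this set is a single class, and it is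
  the class of \<open>g02\<close> iff such a 2-simplex exists.\<close>

definition fundamental_groupoid :: "'s sset \<Rightarrow> ('s, 's set) cat" where
  "fundamental_groupoid S =
     \<lparr>Obj = simplices S 0,
      Hom = (\<lambda>f0 f1. edges S f0 f1 // edge_homotopy S),
      Comp = (\<lambda>G12 G01. {g02 \<in> simplices S 1. \<exists>g12\<in>G12. \<exists>g01\<in>G01. \<exists>h\<in>simplices S 2.
                face S 2 0 h = g12 \<and> face S 2 1 h = g02 \<and> face S 2 2 h = g01}),
      Idt = (\<lambda>f. edge_homotopy S `` {degen S 0 0 f})\<rparr>"

text \<open>The map on classes \<open>[g] \<mapsto> [F g]\<close> induced by a simplicial map \<open>F\<close> with target \<open>T\<close>.\<close>

definition fundamental_map :: "'t sset \<Rightarrow> (nat \<Rightarrow> 's \<Rightarrow> 't) \<Rightarrow> 's set \<Rightarrow> 't set" where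
  "fundamental_map T F G = edge_homotopy T `` (F 1 ` G)"

definition SHom1 ::
    "('a, 'm) dgring_scheme \<Rightarrow> ('b, 'n) dgring_scheme \<Rightarrow> ('a \<Rightarrow> 'b cyl, ('a \<Rightarrow> 'b cyl) set) cat" where
  "SHom1 A B = fundamental_groupoid (SHom A B)"

definition SHom1_map_obj ::
    "('a, 'm) dgring_scheme \<Rightarrow> ('c, 'n) dgring_scheme \<Rightarrow> ('b \<Rightarrow> 'c) \<Rightarrow>
       ('a \<Rightarrow> 'b cyl) \<Rightarrow> ('a \<Rightarrow> 'c cyl)" where
  "SHom1_map_obj A C v = SHom_map A C v 0"

definition SHom1_map_mor ::
    "('a, 'm) dgring_scheme \<Rightarrow> ('c, 'n) dgring_scheme \<Rightarrow> ('b \<Rightarrow> 'c) \<Rightarrow>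
       ('a \<Rightarrow> 'b cyl) set \<Rightarrow> ('a \<Rightarrow> 'c cyl) set" where
  "SHom1_map_mor A C v = fundamental_map (SHom A C) (SHom_map A C v)"

end

theory Submission
  imports Defs "HOL-Library.Sublist"
begin

text \<open>The tensor product \<open>N(\<Delta>\<^sup>q) \<otimes> B\<close> is the ring of \<open>B\<close>-valued functions on the nondegenerate simplices of
  \<open>\<Delta>\<^sup>q\<close>. Hence a \<open>q\<close>-simplex of \<open>SHom(A, B)\<close> is a homomorphism from \<open>A\<close> to \<open>B\<close>-valued cochains on
  \<open>\<Delta>\<^sup>q\<close>, and a compatible family of simplices on some of the faces is a homomorphism to the cochains on
  the subcomplex that they span.

  A homomorphism from a semi-free \<open>A\<close> to \<open>E\<close> subject to constraints is built generator by generator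
  along the filtration; for a generator \<open>a\<close> one must solve \<open>d e = z\<close> for a given cocycle \<open>z\<close> over \<open>d a\<close>,
  with \<open>e\<close> prescribed on a subcomplex. For a horn the top simplex determines the value on the missing
  face. For the boundary of a simplex and a surjective quasi-isomorphism \<open>v\<close>, one value is left,
  prescribed modulo the acyclic kernel of \<open>v\<close>. So horns can be filled in \<open>SHom(A, B)\<close>, and the map
  induced by \<open>v\<close> lifts against the boundaries of \<open>\<Delta>\<^sup>0\<close>, \<open>\<Delta>\<^sup>1\<close> and \<open>\<Delta>\<^sup>2\<close>, which gives surjectivity on
  objects, fullness and faithfulness.\<close>

section \<open>Graded rings\<close>

text \<open>The obstacle is the encoding of the cylinder: its elements are cosets of formal sums,
  and its operations are unions over representatives. Therefore associativity, the Leibniz rule and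
  d d = 0 are proved for cochains on vertex lists, and the mutually inverse \<open>cyl_value\<close>
  and \<open>expand\<close> carry homomorphisms across. They are inverse because the integer
  cochains of a simplex are free on the indicator functions. On vertex lists, product and
  differential are recursions on the first vertex, so each identity is one induction instead of a
  double sum over faces. The price is that the recursion leaves the cochains:
  \<open>\<lambda>y. \<phi> (a # y)\<close> need not vanish on the empty list, and some lemmas carry
  a correction term or an offset for this. Koszul signs become an involution \<open>parity\<close>,
  which also makes sense for inhomogeneous elements. A lift out of a semi-free ring is controlled by
  a relation between elements of source and target that is stable under differences and products.
  Horn filling and boundary lifting are two instances of the same recursion over generators; they
  differ only in how \<open>d e = z\<close> is solved.\<close>

locale graded_group = abelian_group R for R :: "('a, 'm) gring_scheme" (structure) +
  assumes grading_subgroup: "subgroup (grading R i) (add_monoid R)"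
    and direct_sum: "x \<in> carrier R \<Longrightarrow> \<exists>!c. homogeneous_decomposition R x c"

text \<open>Homogeneous parts depend only on the additive structure. The split matters for
  \<open>cochain_ring\<close>, which is used below as a graded group whose products are evaluated
  simplex by simplex.\<close>

sublocale graded_ring \<subseteq> graded_group
  by (rule graded_group.intro[OF is_abelian_group graded_group_axioms.intro[OF grading_subgroup direct_sum]])

context graded_group
begin

lemma grading_closed: "x \<in> grading R i \<Longrightarrow> x \<in> carrier R"
  using subgroup.subset[OF grading_subgroup[of i]] by auto

lemma grading_zero [simp]: "\<zero> \<in> grading R i"
  using subgroup.one_closed[OF grading_subgroup[of i]] by simp

lemma grading_add: "x \<in> grading R i \<Longrightarrow> y \<in> grading R i \<Longrightarrow> x \<oplus> y \<in> grading R i"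
  using subgroup.m_closed[OF grading_subgroup[of i]] by simp

lemma grading_neg: "x \<in> grading R i \<Longrightarrow> \<ominus> x \<in> grading R i"
  using subgroup.m_inv_closed[OF grading_subgroup[of i]] by (simp add: a_inv_def)

lemma grading_minus: "x \<in> grading R i \<Longrightarrow> y \<in> grading R i \<Longrightarrow> x \<ominus> y \<in> grading R i"
  by (simp add: a_minus_def grading_add grading_neg)

lemma grading_finsum: "finite I \<Longrightarrow> (\<And>k. k \<in> I \<Longrightarrow> f k \<in> grading R i) \<Longrightarrow> finsum R f I \<in> grading R i"
proof (induction I rule: finite_induct)
  case (insert k I)
  then show ?case
    by (subst finsum_insert) (auto intro!: grading_add intro: grading_closed)
qed simp

lemma homogeneous_decompositionI:
  assumes "\<And>i. c i \<in> grading R i" "finite F" "\<And>i. i \<notin> F \<Longrightarrow> c i = \<zero>" "x = finsum R c F"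
  shows "homogeneous_decomposition R x c"
proof -
  have sub: "{i. c i \<noteq> \<zero>} \<subseteq> F"
    using assms(3) by auto
  have "finsum R c {i. c i \<noteq> \<zero>} = finsum R c F"
    by (rule add.finprod_mono_neutral_cong_left) (use assms sub in \<open>auto intro: grading_closed[OF assms(1)]\<close>)
  then show ?thesis
    unfolding homogeneous_decomposition_def using assms sub finite_subset by auto
qed

lemma homogeneous_part_decomposition:
  "x \<in> carrier R \<Longrightarrow> homogeneous_decomposition R x (homogeneous_part R x)"
  unfolding homogeneous_part_def by (rule theI'[OF direct_sum])

lemma homogeneous_part_eqI:
  assumes "homogeneous_decomposition R x c"
  shows "homogeneous_part R x = c"
proof -
  have "x \<in> carrier R"
    using assms unfolding homogeneous_decomposition_def
    by (metis (no_types, lifting) Pi_I finsum_closed grading_closed)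
  then show ?thesis
    using direct_sum[of x] homogeneous_part_decomposition[of x] assms by blast
qed

lemma homogeneous_part_degree: "x \<in> carrier R \<Longrightarrow> homogeneous_part R x i \<in> grading R i"
  using homogeneous_part_decomposition unfolding homogeneous_decomposition_def by blast

lemma finite_homogeneous_support: "x \<in> carrier R \<Longrightarrow> finite (homogeneous_support R x)"
  using homogeneous_part_decomposition
  unfolding homogeneous_decomposition_def homogeneous_support_def by blast

lemma homogeneous_part_sum:
  assumes "x \<in> carrier R" "finite F" "homogeneous_support R x \<subseteq> F"
  shows "x = finsum R (homogeneous_part R x) F"
proof -
  have "finsum R (homogeneous_part R x) (homogeneous_support R x) = finsum R (homogeneous_part R x) F"
    by (rule add.finprod_mono_neutral_cong_left)
      (use assms in \<open>auto simp: homogeneous_support_def intro: grading_closed homogeneous_part_degree\<close>)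
  then show ?thesis
    using homogeneous_part_decomposition[OF assms(1)]
    by (simp add: homogeneous_decomposition_def homogeneous_support_def)
qed

lemma homogeneous_part_add:
  assumes "x \<in> carrier R" "y \<in> carrier R"
  shows "homogeneous_part R (x \<oplus> y) = (\<lambda>i. homogeneous_part R x i \<oplus> homogeneous_part R y i)"
proof (rule homogeneous_part_eqI, rule homogeneous_decompositionI)
  let ?F = "homogeneous_support R x \<union> homogeneous_support R y"
  show "finite ?F"
    using assms by (simp add: finite_homogeneous_support)
  then show "x \<oplus> y = (\<Oplus>i\<in>?F. homogeneous_part R x i \<oplus> homogeneous_part R y i)"
    using assms homogeneous_part_sum[of x ?F] homogeneous_part_sum[of y ?F]
    by (subst finsum_addf) (auto intro: grading_closed homogeneous_part_degree)
qed (use assms in \<open>auto simp: homogeneous_support_def intro: grading_add homogeneous_part_degree\<close>)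

lemma homogeneous_part_homogeneous:
  assumes "x \<in> grading R i"
  shows "homogeneous_part R x = (\<lambda>j. if j = i then x else \<zero>)"
  by (rule homogeneous_part_eqI, rule homogeneous_decompositionI[where F = "{i}"])
    (use assms grading_closed in auto)

text \<open>Every element is a finite sum of homogeneous ones, so identities between additive maps,
  such as the sign rules, need checking in one degree at a time.\<close>

lemma homogeneous_induct [consumes 1, case_names homogeneous add]:
  assumes "x \<in> carrier R"
    and hom: "\<And>i x. x \<in> grading R i \<Longrightarrow> P x"
    and add: "\<And>x y. x \<in> carrier R \<Longrightarrow> y \<in> carrier R \<Longrightarrow> P x \<Longrightarrow> P y \<Longrightarrow> P (x \<oplus> y)"
  shows "P x"
proof -
  have "P (finsum R c F)" if "finite F" "\<And>i. c i \<in> grading R i" for c :: "int \<Rightarrow> 'a" and F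
    using that(1)
  proof (induction F rule: finite_induct)
    case empty
    show ?case
      using hom[of \<zero>] by simp
  next
    case (insert i F)
    then show ?case
      using that(2) by (subst finsum_insert) (auto intro!: add finsum_closed intro: hom grading_closed)
  qed
  from this[OF finite_homogeneous_support[OF assms(1)] homogeneous_part_degree[OF assms(1)]]
  show ?thesis
    using homogeneous_part_sum[OF assms(1) finite_homogeneous_support[OF assms(1)] order_refl] by simp
qed

end

text \<open>The signed sums over \<open>homogeneous_support\<close> in the tensor product and its
  differential have this shape: a family of maps, one for each degree, extended additively to all
  elements.\<close>

definition graded_sum ::
    "('a, 'm) gring_scheme \<Rightarrow> ('c, 'n) ring_scheme \<Rightarrow> (int \<Rightarrow> 'a \<Rightarrow> 'c) \<Rightarrow> 'a \<Rightarrow> 'c" where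
  "graded_sum R G H x = finsum G (\<lambda>i. H i (homogeneous_part R x i)) (homogeneous_support R x)"

locale graded_additive = graded_group R + G: abelian_group G
  for R :: "('a, 'm) gring_scheme" (structure) and G :: "('c, 'n) ring_scheme" +
  fixes H :: "int \<Rightarrow> 'a \<Rightarrow> 'c"
  assumes H_closed: "x \<in> grading R i \<Longrightarrow> H i x \<in> carrier G"
    and H_add: "x \<in> grading R i \<Longrightarrow> y \<in> grading R i \<Longrightarrow> H i (x \<oplus> y) = H i x \<oplus>\<^bsub>G\<^esub> H i y"
begin

lemma H_zero: "H i \<zero> = \<zero>\<^bsub>G\<^esub>"
proof -
  have "H i \<zero> \<oplus>\<^bsub>G\<^esub> H i \<zero> = H i \<zero> \<oplus>\<^bsub>G\<^esub> \<zero>\<^bsub>G\<^esub>"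
    using H_add[of \<zero> i \<zero>] H_closed[of \<zero> i] by simp
  then show ?thesis
    using H_closed[of \<zero> i] G.add.l_cancel_one[of "H i \<zero>" "H i \<zero>"] by simp
qed

text \<open>The supports of two elements and of their sum differ. Over a common finite set the sums
  become comparable, and the added terms are \<open>H i\<close> of zero.\<close>

lemma graded_sum_superset:
  assumes "x \<in> carrier R" "finite F" "homogeneous_support R x \<subseteq> F"
  shows "graded_sum R G H x = finsum G (\<lambda>i. H i (homogeneous_part R x i)) F"
  unfolding graded_sum_def
  by (rule G.add.finprod_mono_neutral_cong_left)
    (use assms in \<open>auto simp: homogeneous_support_def H_zero intro!: H_closed homogeneous_part_degree\<close>)

lemma graded_sum_closed: "x \<in> carrier R \<Longrightarrow> graded_sum R G H x \<in> carrier G"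
  unfolding graded_sum_def
  by (intro G.finsum_closed) (auto intro!: H_closed homogeneous_part_degree)

lemma graded_sum_add:
  assumes "x \<in> carrier R" "y \<in> carrier R"
  shows "graded_sum R G H (x \<oplus> y) = graded_sum R G H x \<oplus>\<^bsub>G\<^esub> graded_sum R G H y"
proof -
  let ?F = "homogeneous_support R x \<union> homogeneous_support R y"
  have F: "finite ?F"
    using assms by (simp add: finite_homogeneous_support)
  have sub: "homogeneous_support R (x \<oplus> y) \<subseteq> ?F"
    using assms by (auto simp: homogeneous_support_def homogeneous_part_add)
  have "graded_sum R G H (x \<oplus> y) =
      finsum G (\<lambda>i. H i (homogeneous_part R x i) \<oplus>\<^bsub>G\<^esub> H i (homogeneous_part R y i)) ?F"
    using assms F sub
    by (subst graded_sum_superset[of _ ?F])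
      (auto simp: homogeneous_part_add H_add homogeneous_part_degree
         intro!: G.finsum_cong' H_closed homogeneous_part_degree G.a_closed)
  then show ?thesis
    using assms F graded_sum_superset[of x ?F] graded_sum_superset[of y ?F]
    by (subst (asm) G.finsum_addf) (auto intro!: H_closed homogeneous_part_degree)
qed

lemma graded_sum_homogeneous:
  assumes "x \<in> grading R i"
  shows "graded_sum R G H x = H i x"
proof -
  have "graded_sum R G H x = finsum G (\<lambda>j. H j (homogeneous_part R x j)) {i}"
    using assms by (intro graded_sum_superset)
      (auto simp: homogeneous_support_def homogeneous_part_homogeneous grading_closed split: if_splits)
  then show ?thesis
    using assms by (simp add: homogeneous_part_homogeneous H_closed)
qed

end

text \<open>An additive map is determined by its values on homogeneous elements. This replaces the
  sums over degrees in the tensor formulas by closed expressions.\<close>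

lemma (in graded_additive) graded_sum_eq:
  assumes "x \<in> carrier R"
    and "\<And>x y. x \<in> carrier R \<Longrightarrow> y \<in> carrier R \<Longrightarrow> f (x \<oplus> y) = f x \<oplus>\<^bsub>G\<^esub> f y"
    and "\<And>i x. x \<in> grading R i \<Longrightarrow> f x = H i x"
  shows "graded_sum R G H x = f x"
  using assms(1) by (induction x rule: homogeneous_induct)
    (simp_all add: graded_sum_homogeneous graded_sum_add assms)

section \<open>The grading involution\<close>

lemma (in abelian_group) koszul_sign_smult:
  "x \<in> carrier G \<Longrightarrow> [koszul_sign i] \<cdot> x = (if even i then x else \<ominus> x)"
  using add.int_pow_neg[of x 1] by (simp add: koszul_sign_def)

text \<open>The involution x -> (-1)^deg(x), extended additively. With it Koszul signs can be
  written without naming the degree of an element.\<close>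

definition parity :: "('a, 'm) gring_scheme \<Rightarrow> 'a \<Rightarrow> 'a" where
  "parity R = graded_sum R R (\<lambda>i x. [koszul_sign i] \<cdot>\<^bsub>R\<^esub> x)"

context graded_ring
begin

lemma graded_additive_parity: "graded_additive R R (\<lambda>i x. [koszul_sign i] \<cdot>\<^bsub>R\<^esub> x)"
  by unfold_locales (auto simp: koszul_sign_smult grading_closed minus_add)

lemma parity_closed [simp]: "x \<in> carrier R \<Longrightarrow> parity R x \<in> carrier R"
  unfolding parity_def by (rule graded_additive.graded_sum_closed[OF graded_additive_parity])

lemma parity_add: "x \<in> carrier R \<Longrightarrow> y \<in> carrier R \<Longrightarrow> parity R (x \<oplus> y) = parity R x \<oplus> parity R y"
  unfolding parity_def by (rule graded_additive.graded_sum_add[OF graded_additive_parity])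

lemma parity_homogeneous: "x \<in> grading R i \<Longrightarrow> parity R x = (if even i then x else \<ominus> x)"
  using graded_additive.graded_sum_homogeneous[OF graded_additive_parity]
  by (simp add: parity_def koszul_sign_smult grading_closed)

lemma parity_zero [simp]: "parity R \<zero> = \<zero>"
  using parity_homogeneous[of \<zero> 0] by simp

lemma parity_one [simp]: "parity R \<one> = \<one>"
  using parity_homogeneous[OF one_degree] by simp

lemma parity_neg: "x \<in> carrier R \<Longrightarrow> parity R (\<ominus> x) = \<ominus> parity R x"
  using parity_add[of x "\<ominus> x"] by (simp add: r_neg) (metis add.inv_equality add.inv_closed a_comm parity_closed)

lemma parity_parity [simp]: "x \<in> carrier R \<Longrightarrow> parity R (parity R x) = x"
proof (induction x rule: homogeneous_induct)
  case (homogeneous i x)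
  then show ?case
    by (auto simp: parity_homogeneous[of _ i] grading_neg grading_closed)
qed (simp add: parity_add)

lemma parity_mult:
  assumes "x \<in> carrier R" "y \<in> carrier R"
  shows "parity R (x \<otimes> y) = parity R x \<otimes> parity R y"
  using assms(1)
proof (induction x rule: homogeneous_induct)
  case (homogeneous i x)
  then have x: "x \<in> carrier R"
    by (simp add: grading_closed)
  show ?case
    using assms(2)
  proof (induction y rule: homogeneous_induct)
    case (homogeneous j y)
    then show ?case
      using \<open>x \<in> grading R i\<close> mult_degree[of x i y j]
      by (simp add: parity_homogeneous[of _ i] parity_homogeneous[of _ j] parity_homogeneous[of _ "i + j"]
        grading_closed l_minus r_minus)
  qed (simp add: x parity_add r_distr)
qed (simp add: assms parity_add l_distr)

end

context dg_ring
begin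

lemma differential_closed [simp]: "x \<in> carrier A \<Longrightarrow> differential A x \<in> carrier A"
proof (induction x rule: homogeneous_induct)
  case (homogeneous i x)
  then show ?case
    using differential_degree grading_closed by blast
qed (simp add: differential_add)

lemma differential_zero [simp]: "differential A \<zero> = \<zero>"
proof -
  have "differential A \<zero> \<oplus> differential A \<zero> = differential A \<zero> \<oplus> \<zero>"
    using differential_add[of \<zero> \<zero>] by simp
  then show ?thesis
    using add.l_cancel_one[of "differential A \<zero>" "differential A \<zero>"] by simp
qed

lemma differential_neg: "x \<in> carrier A \<Longrightarrow> differential A (\<ominus> x) = \<ominus> differential A x"
  using differential_add[of "\<ominus> x" x]
  by (simp add: l_neg) (metis add.inv_equality add.inv_closed differential_closed)

lemma differential_minus:
  "x \<in> carrier A \<Longrightarrow> y \<in> carrier A \<Longrightarrow>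
    differential A (x \<ominus> y) = differential A x \<ominus> differential A y"
  by (simp add: a_minus_def differential_add differential_neg)

text \<open>The differential raises the degree by one and so flips the sign by which
  \<open>parity\<close> acts.\<close>

lemma differential_parity:
  "x \<in> carrier A \<Longrightarrow> differential A (parity A x) = \<ominus> parity A (differential A x)"
proof (induction x rule: homogeneous_induct)
  case (homogeneous i x)
  then show ?case
    using differential_degree[of x i]
    by (auto simp: parity_homogeneous[of _ i] parity_homogeneous[of _ "i + 1"] differential_neg grading_closed)
qed (simp add: parity_add differential_add minus_add)

text \<open>Both sides are additive in \<open>x\<close>, so the homogeneous rule suffices; its sign
  is absorbed in \<open>parity\<close>.\<close>

lemma leibniz_parity:
  assumes "x \<in> carrier A" "y \<in> carrier A"
  shows "differential A (x \<otimes> y) = (differential A x \<otimes> y) \<oplus> (parity A x \<otimes> differential A y)"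
  using assms(1)
proof (induction x rule: homogeneous_induct)
  case (homogeneous i x)
  then have "x \<in> carrier A"
    by (simp add: grading_closed)
  then show ?case
    using homogeneous assms(2)
    by (simp add: leibniz koszul_sign_smult parity_homogeneous[of _ i] l_minus)
next
  case (add u w)
  have swap: "(a \<oplus> b) \<oplus> (c \<oplus> e) = (a \<oplus> c) \<oplus> (b \<oplus> e)"
    if "a \<in> carrier A" "b \<in> carrier A" "c \<in> carrier A" "e \<in> carrier A" for a b c e
    using that by (simp add: a_ac)
  show ?case
    using add assms(2) by (simp add: parity_add l_distr differential_add swap)
qed

end

section \<open>Cochains with coefficients in a DG ring\<close>

definition twist :: "('b, 'm) gring_scheme \<Rightarrow> nat \<Rightarrow> 'b \<Rightarrow> 'b" where
  "twist B n x = (if even n then x else parity B x)"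

text \<open>The Alexander-Whitney product, by recursion on the simplex: one summand has the first vertex as
  front face, the others have longer front faces. The twist is the Koszul sign of moving a
  coefficient past the back face.\<close>

fun cup :: "('b, 'm) dgring_scheme \<Rightarrow> ('v list \<Rightarrow> 'b) \<Rightarrow> ('v list \<Rightarrow> 'b) \<Rightarrow> 'v list \<Rightarrow> 'b" where
  "cup B \<phi> \<psi> [] = \<zero>\<^bsub>B\<^esub>"
| "cup B \<phi> \<psi> (a # x) =
     (twist B (length x) (\<phi> [a]) \<otimes>\<^bsub>B\<^esub> \<psi> (a # x)) \<oplus>\<^bsub>B\<^esub> cup B (\<lambda>y. \<phi> (a # y)) \<psi> x"

text \<open>A list of length \<open>n\<close> is a simplex of dimension \<open>n - 1\<close>. Cochains vanish on the empty list, but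
  the functions \<open>\<lambda>y. \<phi> (a # y)\<close> met in the recursion do not.\<close>

fun total_diff :: "('b, 'm) dgring_scheme \<Rightarrow> ('v list \<Rightarrow> 'b) \<Rightarrow> 'v list \<Rightarrow> 'b" where
  "total_diff B \<phi> [] = \<ominus>\<^bsub>B\<^esub> differential B (\<phi> [])"
| "total_diff B \<phi> (a # x) = \<phi> x \<ominus>\<^bsub>B\<^esub> total_diff B (\<lambda>y. \<phi> (a # y)) x"

text \<open>At a list of length n the sign is (-1)^(n-1) times the parity of the coefficient. For a
  cochain of total degree i this amounts to (-1)^i, the sign in its Leibniz rule.\<close>

definition total_parity :: "('b, 'm) dgring_scheme \<Rightarrow> ('v list \<Rightarrow> 'b) \<Rightarrow> 'v list \<Rightarrow> 'b" where
  "total_parity B \<phi> x = (if odd (length x) then parity B (\<phi> x) else \<ominus>\<^bsub>B\<^esub> parity B (\<phi> x))"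

text \<open>Front and back faces of \<open>x\<close> are nonempty subsequences of it, so the product
  sees only values on faces. This is what makes restriction to subcomplexes and gluing
  possible.\<close>

lemma cup_cong:
  assumes "\<And>y. subseq y x \<Longrightarrow> y \<noteq> [] \<Longrightarrow> \<phi> y = \<phi>' y" "\<And>y. subseq y x \<Longrightarrow> y \<noteq> [] \<Longrightarrow> \<psi> y = \<psi>' y"
  shows "cup B \<phi> \<psi> x = cup B \<phi>' \<psi>' x"
  using assms
proof (induction x arbitrary: \<phi> \<phi>')
  case (Cons a x)
  have "cup B (\<lambda>y. \<phi> (a # y)) \<psi> x = cup B (\<lambda>y. \<phi>' (a # y)) \<psi>' x"
    by (rule Cons.IH) (use Cons.prems in auto)
  then show ?case
    using Cons.prems by simp
qed simp

lemma total_diff_cong: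
  assumes "\<phi> x = \<phi>' x" "\<And>k. k < length x \<Longrightarrow> \<phi> (take k x @ drop (Suc k) x) = \<phi>' (take k x @ drop (Suc k) x)"
  shows "total_diff B \<phi> x = total_diff B \<phi>' x"
  using assms
proof (induction x arbitrary: \<phi> \<phi>')
  case (Cons a x)
  have "total_diff B (\<lambda>y. \<phi> (a # y)) x = total_diff B (\<lambda>y. \<phi>' (a # y)) x"
    by (rule Cons.IH) (use Cons.prems(1) Cons.prems(2)[of "Suc _"] in auto)
  then show ?case
    using Cons.prems(2)[of 0] by simp
qed simp

lemma subseq_remove: "subseq (take k x @ drop (Suc k) x) x"
proof (cases "k < length x")
  case True
  then have "x = take k x @ (x ! k) # drop (Suc k) x"
    by (rule id_take_nth_drop)
  then show ?thesis
    by (metis list_emb_append_mono subseq_order.order_refl subseq_Cons')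
qed simp

lemma total_diff_cong_subseq:
  assumes "\<And>y. subseq y x \<Longrightarrow> \<phi> y = \<phi>' y"
  shows "total_diff B \<phi> x = total_diff B \<phi>' x"
  using assms subseq_remove by (intro total_diff_cong) auto

lemma cup_map: "cup B (\<lambda>y. \<phi> (map \<rho> y)) (\<lambda>y. \<psi> (map \<rho> y)) x = cup B \<phi> \<psi> (map \<rho> x)"
proof (induction x arbitrary: \<phi>)
  case (Cons a x)
  show ?case
    using Cons.IH[of "\<lambda>y. \<phi> (\<rho> a # y)"] by simp
qed simp

lemma total_diff_map: "total_diff B (\<lambda>y. \<phi> (map \<rho> y)) x = total_diff B \<phi> (map \<rho> x)"
proof (induction x arbitrary: \<phi>)
  case (Cons a x)
  show ?case
    using Cons.IH[of "\<lambda>y. \<phi> (\<rho> a # y)"] by simp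
qed simp

section \<open>Product and differential on vertex lists\<close>

context dg_ring
begin

lemma twist_closed [simp]: "x \<in> carrier A \<Longrightarrow> twist A n x \<in> carrier A"
  by (simp add: twist_def)

lemma twist_add: "x \<in> carrier A \<Longrightarrow> y \<in> carrier A \<Longrightarrow> twist A n (x \<oplus> y) = twist A n x \<oplus> twist A n y"
  by (simp add: twist_def parity_add)

lemma twist_neg: "x \<in> carrier A \<Longrightarrow> twist A n (\<ominus> x) = \<ominus> twist A n x"
  by (simp add: twist_def parity_neg)

lemma twist_mult: "x \<in> carrier A \<Longrightarrow> y \<in> carrier A \<Longrightarrow> twist A n (x \<otimes> y) = twist A n x \<otimes> twist A n y"
  by (simp add: twist_def parity_mult)

lemma twist_twist: "x \<in> carrier A \<Longrightarrow> twist A m (twist A n x) = twist A (m + n) x"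
  by (simp add: twist_def)

lemma twist_zero [simp]: "twist A n \<zero> = \<zero>"
  by (simp add: twist_def)

lemma twist_one [simp]: "twist A n \<one> = \<one>"
  by (simp add: twist_def)

lemma twist_degree: "x \<in> grading A i \<Longrightarrow> twist A n x \<in> grading A i"
  by (simp add: twist_def parity_homogeneous grading_neg)

lemma cup_closed [simp]:
  "(\<And>y. \<phi> y \<in> carrier A) \<Longrightarrow> (\<And>y. \<psi> y \<in> carrier A) \<Longrightarrow> cup A \<phi> \<psi> x \<in> carrier A"
  by (induction x arbitrary: \<phi>) simp_all

lemma total_diff_closed [simp]:
  "(\<And>y. \<phi> y \<in> carrier A) \<Longrightarrow> total_diff A \<phi> x \<in> carrier A"
  by (induction x arbitrary: \<phi>) simp_all

lemma total_parity_closed [simp]: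
  "(\<And>y. \<phi> y \<in> carrier A) \<Longrightarrow> total_parity A \<phi> x \<in> carrier A"
  by (simp add: total_parity_def)

lemma cup_zero_left [simp]: "(\<And>y. \<psi> y \<in> carrier A) \<Longrightarrow> cup A (\<lambda>_. \<zero>) \<psi> x = \<zero>"
  by (induction x) simp_all

lemma total_diff_zero [simp]: "total_diff A (\<lambda>_. \<zero>) x = \<zero>"
  by (induction x) (simp_all add: a_minus_def)

lemma add_swap: "a \<in> carrier A \<Longrightarrow> b \<in> carrier A \<Longrightarrow> c \<in> carrier A \<Longrightarrow> e \<in> carrier A \<Longrightarrow>
    (a \<oplus> b) \<oplus> (c \<oplus> e) = (a \<oplus> c) \<oplus> (b \<oplus> e)"
  by (simp add: a_ac)

lemma cup_add_left:
  assumes "\<And>y. \<phi> y \<in> carrier A" "\<And>y. \<phi>' y \<in> carrier A" "\<And>y. \<psi> y \<in> carrier A"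
  shows "cup A (\<lambda>y. \<phi> y \<oplus> \<phi>' y) \<psi> x = cup A \<phi> \<psi> x \<oplus> cup A \<phi>' \<psi> x"
  using assms by (induction x arbitrary: \<phi> \<phi>') (simp_all add: twist_add l_distr add_swap)

lemma cup_add_right:
  assumes "\<And>y. \<phi> y \<in> carrier A" "\<And>y. \<psi> y \<in> carrier A" "\<And>y. \<psi>' y \<in> carrier A"
  shows "cup A \<phi> (\<lambda>y. \<psi> y \<oplus> \<psi>' y) x = cup A \<phi> \<psi> x \<oplus> cup A \<phi> \<psi>' x"
  using assms by (induction x arbitrary: \<phi>) (simp_all add: r_distr add_swap)

lemma cup_neg_left:
  assumes "\<And>y. \<phi> y \<in> carrier A" "\<And>y. \<psi> y \<in> carrier A"
  shows "cup A (\<lambda>y. \<ominus> \<phi> y) \<psi> x = \<ominus> cup A \<phi> \<psi> x"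
  using assms by (induction x arbitrary: \<phi>) (simp_all add: twist_neg l_minus minus_add)

lemma total_diff_add:
  assumes "\<And>y. \<phi> y \<in> carrier A" "\<And>y. \<phi>' y \<in> carrier A"
  shows "total_diff A (\<lambda>y. \<phi> y \<oplus> \<phi>' y) x = total_diff A \<phi> x \<oplus> total_diff A \<phi>' x"
  using assms by (induction x arbitrary: \<phi> \<phi>')
    (simp_all add: differential_add minus_add a_minus_def add_swap)

lemma total_diff_neg:
  assumes "\<And>y. \<phi> y \<in> carrier A"
  shows "total_diff A (\<lambda>y. \<ominus> \<phi> y) x = \<ominus> total_diff A \<phi> x"
  using assms by (induction x arbitrary: \<phi>)
    (simp_all add: differential_neg minus_add a_minus_def)

text \<open>A scalar leaves the front factor without a sign if it is twisted by the length of the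
  list; the offset \<open>k\<close> accounts for letters that the recursion has already
  removed.\<close>

lemma cup_scale_left:
  assumes "\<And>y. \<phi> y \<in> carrier A" "\<And>y. \<psi> y \<in> carrier A" "u \<in> carrier A"
  shows "cup A (\<lambda>y. twist A (length y + k) u \<otimes> \<phi> y) \<psi> x = twist A (length x + k) u \<otimes> cup A \<phi> \<psi> x"
  using assms
proof (induction x arbitrary: \<phi> k)
  case (Cons a x)
  show ?case
    using Cons.prems Cons.IH[of "\<lambda>y. \<phi> (a # y)" "Suc k"]
    by (simp add: twist_mult twist_twist m_assoc r_distr)
qed simp

text \<open>Peel off the first vertex \<open>a\<close>. Either the first factor sits on
  \<open>[a]\<close> alone, and its value is a scalar for \<open>cup_scale_left\<close>, or the
  induction hypothesis for \<open>\<lambda>y. \<phi> (a # y)\<close> applies.\<close>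

lemma cup_assoc:
  assumes "\<And>y. \<phi> y \<in> carrier A" "\<And>y. \<psi> y \<in> carrier A" "\<And>y. \<chi> y \<in> carrier A"
  shows "cup A (cup A \<phi> \<psi>) \<chi> x = cup A \<phi> (cup A \<psi> \<chi>) x"
  using assms
proof (induction x arbitrary: \<phi>)
  case (Cons a x)
  have "cup A (cup A \<phi> \<psi>) \<chi> (a # x) =
      (twist A (length x) (\<phi> [a]) \<otimes> twist A (length x) (\<psi> [a]) \<otimes> \<chi> (a # x)) \<oplus>
      (cup A (\<lambda>y. twist A (length y) (\<phi> [a]) \<otimes> \<psi> (a # y)) \<chi> x \<oplus>
       cup A (cup A (\<lambda>y. \<phi> (a # y)) \<psi>) \<chi> x)"
    using Cons.prems
    by (simp add: cup_add_left twist_mult) (simp add: twist_def)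
  also have "cup A (cup A (\<lambda>y. \<phi> (a # y)) \<psi>) \<chi> x = cup A (\<lambda>y. \<phi> (a # y)) (cup A \<psi> \<chi>) x"
    by (rule Cons.IH) (use Cons.prems in auto)
  also have "cup A (\<lambda>y. twist A (length y) (\<phi> [a]) \<otimes> \<psi> (a # y)) \<chi> x =
      twist A (length x) (\<phi> [a]) \<otimes> cup A (\<lambda>y. \<psi> (a # y)) \<chi> x"
    using Cons.prems cup_scale_left[of "\<lambda>y. \<psi> (a # y)" \<chi> "\<phi> [a]" 0] by simp
  finally show ?case
    using Cons.prems by (simp add: r_distr m_assoc a_assoc)
qed simp

text \<open>The Leibniz rule for a scalar times a cochain. The twist by the length is the sign of
  moving \<open>u\<close> past the simplicial directions, and the parity of \<open>k\<close> fixes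
  the sign of the term with \<open>differential A u\<close>.\<close>

lemma total_diff_scale:
  assumes "\<And>y. \<psi> y \<in> carrier A" "u \<in> carrier A"
  shows "total_diff A (\<lambda>y. twist A (length y + k) u \<otimes> \<psi> y) x =
    (twist A (Suc (length x + k)) u \<otimes> total_diff A \<psi> x) \<ominus>
    ((if even k then twist A (length x + k) (differential A u)
      else \<ominus> twist A (length x + k) (differential A u)) \<otimes> \<psi> x)"
  using assms
proof (induction x arbitrary: \<psi> k)
  case Nil
  then show ?case
    by (simp add: leibniz_parity twist_def differential_parity minus_add r_minus l_minus a_minus_def a_ac)
next
  case (Cons a x)
  have "total_diff A (\<lambda>y. twist A (length (a # y) + k) u \<otimes> \<psi> (a # y)) x =
      (twist A (length x + k) u \<otimes> total_diff A (\<lambda>y. \<psi> (a # y)) x) \<ominus>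
      ((if even (Suc k) then twist A (Suc (length x + k)) (differential A u)
        else \<ominus> twist A (Suc (length x + k)) (differential A u)) \<otimes> \<psi> (a # x))"
    using Cons.IH[of "\<lambda>y. \<psi> (a # y)" "Suc k"] Cons.prems by (simp add: twist_def)
  then show ?case
    using Cons.prems
    by (simp add: r_distr minus_add r_minus l_minus a_minus_def a_ac) (simp add: twist_def)
qed

text \<open>The last summand vanishes for cochains; the induction needs it because it passes from \<open>\<phi>\<close> to
  \<open>\<lambda>y. \<phi> (a # y)\<close>.\<close>

lemma total_diff_cup:
  assumes "\<And>y. \<phi> y \<in> carrier A" "\<And>y. \<psi> y \<in> carrier A" "\<psi> [] = \<zero>"
  shows "total_diff A (cup A \<phi> \<psi>) x =
    (cup A (total_diff A \<phi>) \<psi> x \<oplus> cup A (total_parity A \<phi>) (total_diff A \<psi>) x) \<ominus>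
    (twist A (Suc (length x)) (\<phi> []) \<otimes> \<psi> x)"
  using assms(1)
proof (induction x arbitrary: \<phi>)
  case Nil
  then show ?case
    using assms by (simp add: a_minus_def)
next
  case (Cons a x)
  let ?\<phi> = "\<lambda>y. \<phi> (a # y)" and ?\<psi> = "\<lambda>y. \<psi> (a # y)"
  note [simp] = Cons.prems assms(2,3)
  \<comment> \<open>Here \<open>p\<close> is the term with \<open>\<phi> []\<close>: it arises in
    the product with \<open>total_diff A \<phi>\<close> and cancels against the last summand. The
    correction term of the induction hypothesis is \<open>t\<close>, which returns as a face term of
    \<open>\<psi>\<close>. The remaining letters occur on both sides.\<close>
  have regroup: "r \<oplus> \<ominus> ((w \<oplus> \<ominus> q) \<oplus> ((s \<oplus> m) \<oplus> \<ominus> t)) =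
      (((p \<oplus> q) \<oplus> (r \<oplus> \<ominus> s)) \<oplus> ((t \<oplus> \<ominus> w) \<oplus> \<ominus> m)) \<oplus> \<ominus> p"
    if "p \<in> carrier A" "q \<in> carrier A" "r \<in> carrier A" "s \<in> carrier A" "t \<in> carrier A"
      "w \<in> carrier A" "m \<in> carrier A" for p q r s t w m
    using that by algebra
  have 1: "total_diff A (cup A \<phi> \<psi>) (a # x) =
      cup A \<phi> \<psi> x \<ominus> (total_diff A (\<lambda>y. twist A (length y) (\<phi> [a]) \<otimes> ?\<psi> y) x \<oplus>
        total_diff A (cup A ?\<phi> \<psi>) x)"
    by (simp add: total_diff_add)
  have 2: "total_diff A (\<lambda>y. twist A (length y) (\<phi> [a]) \<otimes> ?\<psi> y) x =
      (twist A (Suc (length x)) (\<phi> [a]) \<otimes> total_diff A ?\<psi> x) \<ominus>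
      (twist A (length x) (differential A (\<phi> [a])) \<otimes> ?\<psi> x)"
    using total_diff_scale[of ?\<psi> "\<phi> [a]" 0 x] by simp
  have 3: "total_diff A (cup A ?\<phi> \<psi>) x =
      (cup A (total_diff A ?\<phi>) \<psi> x \<oplus> cup A (total_parity A ?\<phi>) (total_diff A \<psi>) x) \<ominus>
      (twist A (Suc (length x)) (\<phi> [a]) \<otimes> \<psi> x)"
    by (rule Cons.IH) simp
  have "cup A (\<lambda>y. total_diff A \<phi> (a # y)) \<psi> x =
      cup A (\<lambda>y. \<phi> y \<oplus> \<ominus> total_diff A ?\<phi> y) \<psi> x"
    by (simp add: a_minus_def)
  also have "\<dots> = cup A \<phi> \<psi> x \<ominus> cup A (total_diff A ?\<phi>) \<psi> x"
    by (subst cup_add_left) (simp_all add: cup_neg_left a_minus_def)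
  finally have 4: "cup A (total_diff A \<phi>) \<psi> (a # x) =
      (twist A (length x) (\<phi> [] \<oplus> differential A (\<phi> [a])) \<otimes> \<psi> (a # x)) \<oplus>
      (cup A \<phi> \<psi> x \<ominus> cup A (total_diff A ?\<phi>) \<psi> x)"
    by (simp add: a_minus_def)
  have "(\<lambda>y. total_parity A \<phi> (a # y)) = (\<lambda>y. \<ominus> total_parity A ?\<phi> y)"
    by (auto simp: total_parity_def)
  then have 5: "cup A (total_parity A \<phi>) (total_diff A \<psi>) (a # x) =
      (twist A (Suc (length x)) (\<phi> [a]) \<otimes> (\<psi> x \<ominus> total_diff A ?\<psi> x)) \<ominus>
      cup A (total_parity A ?\<phi>) (total_diff A \<psi>) x"
    by (simp add: cup_neg_left a_minus_def) (simp add: total_parity_def twist_def)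
  have 6: "twist A (Suc (length (a # x))) (\<phi> []) = twist A (length x) (\<phi> [])"
    by (simp add: twist_def)
  show ?case
    unfolding 1 2 3 4 5 6 twist_add[OF Cons.prems differential_closed[OF Cons.prems]]
    by (simp add: l_distr a_minus_def r_distr r_minus regroup)
qed

text \<open>Let F be \<open>total_diff A \<phi>\<close> and G the same for
  \<open>\<lambda>y. \<phi> (a # y)\<close>. The recursion gives F at \<open>a # y\<close> as
  \<open>\<phi> y\<close> minus G at \<open>y\<close>. Applying the differential again yields F - F
  plus the square for the shifted function, which is zero by induction.\<close>

lemma total_diff_total_diff:
  assumes "\<And>y. \<phi> y \<in> carrier A"
  shows "total_diff A (total_diff A \<phi>) x = \<zero>"
  using assms
proof (induction x arbitrary: \<phi>)
  case (Cons a x)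
  have "total_diff A (\<lambda>y. total_diff A \<phi> (a # y)) x =
      total_diff A (\<lambda>y. \<phi> y \<oplus> \<ominus> total_diff A (\<lambda>y. \<phi> (a # y)) y) x"
    by (simp add: a_minus_def)
  also have "\<dots> = total_diff A \<phi> x"
    using Cons by (subst total_diff_add) (simp_all add: total_diff_neg)
  finally show ?case
    using Cons.prems by (simp add: a_minus_def r_neg)
qed (simp add: differential_square differential_neg)

text \<open>Front and back face overlap in one vertex, so a repeated adjacent pair of
  \<open>x\<close> lies inside one of the two.\<close>

lemma cup_zero_if_not_distinct_adj:
  assumes "\<And>y. \<phi> y \<in> carrier A" "\<And>y. \<psi> y \<in> carrier A"
    and "\<And>y. \<not> distinct_adj y \<Longrightarrow> \<phi> y = \<zero>" "\<And>y. \<not> distinct_adj y \<Longrightarrow> \<psi> y = \<zero>"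
    and "\<not> distinct_adj x"
  shows "cup A \<phi> \<psi> x = \<zero>"
  using assms
proof (induction x arbitrary: \<phi>)
  case (Cons a x)
  have "cup A (\<lambda>y. \<phi> (a # y)) \<psi> x = \<zero>"
  proof (cases "distinct_adj x")
    case False
    moreover have "\<phi> (a # y) = \<zero>" if "\<not> distinct_adj y" for y
      using Cons.prems(3)[of "a # y"] that by (cases y) auto
    ultimately show ?thesis
      using Cons.prems by (intro Cons.IH) auto
  next
    case True
    then obtain z where x: "x = a # z"
      using Cons.prems by (auto simp: distinct_adj_Cons neq_Nil_conv)
    then show ?thesis
      using Cons.prems by simp
  qed
  then show ?case
    using Cons.prems by simp
qed simp

text \<open>Deleting either of two equal neighbours gives the same list with opposite signs; every
  other face, and \<open>x\<close> itself, still contains the pair.\<close>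

lemma total_diff_zero_if_not_distinct_adj:
  assumes "\<And>y. \<phi> y \<in> carrier A" "\<And>y. \<not> distinct_adj y \<Longrightarrow> \<phi> y = \<zero>" "\<not> distinct_adj x"
  shows "total_diff A \<phi> x = \<zero>"
  using assms
proof (induction x arbitrary: \<phi>)
  case (Cons a x)
  show ?case
  proof (cases "distinct_adj x")
    case False
    moreover have "\<phi> (a # y) = \<zero>" if "\<not> distinct_adj y" for y
      using Cons.prems(2)[of "a # y"] that by (cases y) auto
    ultimately have "total_diff A (\<lambda>y. \<phi> (a # y)) x = \<zero>"
      using Cons.prems by (intro Cons.IH) auto
    then show ?thesis
      using Cons.prems False by (simp add: a_minus_def)
  next
    case True
    then obtain z where x: "x = a # z"
      using Cons.prems by (auto simp: distinct_adj_Cons neq_Nil_conv)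
    then show ?thesis
      using Cons.prems by (simp add: a_minus_def minus_add r_neg)
  qed
qed simp

text \<open>The offset \<open>k\<close> is 1 for a cochain, since a list of length n has dimension n
  - 1. It drops by one for each vertex that the recursion prefixes to the argument of
  \<open>\<phi>\<close>.\<close>

lemma cup_degree:
  assumes "\<And>y. y \<noteq> [] \<Longrightarrow> \<phi> y \<in> grading A (i - int (length y) + k)"
    "\<And>y. y \<noteq> [] \<Longrightarrow> \<psi> y \<in> grading A (j - int (length y) + 1)" "x \<noteq> []"
  shows "cup A \<phi> \<psi> x \<in> grading A (i + j - int (length x) + k)"
  using assms
proof (induction x arbitrary: \<phi> k)
  case (Cons a x)
  have "twist A (length x) (\<phi> [a]) \<otimes> \<psi> (a # x) \<in>
      grading A ((i - int (length [a]) + k) + (j - int (length (a # x)) + 1))"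
    using Cons.prems(1)[of "[a]"] Cons.prems(2)[of "a # x"] by (intro mult_degree twist_degree) auto
  then have 1: "twist A (length x) (\<phi> [a]) \<otimes> \<psi> (a # x) \<in> grading A (i + j - int (length (a # x)) + k)"
    by (simp add: algebra_simps)
  show ?case
  proof (cases "x = []")
    case True
    then show ?thesis
      using 1 by (auto intro: grading_add)
  next
    case False
    have "cup A (\<lambda>y. \<phi> (a # y)) \<psi> x \<in> grading A (i + j - int (length x) + (k - 1))"
      by (rule Cons.IH) (use Cons.prems(1)[of "a # _"] Cons.prems(2) False in \<open>auto simp: algebra_simps\<close>)
    then show ?thesis
      using 1 by (auto intro!: grading_add simp: algebra_simps)
  qed
qed simp

lemma total_diff_degree:
  assumes "\<And>y. \<phi> y \<in> grading A (i - int (length y))"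
  shows "total_diff A \<phi> x \<in> grading A (i + 1 - int (length x))"
  using assms
proof (induction x arbitrary: \<phi> i)
  case Nil
  then show ?case
    using differential_degree[of "\<phi> []" i] Nil[of "[]"] by (simp add: grading_neg)
next
  case (Cons a x)
  have "total_diff A (\<lambda>y. \<phi> (a # y)) x \<in> grading A (i - 1 + 1 - int (length x))"
    by (rule Cons.IH) (use Cons.prems[of "a # _"] in \<open>simp add: algebra_simps\<close>)
  then show ?case
    using Cons.prems[of x] by (auto intro!: grading_minus)
qed

lemma total_diff_single_face:
  assumes "\<And>y. \<phi> y \<in> carrier A" "\<phi> x = \<zero>" "k < length x"
    and "\<And>j. j < length x \<Longrightarrow> j \<noteq> k \<Longrightarrow> \<phi> (take j x @ drop (Suc j) x) = \<zero>"
  shows "total_diff A \<phi> x = (if even k then \<phi> (take k x @ drop (Suc k) x)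
    else \<ominus> \<phi> (take k x @ drop (Suc k) x))"
  using assms
proof (induction x arbitrary: \<phi> k)
  case (Cons a x)
  show ?case
  proof (cases k)
    case 0
    have "total_diff A (\<lambda>y. \<phi> (a # y)) x = total_diff A (\<lambda>_. \<zero>) x"
      by (rule total_diff_cong) (use Cons.prems(2) Cons.prems(4)[of "Suc _"] 0 in auto)
    then show ?thesis
      using 0 Cons.prems by (simp add: a_minus_def)
  next
    case (Suc k')
    have "total_diff A (\<lambda>y. \<phi> (a # y)) x = (if even k' then \<phi> (a # take k' x @ drop (Suc k') x)
        else \<ominus> \<phi> (a # take k' x @ drop (Suc k') x))"
      by (rule Cons.IH) (use Cons.prems(1-3) Cons.prems(4)[of "Suc _"] Suc in auto)
    then show ?thesis
      using Suc Cons.prems(1) Cons.prems(4)[of 0] by (simp add: a_minus_def)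
  qed
qed simp

text \<open>Unrolled, the recursion ends in the differential of the coefficient with the sign
  (-1)^dimension; when the values on all faces vanish, only this term is left.\<close>

lemma total_diff_no_face:
  assumes "\<And>y. \<phi> y \<in> carrier A"
    and "\<And>j. j < length x \<Longrightarrow> \<phi> (take j x @ drop (Suc j) x) = \<zero>"
  shows "total_diff A \<phi> x = (if odd (length x) then differential A (\<phi> x)
    else \<ominus> differential A (\<phi> x))"
  using assms
proof (induction x arbitrary: \<phi>)
  case (Cons a x)
  have "total_diff A (\<lambda>y. \<phi> (a # y)) x = (if odd (length x) then differential A (\<phi> (a # x))
        else \<ominus> differential A (\<phi> (a # x)))"
    by (rule Cons.IH) (use Cons.prems(1) Cons.prems(2)[of "Suc _"] in auto)
  then show ?case
    using Cons.prems(1) Cons.prems(2)[of 0] by (simp add: a_minus_def)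
qed simp

end

text \<open>Nondegeneracy is expressed by \<open>distinct_adj\<close>, which refers to no order on
  the vertices. Finiteness bounds the degrees that occur in a cochain, as the direct sum axiom
  demands.\<close>

definition subcomplex :: "'v list set \<Rightarrow> bool" where
  "subcomplex L \<longleftrightarrow> finite L \<and> [] \<notin> L \<and> (\<forall>x\<in>L. distinct_adj x) \<and>
     (\<forall>x\<in>L. \<forall>y. subseq y x \<longrightarrow> y \<noteq> [] \<longrightarrow> y \<in> L)"

text \<open>A list has one vertex more than its dimension, hence the shift in the grading. Product
  and differential are cut off outside \<open>L\<close>, where \<open>cup\<close> and
  \<open>total_diff\<close> may be nonzero.\<close>

definition cochains :: "'v list set \<Rightarrow> ('b, 'm) dgring_scheme \<Rightarrow> ('v list \<Rightarrow> 'b) dgring" where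
  "cochains L B =
     \<lparr>carrier = {\<phi>. (\<forall>x. \<phi> x \<in> carrier B) \<and> (\<forall>x. x \<notin> L \<longrightarrow> \<phi> x = \<zero>\<^bsub>B\<^esub>)},
      monoid.mult = (\<lambda>\<phi> \<psi> x. if x \<in> L then cup B \<phi> \<psi> x else \<zero>\<^bsub>B\<^esub>),
      one = (\<lambda>x. if x \<in> L \<and> length x = Suc 0 then \<one>\<^bsub>B\<^esub> else \<zero>\<^bsub>B\<^esub>),
      ring.zero = (\<lambda>x. \<zero>\<^bsub>B\<^esub>),
      add = (\<lambda>\<phi> \<psi> x. \<phi> x \<oplus>\<^bsub>B\<^esub> \<psi> x),
      grading = (\<lambda>i. {\<phi>. (\<forall>x. \<phi> x \<in> grading B (i + 1 - int (length x))) \<and>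
        (\<forall>x. x \<notin> L \<longrightarrow> \<phi> x = \<zero>\<^bsub>B\<^esub>)}),
      differential = (\<lambda>\<phi> x. if x \<in> L then total_diff B \<phi> x else \<zero>\<^bsub>B\<^esub>)\<rparr>"

lemma cochains_simps [simp]:
  "carrier (cochains L B) = {\<phi>. (\<forall>x. \<phi> x \<in> carrier B) \<and> (\<forall>x. x \<notin> L \<longrightarrow> \<phi> x = \<zero>\<^bsub>B\<^esub>)}"
  "monoid.mult (cochains L B) = (\<lambda>\<phi> \<psi> x. if x \<in> L then cup B \<phi> \<psi> x else \<zero>\<^bsub>B\<^esub>)"
  "one (cochains L B) = (\<lambda>x. if x \<in> L \<and> length x = Suc 0 then \<one>\<^bsub>B\<^esub> else \<zero>\<^bsub>B\<^esub>)"
  "ring.zero (cochains L B) = (\<lambda>x. \<zero>\<^bsub>B\<^esub>)"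
  "add (cochains L B) = (\<lambda>\<phi> \<psi> x. \<phi> x \<oplus>\<^bsub>B\<^esub> \<psi> x)"
  "grading (cochains L B) i = {\<phi>. (\<forall>x. \<phi> x \<in> grading B (i + 1 - int (length x))) \<and>
        (\<forall>x. x \<notin> L \<longrightarrow> \<phi> x = \<zero>\<^bsub>B\<^esub>)}"
  "differential (cochains L B) = (\<lambda>\<phi> x. if x \<in> L then total_diff B \<phi> x else \<zero>\<^bsub>B\<^esub>)"
  by (simp_all add: cochains_def)

locale cochain_algebra = dg_ring B for B :: "('b, 'm) dgring_scheme" (structure) +
  fixes L :: "'v list set"
  assumes subcomplex: "subcomplex L"
begin

lemma Nil_notin: "[] \<notin> L" and fin_L: "finite L" and L_distinct: "x \<in> L \<Longrightarrow> distinct_adj x"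
  and L_subseq: "x \<in> L \<Longrightarrow> subseq y x \<Longrightarrow> y \<noteq> [] \<Longrightarrow> y \<in> L"
  using subcomplex by (auto simp: subcomplex_def)

lemma abelian_group_cochains: "abelian_group (cochains L B)"
proof (rule abelian_groupI)
  fix \<phi> assume "\<phi> \<in> carrier (cochains L B)"
  then show "\<exists>\<psi>\<in>carrier (cochains L B). \<psi> \<oplus>\<^bsub>cochains L B\<^esub> \<phi> = \<zero>\<^bsub>cochains L B\<^esub>"
    by (intro bexI[of _ "\<lambda>x. \<ominus> \<phi> x"]) (auto simp: l_neg)
qed (auto simp: a_ac)

lemma cochains_neg: "\<phi> \<in> carrier (cochains L B) \<Longrightarrow> \<ominus>\<^bsub>cochains L B\<^esub> \<phi> = (\<lambda>x. \<ominus> \<phi> x)"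
  by (rule abelian_group.minus_equality[OF abelian_group_cochains]) (auto simp: l_neg)

lemma cochains_finsum:
  assumes "finite F" "\<And>i. i \<in> F \<Longrightarrow> c i \<in> carrier (cochains L B)"
  shows "finsum (cochains L B) c F = (\<lambda>x. finsum B (\<lambda>i. c i x) F)"
  using assms
proof (induction F rule: finite_induct)
  case empty
  then show ?case
    by (simp add: abelian_monoid.finsum_empty[OF abelian_group.axioms(1)[OF abelian_group_cochains]])
next
  case (insert i F)
  then show ?case
    by (subst abelian_monoid.finsum_insert[OF abelian_group.axioms(1)[OF abelian_group_cochains]])
      (auto simp: finsum_insert)
qed

lemma cup_unit:
  assumes "\<And>y. \<phi> y \<in> carrier B"
  shows "x \<in> L \<Longrightarrow> cup B (\<lambda>x. if x \<in> L \<and> length x = Suc 0 then \<one> else \<zero>) \<phi> x = \<phi> x"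
    and "x \<in> L \<Longrightarrow> cup B \<phi> (\<lambda>x. if x \<in> L \<and> length x = Suc 0 then \<one> else \<zero>) x = \<phi> x"
proof -
  have 1: "cup B (\<lambda>x. if length x = Suc 0 then \<one> else \<zero>) \<phi> x = \<phi> x" if ne: "x \<noteq> []" for x
  proof -
    obtain a y where x: "x = a # y"
      using ne by (cases x) auto
    have "cup B (\<lambda>y. if length (a # y) = Suc 0 then \<one> else \<zero>) \<phi> y = cup B (\<lambda>_. \<zero>) \<phi> y"
      by (rule cup_cong) auto
    then show ?thesis
      using assms x by simp
  qed
  have 2: "cup B \<phi> (\<lambda>x. if length x = Suc 0 then \<one> else \<zero>) x = \<phi> x" if "\<And>y. \<phi> y \<in> carrier B" "x \<noteq> []" for \<phi> x
    using that
  proof (induction x arbitrary: \<phi>)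
    case (Cons a x)
    then show ?case
      by (cases "x = []") (auto simp: twist_def)
  qed simp
  assume x: "x \<in> L"
  then have ne: "x \<noteq> []"
    using Nil_notin by auto
  show "cup B (\<lambda>x. if x \<in> L \<and> length x = Suc 0 then \<one> else \<zero>) \<phi> x = \<phi> x"
    unfolding 1[OF ne, symmetric] by (rule cup_cong) (use x L_subseq in auto)
  show "cup B \<phi> (\<lambda>x. if x \<in> L \<and> length x = Suc 0 then \<one> else \<zero>) x = \<phi> x"
    by (subst 2[OF assms ne, symmetric], rule cup_cong) (use x L_subseq in auto)
qed

lemma ring_cochains: "ring (cochains L B)"
proof (rule ringI[OF abelian_group_cochains])
  show "monoid (cochains L B)"
  proof (rule monoidI, goal_cases)
    case (3 \<phi> \<psi> \<chi>)
    have "cup B (\<lambda>x. if x \<in> L then cup B \<phi> \<psi> x else \<zero>) \<chi> x = cup B (cup B \<phi> \<psi>) \<chi> x"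
      "cup B \<phi> (\<lambda>x. if x \<in> L then cup B \<psi> \<chi> x else \<zero>) x = cup B \<phi> (cup B \<psi> \<chi>) x" if "x \<in> L" for x
      using that L_subseq by (auto intro!: cup_cong)
    then show ?case
      using 3 by (simp add: cup_assoc cong: if_cong)
  next
    case (4 \<phi>)
    then show ?case
      by (auto simp: cup_unit)
  next
    case (5 \<phi>)
    then show ?case
      by (auto simp: cup_unit)
  qed auto
qed (auto simp: cup_add_left cup_add_right)

lemma total_parity_koszul:
  assumes "\<phi> y \<in> grading B (i + 1 - int (length y))"
  shows "total_parity B \<phi> y = (if even i then \<phi> y else \<ominus> \<phi> y)"
  using parity_homogeneous[OF assms] grading_closed[OF assms] by (auto simp: total_parity_def)

lemma dg_ring_cochains: "dg_ring (cochains L B)"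
proof -
  interpret K: ring "cochains L B"
    by (rule ring_cochains)
  have Kgr: "\<phi> \<in> grading (cochains L B) i \<Longrightarrow> \<phi> \<in> carrier (cochains L B)" for \<phi> i
    using grading_closed by auto
  have sub: "subgroup (grading (cochains L B) i) (add_monoid (cochains L B))" for i
  proof (rule group.subgroupI[OF K.add.group_axioms])
    show "\<phi> \<in> grading (cochains L B) i \<Longrightarrow> inv\<^bsub>add_monoid (cochains L B)\<^esub> \<phi> \<in> grading (cochains L B) i" for \<phi>
      using cochains_neg[OF Kgr, of \<phi> i] unfolding a_inv_def[symmetric] by (auto simp: grading_neg)
  qed (use Kgr in \<open>auto simp: grading_add intro: exI[of _ "\<lambda>_. \<zero>"]\<close>)
  have direct: "\<exists>!c. homogeneous_decomposition (cochains L B) \<phi> c" if \<phi>: "\<phi> \<in> carrier (cochains L B)" for \<phi>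
  proof (rule ex1I)
    \<comment> \<open>In total degree i the value at \<open>x\<close> is the part of
      \<open>\<phi> x\<close> whose degree is i minus the dimension of \<open>x\<close>; the degrees
      that occur lie in the finite set \<open>?F\<close>.\<close>
    let ?c = "\<lambda>i x. homogeneous_part B (\<phi> x) (i + 1 - int (length x))"
    let ?F = "\<Union>x\<in>L. (\<lambda>j. j - 1 + int (length x)) ` homogeneous_support B (\<phi> x)"
    have c: "?c i \<in> grading (cochains L B) i" for i
      using \<phi> by (auto intro: homogeneous_part_degree simp: homogeneous_part_homogeneous[OF grading_zero[of 0]])
    have out: "?c i x = \<zero>" if "i \<notin> ?F" for i x
    proof (cases "x \<in> L")
      case True
      then show ?thesis
        using that by (force simp: homogeneous_support_def image_iff algebra_simps)
    next
      case False
      then show ?thesis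
        using \<phi> by (simp add: homogeneous_part_homogeneous[OF grading_zero[of 0]])
    qed
    have finF: "finite ?F"
      using fin_L \<phi> by (auto intro!: finite_homogeneous_support)
    have nz: "{i. ?c i \<noteq> \<zero>\<^bsub>cochains L B\<^esub>} \<subseteq> ?F"
      using out by auto
    have "\<phi> x = finsum B (\<lambda>i. ?c i x) {i. ?c i \<noteq> \<zero>\<^bsub>cochains L B\<^esub>}" for x
    proof -
      let ?N = "{i. ?c i \<noteq> \<zero>\<^bsub>cochains L B\<^esub>}"
      let ?h = "\<lambda>i. i + 1 - int (length x)"
      have "finsum B (homogeneous_part B (\<phi> x)) (?h ` ?N) = finsum B (\<lambda>i. ?c i x) ?N"
        using \<phi> by (subst finsum_reindex) (auto simp: inj_on_def intro: grading_closed homogeneous_part_degree)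
      moreover have "homogeneous_support B (\<phi> x) \<subseteq> ?h ` ?N"
      proof
        fix j assume "j \<in> homogeneous_support B (\<phi> x)"
        then have "?c (j - 1 + int (length x)) x \<noteq> \<zero>"
          by (simp add: homogeneous_support_def)
        then have "j - 1 + int (length x) \<in> ?N"
          unfolding mem_Collect_eq cochains_simps(4) by metis
        then show "j \<in> ?h ` ?N"
          by (rule rev_image_eqI) simp
      qed
      moreover have "finite ?N"
        using finite_subset[OF nz finF] .
      ultimately show ?thesis
        using homogeneous_part_sum[of "\<phi> x" "?h ` ?N"] \<phi> by simp
    qed
    then show "homogeneous_decomposition (cochains L B) \<phi> ?c"
      unfolding homogeneous_decomposition_def
      using c finite_subset[OF nz finF] cochains_finsum[of _ ?c] Kgr[OF c] by (auto simp del: cochains_simps)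
  next
    fix c assume c: "homogeneous_decomposition (cochains L B) \<phi> c"
    show "c = (\<lambda>i x. homogeneous_part B (\<phi> x) (i + 1 - int (length x)))"
    proof (intro ext)
      fix i and x :: "'v list"
      let ?N = "{i. c i \<noteq> \<zero>\<^bsub>cochains L B\<^esub>}" and ?h = "\<lambda>i. i + 1 - int (length x)"
        and ?g = "\<lambda>j. j - 1 + int (length x)"
      have cg: "c i \<in> grading (cochains L B) i" for i
        using c by (simp only: homogeneous_decomposition_def)
      have "\<phi> = finsum (cochains L B) c ?N" "finite ?N"
        using c by (simp_all only: homogeneous_decomposition_def)
      then have "\<phi> x = finsum B (\<lambda>i. c i x) ?N"
        using cochains_finsum[of ?N c] Kgr[OF cg] by metis
      also have "\<dots> = finsum B (\<lambda>j. c (?g j) x) (?h ` ?N)"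
        using Kgr[OF cg] by (subst finsum_reindex) (auto simp: inj_on_def)
      finally have sum: "\<phi> x = finsum B (\<lambda>j. c (?g j) x) (?h ` ?N)" .
      \<comment> \<open>Evaluated at \<open>x\<close> and reindexed, \<open>c\<close> decomposes
        \<open>\<phi> x\<close> in \<open>B\<close>, where decompositions are unique.\<close>
      have "homogeneous_decomposition B (\<phi> x) (\<lambda>j. c (?g j) x)"
      proof (rule homogeneous_decompositionI[OF _ _ _ sum])
        show "c (?g j) x \<in> grading B j" for j
        proof -
          have "c (?g j) x \<in> grading B (?g j + 1 - int (length x))"
            using cg[of "?g j"] unfolding cochains_simps(6) by blast
          then show ?thesis
            by simp
        qed
        show "finite (?h ` ?N)"
          using \<open>finite ?N\<close> by simp
        show "c (?g j) x = \<zero>" if "j \<notin> ?h ` ?N" for j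
        proof -
          have "j = ?h (?g j)"
            by simp
          then have "?g j \<notin> ?N"
            using that by blast
          then show ?thesis
            by simp
        qed
      qed
      then show "c i x = homogeneous_part B (\<phi> x) (i + 1 - int (length x))"
        by (simp add: homogeneous_part_eqI)
    qed
  qed
  show ?thesis
  proof (intro dg_ring.intro graded_ring.intro graded_ring_axioms.intro dg_ring_axioms.intro
      ring_cochains sub, goal_cases)
    case 1
    show ?case by (auto simp: one_degree)
  next
    case (2 \<phi> i \<psi> j)
    then have "cup B \<phi> \<psi> x \<in> grading B (i + j - int (length x) + 1)" if "x \<in> L" for x
      by (intro cup_degree) (use that Nil_notin in \<open>auto simp: algebra_simps\<close>)
    then show ?case
      by (auto simp: algebra_simps)
  next
    case (3 \<phi>)
    then show ?case by (rule direct)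
  next
    case (4 \<phi> \<psi>)
    then show ?case by (auto simp: total_diff_add)
  next
    case (5 \<phi> i)
    then show ?case
      using total_diff_degree[of \<phi> "i + 1"] by (auto simp: algebra_simps)
  next
    case (6 \<phi>)
    have "total_diff B (\<lambda>x. if x \<in> L then total_diff B \<phi> x else \<zero>) x = total_diff B (total_diff B \<phi>) x"
      if x: "x \<in> L" for x
    proof (rule total_diff_cong_subseq)
      fix y assume "subseq y x"
      then show "(if y \<in> L then total_diff B \<phi> y else \<zero>) = total_diff B \<phi> y"
        using 6 L_subseq[OF x, of y] Nil_notin by (cases "y = []") auto
    qed
    then show ?case
      using 6 by (auto simp: total_diff_total_diff)
  next
    case (7 \<phi> i \<psi>)
    let ?d = "\<lambda>\<phi> x. if x \<in> L then total_diff B \<phi> x else \<zero>"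
    have \<phi>: "\<And>y. \<phi> y \<in> carrier B" "\<phi> [] = \<zero>" and \<psi>: "\<And>y. \<psi> y \<in> carrier B" "\<psi> [] = \<zero>"
      using 7 Nil_notin grading_closed by auto
    have "total_diff B (\<lambda>x. if x \<in> L then cup B \<phi> \<psi> x else \<zero>) x =
        cup B (?d \<phi>) \<psi> x \<oplus> (if even i then cup B \<phi> (?d \<psi>) x else \<ominus> cup B \<phi> (?d \<psi>) x)" if x: "x \<in> L" for x
    proof -
      have "total_diff B (\<lambda>x. if x \<in> L then cup B \<phi> \<psi> x else \<zero>) x = total_diff B (cup B \<phi> \<psi>) x"
      proof (rule total_diff_cong_subseq)
        fix y assume "subseq y x"
        then show "(if y \<in> L then cup B \<phi> \<psi> y else \<zero>) = cup B \<phi> \<psi> y"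
          using L_subseq[OF x, of y] Nil_notin by (cases "y = []") auto
      qed
      \<comment> \<open>The correction term of \<open>total_diff_cup\<close> is a multiple of
        \<open>\<phi> []\<close>, which is zero because the empty list is not in
        \<open>L\<close>.\<close>
      also have "\<dots> = cup B (total_diff B \<phi>) \<psi> x \<oplus> cup B (total_parity B \<phi>) (total_diff B \<psi>) x"
        using \<phi> \<psi> by (subst total_diff_cup) (auto simp: a_minus_def)
      also have "cup B (total_diff B \<phi>) \<psi> x = cup B (?d \<phi>) \<psi> x"
        using x L_subseq[of x] by (intro cup_cong) auto
      also have "cup B (total_parity B \<phi>) (total_diff B \<psi>) x =
          cup B (\<lambda>y. if even i then \<phi> y else \<ominus> \<phi> y) (?d \<psi>) x"
        using x L_subseq[of x] 7 by (intro cup_cong total_parity_koszul) auto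
      also have "\<dots> = (if even i then cup B \<phi> (?d \<psi>) x else \<ominus> cup B \<phi> (?d \<psi>) x)"
        using \<phi> \<psi> by (simp add: cup_neg_left)
      finally show ?thesis .
    qed
    moreover have "\<phi> \<otimes>\<^bsub>cochains L B\<^esub> differential (cochains L B) \<psi> \<in> carrier (cochains L B)"
      using \<phi> \<psi> by auto
    then have "[koszul_sign i] \<cdot>\<^bsub>cochains L B\<^esub> (\<phi> \<otimes>\<^bsub>cochains L B\<^esub> differential (cochains L B) \<psi>) =
        (\<lambda>x. if even i then (\<phi> \<otimes>\<^bsub>cochains L B\<^esub> differential (cochains L B) \<psi>) x else
          \<ominus> (\<phi> \<otimes>\<^bsub>cochains L B\<^esub> differential (cochains L B) \<psi>) x)"
      by (simp only: K.koszul_sign_smult cochains_neg) (auto simp del: cochains_simps)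
    ultimately show ?case
      by (auto simp: fun_eq_iff)
  qed
qed

end

definition pullback :: "'u list set \<Rightarrow> ('b, 'm) dgring_scheme \<Rightarrow> ('u \<Rightarrow> 'v) \<Rightarrow> ('v list \<Rightarrow> 'b) \<Rightarrow> 'u list \<Rightarrow> 'b" where
  "pullback L B \<rho> \<phi> x = (if x \<in> L then \<phi> (map \<rho> x) else \<zero>\<^bsub>B\<^esub>)"

text \<open>The vertex map may collapse a simplex of \<open>L\<close> to a degenerate list. Product
  and differential of normalized cochains vanish there, in agreement with the value zero off
  \<open>L'\<close>.\<close>

lemma dg_hom_pullback:
  assumes B: "dg_ring B" and L: "subcomplex L" and L': "subcomplex L'"
    and \<rho>: "\<And>x. x \<in> L \<Longrightarrow> distinct_adj (map \<rho> x) \<Longrightarrow> map \<rho> x \<in> L'"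
  shows "dg_hom (cochains L' B) (cochains L B) (pullback L B \<rho>)"
proof -
  interpret K: cochain_algebra B L
    using B L by (simp add: cochain_algebra_def cochain_algebra_axioms_def)
  interpret K': cochain_algebra B L'
    using B L' by (simp add: cochain_algebra_def cochain_algebra_axioms_def)
  have nd: "y \<notin> L'" if "\<not> distinct_adj y" for y
    using that K'.L_distinct by blast
  have cup: "cup B (pullback L B \<rho> \<phi>) (pullback L B \<rho> \<psi>) x =
      (if map \<rho> x \<in> L' then cup B \<phi> \<psi> (map \<rho> x) else \<zero>\<^bsub>B\<^esub>)"
    if "x \<in> L" "\<phi> \<in> carrier (cochains L' B)" "\<psi> \<in> carrier (cochains L' B)" for x \<phi> \<psi>
  proof -
    have "cup B (pullback L B \<rho> \<phi>) (pullback L B \<rho> \<psi>) x =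
        cup B (\<lambda>y. \<phi> (map \<rho> y)) (\<lambda>y. \<psi> (map \<rho> y)) x"
      using K.L_subseq[OF that(1)] by (intro cup_cong) (auto simp: pullback_def)
    then have "cup B (pullback L B \<rho> \<phi>) (pullback L B \<rho> \<psi>) x = cup B \<phi> \<psi> (map \<rho> x)"
      by (simp only: cup_map)
    moreover have "cup B \<phi> \<psi> (map \<rho> x) = \<zero>\<^bsub>B\<^esub>" if "map \<rho> x \<notin> L'"
    proof (rule K.cup_zero_if_not_distinct_adj)
      show "\<not> distinct_adj (map \<rho> x)"
        using \<rho>[OF \<open>x \<in> L\<close>] that by blast
    qed (use \<open>\<phi> \<in> _\<close> \<open>\<psi> \<in> _\<close> nd in auto)
    ultimately show ?thesis
      by simp
  qed
  have diff: "total_diff B (pullback L B \<rho> \<phi>) x =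
      (if map \<rho> x \<in> L' then total_diff B \<phi> (map \<rho> x) else \<zero>\<^bsub>B\<^esub>)"
    if "x \<in> L" "\<phi> \<in> carrier (cochains L' B)" for x \<phi>
  proof -
    have "total_diff B (pullback L B \<rho> \<phi>) x = total_diff B (\<lambda>y. \<phi> (map \<rho> y)) x"
      using K.L_subseq[OF that(1)] that(2) K.Nil_notin K'.Nil_notin
      by (intro total_diff_cong_subseq) (force simp: pullback_def)
    then have "total_diff B (pullback L B \<rho> \<phi>) x = total_diff B \<phi> (map \<rho> x)"
      by (simp only: total_diff_map)
    moreover have "total_diff B \<phi> (map \<rho> x) = \<zero>\<^bsub>B\<^esub>" if "map \<rho> x \<notin> L'"
    proof (rule K.total_diff_zero_if_not_distinct_adj)
      show "\<not> distinct_adj (map \<rho> x)"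
        using \<rho>[OF \<open>x \<in> L\<close>] that by blast
    qed (use \<open>\<phi> \<in> _\<close> nd in auto)
    ultimately show ?thesis
      by simp
  qed
  show ?thesis
    unfolding dg_hom_def
  proof (intro conjI allI ballI image_subsetI)
    have "map \<rho> x \<in> L'" if "x \<in> L" "length x = Suc 0" for x
      using that \<rho>[of x] by (cases x) auto
    then show "pullback L B \<rho> \<in> ring_hom (cochains L' B) (cochains L B)"
      using cup by (intro ring_hom_memI) (auto simp: fun_eq_iff pullback_def)
  next
    fix i \<phi> assume "\<phi> \<in> grading (cochains L' B) i"
    then have "\<phi> (map \<rho> x) \<in> grading B (i + 1 - int (length (map \<rho> x)))" for x
      by (simp del: length_map)
    then show "pullback L B \<rho> \<phi> \<in> grading (cochains L B) i"
      by (auto simp: pullback_def)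
  next
    fix \<phi> assume "\<phi> \<in> carrier (cochains L' B)"
    then show "pullback L B \<rho> (differential (cochains L' B) \<phi>) = differential (cochains L B) (pullback L B \<rho> \<phi>)"
      using diff by (auto simp: fun_eq_iff pullback_def)
  qed
qed

lemma dg_hom_closed: "dg_hom A B f \<Longrightarrow> x \<in> carrier A \<Longrightarrow> f x \<in> carrier B"
  and dg_hom_add: "dg_hom A B f \<Longrightarrow> x \<in> carrier A \<Longrightarrow> y \<in> carrier A \<Longrightarrow> f (x \<oplus>\<^bsub>A\<^esub> y) = f x \<oplus>\<^bsub>B\<^esub> f y"
  and dg_hom_mult: "dg_hom A B f \<Longrightarrow> x \<in> carrier A \<Longrightarrow> y \<in> carrier A \<Longrightarrow> f (x \<otimes>\<^bsub>A\<^esub> y) = f x \<otimes>\<^bsub>B\<^esub> f y"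
  and dg_hom_one: "dg_hom A B f \<Longrightarrow> f \<one>\<^bsub>A\<^esub> = \<one>\<^bsub>B\<^esub>"
  and dg_hom_degree: "dg_hom A B f \<Longrightarrow> x \<in> grading A i \<Longrightarrow> f x \<in> grading B i"
  and dg_hom_differential: "dg_hom A B f \<Longrightarrow> x \<in> carrier A \<Longrightarrow> f (differential A x) = differential B (f x)"
  unfolding dg_hom_def ring_hom_def by blast+

lemma dg_hom_zero: "dg_ring A \<Longrightarrow> dg_ring B \<Longrightarrow> dg_hom A B f \<Longrightarrow> f \<zero>\<^bsub>A\<^esub> = \<zero>\<^bsub>B\<^esub>"
  by (auto simp: dg_hom_def dg_ring_def graded_ring_def intro: ring_hom_zero)

lemma dg_hom_neg:
  assumes "dg_ring A" "dg_ring B" "dg_hom A B f" "x \<in> carrier A"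
  shows "f (\<ominus>\<^bsub>A\<^esub> x) = \<ominus>\<^bsub>B\<^esub> f x"
proof -
  interpret A: dg_ring A by fact
  interpret B: dg_ring B by fact
  have "f (\<ominus>\<^bsub>A\<^esub> x) \<oplus>\<^bsub>B\<^esub> f x = \<zero>\<^bsub>B\<^esub>"
    using assms dg_hom_add[OF assms(3), of "\<ominus>\<^bsub>A\<^esub> x" x] by (simp add: A.l_neg dg_hom_zero)
  then show ?thesis
    using assms dg_hom_closed[OF assms(3)] by (simp add: B.minus_equality)
qed

lemma dg_hom_minus:
  assumes "dg_ring A" "dg_ring B" "dg_hom A B f" "x \<in> carrier A" "y \<in> carrier A"
  shows "f (x \<ominus>\<^bsub>A\<^esub> y) = f x \<ominus>\<^bsub>B\<^esub> f y"
proof -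
  interpret A: dg_ring A by fact
  show ?thesis
    using assms by (simp add: a_minus_def dg_hom_add dg_hom_neg)
qed

lemma dg_hom_comp:
  assumes "dg_hom A B f" "dg_hom B C g"
  shows "dg_hom A C (\<lambda>x. g (f x))"
  unfolding dg_hom_def
proof (intro conjI allI ballI image_subsetI)
  show "(\<lambda>x. g (f x)) \<in> ring_hom A C"
    using assms by (intro ring_hom_memI) (simp_all add: dg_hom_closed dg_hom_add dg_hom_mult dg_hom_one)
qed (use assms in \<open>simp_all add: dg_hom_closed dg_hom_degree dg_hom_differential\<close>)

lemma dg_hom_cong:
  assumes "dg_ring A" "dg_hom A B f" "\<And>x. x \<in> carrier A \<Longrightarrow> f x = g x"
  shows "dg_hom A B g"
proof -
  interpret A: dg_ring A by fact
  have "g \<in> ring_hom A B"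
    using assms by (intro ring_hom_memI)
      (simp_all add: assms(3)[symmetric] dg_hom_closed[OF assms(2)] dg_hom_add[OF assms(2)]
        dg_hom_mult[OF assms(2)] dg_hom_one[OF assms(2)])
  then show ?thesis
    using assms A.grading_closed unfolding dg_hom_def by (auto simp: image_subset_iff)
qed

text \<open>A homomorphism preserves degrees and hence commutes with \<open>parity\<close>;
  induction on the list then moves \<open>v\<close> through both recursions.\<close>

lemma dg_hom_coefficients:
  fixes L :: "'v list set"
  assumes "dg_ring B'" "dg_ring B" "dg_hom B' B v" "subcomplex L"
  shows "dg_hom (cochains L B') (cochains L B) (\<lambda>\<phi> x. v (\<phi> x))"
proof -
  interpret B': dg_ring B' by fact
  interpret B: dg_ring B by fact
  note h = dg_hom_closed[OF assms(3)] dg_hom_add[OF assms(3)] dg_hom_mult[OF assms(3)] dg_hom_one[OF assms(3)]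
    dg_hom_degree[OF assms(3)] dg_hom_differential[OF assms(3)] dg_hom_zero[OF assms(1-3)]
    dg_hom_neg[OF assms(1-3)] dg_hom_minus[OF assms(1-3)]
  have parity: "v (parity B' x) = parity B (v x)" if "x \<in> carrier B'" for x
    using that
  proof (induction x rule: B'.homogeneous_induct)
    case (homogeneous i x)
    then show ?case
      using B.parity_homogeneous[OF h(5)[of x i]]
      by (auto simp: B'.parity_homogeneous[of _ i] h B'.grading_closed)
  qed (simp add: h B'.parity_add B.parity_add)
  have cup: "v (cup B' \<phi> \<psi> x) = cup B (\<lambda>y. v (\<phi> y)) (\<lambda>y. v (\<psi> y)) x"
    if "\<And>y. \<phi> y \<in> carrier B'" "\<And>y. \<psi> y \<in> carrier B'" for \<phi> \<psi> and x :: "'v list"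
    using that by (induction x arbitrary: \<phi>) (simp_all add: h parity twist_def)
  have diff: "v (total_diff B' \<phi> x) = total_diff B (\<lambda>y. v (\<phi> y)) x"
    if "\<And>y. \<phi> y \<in> carrier B'" for \<phi> and x :: "'v list"
    using that by (induction x arbitrary: \<phi>) (simp_all add: h)
  show ?thesis
    unfolding dg_hom_def
  proof (intro conjI allI ballI image_subsetI)
    show "(\<lambda>\<phi> x. v (\<phi> x)) \<in> ring_hom (cochains L B') (cochains L B)"
      by (intro ring_hom_memI) (auto simp: h cup fun_eq_iff)
  qed (auto simp: h diff fun_eq_iff)
qed

section \<open>Evaluation of formal sums\<close>

text \<open>The homomorphism from the free abelian group on the keys to \<open>G\<close> that
  extends \<open>g\<close>. It serves twice: to evaluate tensors at a simplex, and noncommutative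
  polynomials at ring elements.\<close>

definition frag_eval :: "('b, 'm) ring_scheme \<Rightarrow> ('k \<Rightarrow> 'b) \<Rightarrow> ('k \<Rightarrow>\<^sub>0 int) \<Rightarrow> 'b" where
  "frag_eval G g c = finsum G (\<lambda>k. [Poly_Mapping.lookup c k] \<cdot>\<^bsub>G\<^esub> g k) (Poly_Mapping.keys c)"

context abelian_group
begin

lemma int_smult_zero [simp]: "[(0::int)] \<cdot> x = \<zero>"
  by (simp add: add_pow_def)

lemma frag_eval_superset:
  assumes "finite F" "Poly_Mapping.keys c \<subseteq> F" "\<And>k. k \<in> F \<Longrightarrow> g k \<in> carrier G"
  shows "frag_eval G g c = finsum G (\<lambda>k. [Poly_Mapping.lookup c k] \<cdot> g k) F"
  unfolding frag_eval_def
  by (rule add.finprod_mono_neutral_cong_left) (use assms in \<open>auto simp: in_keys_iff\<close>)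

lemma frag_eval_closed:
  "(\<And>k. k \<in> Poly_Mapping.keys c \<Longrightarrow> g k \<in> carrier G) \<Longrightarrow> frag_eval G g c \<in> carrier G"
  unfolding frag_eval_def by (auto intro!: finsum_closed)

lemma frag_eval_zero [simp]: "frag_eval G g 0 = \<zero>"
  by (simp add: frag_eval_def)

lemma frag_eval_of: "g k \<in> carrier G \<Longrightarrow> frag_eval G g (frag_of k) = g k"
  by (simp add: frag_eval_def)

lemma frag_eval_cong:
  "(\<And>k. k \<in> Poly_Mapping.keys c \<Longrightarrow> g k = g' k) \<Longrightarrow> (\<And>k. k \<in> Poly_Mapping.keys c \<Longrightarrow> g' k \<in> carrier G) \<Longrightarrow>
    frag_eval G g c = frag_eval G g' c"
  unfolding frag_eval_def by (auto intro!: finsum_cong')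

context
  fixes S :: "'k set" and g :: "'k \<Rightarrow> 'a"
  assumes g: "\<And>k. k \<in> S \<Longrightarrow> g k \<in> carrier G"
begin

lemma frag_eval_add:
  assumes "Poly_Mapping.keys c \<subseteq> S" "Poly_Mapping.keys c' \<subseteq> S"
  shows "frag_eval G g (c + c') = frag_eval G g c \<oplus> frag_eval G g c'"
proof -
  let ?F = "Poly_Mapping.keys c \<union> Poly_Mapping.keys c'"
  have F: "finite ?F" "\<And>k. k \<in> ?F \<Longrightarrow> g k \<in> carrier G"
    using assms g by auto
  have "frag_eval G g (c + c') =
      finsum G (\<lambda>k. [Poly_Mapping.lookup c k] \<cdot> g k \<oplus> [Poly_Mapping.lookup c' k] \<cdot> g k) ?F"
    using F keys_add[of c c']
    by (intro trans[OF frag_eval_superset[of ?F] finsum_cong']) (auto simp: lookup_add add.int_pow_mult)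
  also have "\<dots> = frag_eval G g c \<oplus> frag_eval G g c'"
    using F frag_eval_superset[of ?F c g] frag_eval_superset[of ?F c' g]
    by (subst finsum_addf) auto
  finally show ?thesis .
qed

lemma frag_eval_cmul:
  assumes "Poly_Mapping.keys c \<subseteq> S"
  shows "frag_eval G g (frag_cmul n c) = [n] \<cdot> frag_eval G g c"
proof -
  have fin: "[n] \<cdot> finsum G f F = finsum G (\<lambda>k. [n] \<cdot> f k) F"
    if "finite F" "\<And>k. k \<in> F \<Longrightarrow> f k \<in> carrier G" for f :: "'k \<Rightarrow> 'a" and F
    using that by (induction F rule: finite_induct) (auto simp: finsum_insert add.int_pow_distrib Pi_iff)
  have "frag_eval G g (frag_cmul n c) =
      finsum G (\<lambda>k. [n] \<cdot> ([Poly_Mapping.lookup c k] \<cdot> g k)) (Poly_Mapping.keys c)"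
    using assms g keys_cmul[of n c]
    by (subst frag_eval_superset[of "Poly_Mapping.keys c"])
      (auto simp: add.int_pow_pow mult.commute intro!: finsum_cong')
  then show ?thesis
    unfolding frag_eval_def using assms g by (subst fin) auto
qed

lemma frag_eval_diff:
  assumes "Poly_Mapping.keys c \<subseteq> S" "Poly_Mapping.keys c' \<subseteq> S"
  shows "frag_eval G g (c - c') = frag_eval G g c \<ominus> frag_eval G g c'"
proof -
  have "frag_eval G g c' \<in> carrier G"
    using assms g by (auto intro: frag_eval_closed)
  then show ?thesis
    using frag_eval_add[of c "frag_cmul (-1) c'"] frag_eval_cmul[of c' "-1"] assms
      add.int_pow_neg[of "frag_eval G g c'" 1]
    by (simp add: a_minus_def)
qed

lemma frag_eval_sum:
  assumes "finite I" "\<And>i. i \<in> I \<Longrightarrow> Poly_Mapping.keys (f i) \<subseteq> S"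
  shows "frag_eval G g (sum f I) = finsum G (\<lambda>i. frag_eval G g (f i)) I"
  using assms
proof (induction I rule: finite_induct)
  case (insert i I)
  have "Poly_Mapping.keys (sum f I) \<subseteq> S"
    using insert.prems sum_closed_free_Abelian_group[of I f S] by simp
  moreover have "frag_eval G g (f j) \<in> carrier G" if "j \<in> insert i I" for j
    using insert.prems that g by (intro frag_eval_closed) auto
  ultimately show ?case
    using insert by (simp add: frag_eval_add finsum_insert Pi_iff)
qed simp

end

end

section \<open>Normalized cochains of standard simplices\<close>

text \<open>The nondegenerate simplices of the standard simplex in all dimensions at once; the
  dimension is read off from the length of the list.\<close>

definition nondeg :: "nat \<Rightarrow> nat list set" where
  "nondeg q = {x. x \<noteq> [] \<and> sorted_wrt (<) x \<and> set x \<subseteq> {..q}}"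

lemma sorted_wrt_less_iff: "sorted_wrt (<) (x :: nat list) \<longleftrightarrow> sorted x \<and> distinct_adj x"
proof (induction x)
  case (Cons a x)
  then show ?case
    by (cases x) (auto simp: less_le dest: order.strict_trans1)
qed simp

lemma set_mono_subseq: "subseq y x \<Longrightarrow> set y \<subseteq> set x"
  by (induction rule: list_emb.induct) auto

lemma sorted_wrt_subseq: "sorted_wrt P x \<Longrightarrow> subseq y x \<Longrightarrow> sorted_wrt P y"
proof (induction x arbitrary: y)
  case (Cons a x)
  show ?case
  proof (cases y)
    case (Cons b z)
    then show ?thesis
      using Cons.prems Cons.IH[of y] Cons.IH[of z]
      by (cases "b = a") (auto simp: subseq_Cons2_iff dest: set_mono_subseq)
  qed simp
qed (auto dest: list_emb_length)

lemma finite_nondeg: "finite (nondeg q)"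
proof (rule finite_subset)
  show "nondeg q \<subseteq> {x. distinct x \<and> set x \<subseteq> {..q}}"
    by (auto simp: nondeg_def strict_sorted_iff)
  show "finite {x. distinct x \<and> set x \<subseteq> {..q}}"
    using finite_subset_distinct[of "{..q}"] by (simp add: conj_commute)
qed

lemma subcomplexI_nondeg:
  assumes "L \<subseteq> nondeg q" "\<And>x y. x \<in> L \<Longrightarrow> subseq y x \<Longrightarrow> y \<noteq> [] \<Longrightarrow> y \<in> L"
  shows "subcomplex L"
  using assms finite_subset[OF assms(1) finite_nondeg]
  unfolding subcomplex_def by (auto simp: nondeg_def sorted_wrt_less_iff)

lemma nondeg_subseq: "x \<in> nondeg q \<Longrightarrow> subseq y x \<Longrightarrow> y \<noteq> [] \<Longrightarrow> y \<in> nondeg q"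
  using sorted_wrt_subseq set_mono_subseq unfolding nondeg_def by blast

lemma subcomplex_nondeg: "subcomplex (nondeg q)"
  by (rule subcomplexI_nondeg[OF order_refl nondeg_subseq])

lemma nondeg_iff: "x \<in> nondeg q \<longleftrightarrow> x \<in> monotone_maps (length x - 1) q \<and> distinct_adj x"
  by (auto simp: nondeg_def monotone_maps_def sorted_wrt_less_iff)

lemma degenerate_std_simplex:
  "x \<in> monotone_maps p q \<Longrightarrow> degenerate (std_simplex q) p x \<longleftrightarrow> \<not> distinct_adj x"
proof
  assume "degenerate (std_simplex q) p x"
  then obtain m i y where "p = Suc m" "i \<le> m" "y \<in> monotone_maps m q"
    and x: "x = map (\<lambda>j. y ! j) ([0..<Suc i] @ [i..<Suc m])"
    by (auto simp: degenerate_def degen_def std_simplex_def monotone_comp_def)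
  then have "x = map ((!) y) [0..<i] @ [y ! i, y ! i] @ map ((!) y) [Suc i..<Suc m]"
    using upt_conv_Cons[of i "Suc m"] upt_Suc_append[of 0 i] by (simp del: upt_Suc)
  then show "\<not> distinct_adj x"
    by (simp add: distinct_adj_append_iff del: upt_Suc)
next
  assume x: "x \<in> monotone_maps p q" and "\<not> distinct_adj x"
  then obtain i where i: "Suc i < length x" "x ! i = x ! Suc i"
    by (auto simp: distinct_adj_conv_nth)
  have len: "length x = Suc p"
    using x by (simp add: monotone_maps_def)
  define m where "m = p - 1"
  have p: "p = Suc m" "i \<le> m"
    using i len by (auto simp: m_def)
  \<comment> \<open>Dropping one of the two equal entries gives the simplex whose degeneracy at
    \<open>i\<close> is \<open>x\<close>.\<close>
  define y where "y = take i x @ drop (Suc i) x"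
  have "subseq y x"
    unfolding y_def by (rule subseq_remove)
  then have "y \<in> monotone_maps m q"
    using x len p sorted_wrt_subseq[of "(\<le>)" x y] set_mono_subseq[of y x]
    by (auto simp: monotone_maps_def y_def)
  moreover have "x = map (\<lambda>j. y ! j) ([0..<Suc i] @ [i..<Suc m])"
  proof (rule nth_equalityI)
    show "length x = length (map (\<lambda>j. y ! j) ([0..<Suc i] @ [i..<Suc m]))"
      using len p by simp
    fix k assume k: "k < length x"
    consider "k < i" | "k = i" | "Suc i \<le> k"
      by linarith
    then show "x ! k = map (\<lambda>j. y ! j) ([0..<Suc i] @ [i..<Suc m]) ! k"
    proof cases
      case 3
      then have "map (\<lambda>j. y ! j) ([0..<Suc i] @ [i..<Suc m]) ! k = y ! (k - 1)"
        using k len p by (simp add: nth_append del: upt_Suc)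
      also have "\<dots> = x ! k"
        using 3 k i linorder_not_less[of "k - 1" i] by (auto simp: y_def nth_append)
      finally show ?thesis by simp
    qed (use k i in \<open>simp_all add: nth_append y_def del: upt_Suc\<close>)
  qed
  ultimately show "degenerate (std_simplex q) p x"
    using p by (auto simp: degenerate_def degen_def std_simplex_def monotone_comp_def)
qed

lemma normalized_cochains_std_simplex:
  "normalized_cochains (std_simplex q) = {\<phi>. \<forall>p x. \<phi> p x \<noteq> 0 \<longrightarrow> x \<in> nondeg q \<and> length x = Suc p}"
proof (intro equalityI subsetI CollectI)
  fix \<phi> assume \<phi>: "\<phi> \<in> normalized_cochains (std_simplex q)"
  show "\<forall>p x. \<phi> p x \<noteq> 0 \<longrightarrow> x \<in> nondeg q \<and> length x = Suc p"
  proof (intro allI impI)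
    fix p x assume "\<phi> p x \<noteq> 0"
    then have "x \<in> monotone_maps p q" "\<not> degenerate (std_simplex q) p x"
      using \<phi> by (auto simp: normalized_cochains_def std_simplex_def)
    then show "x \<in> nondeg q \<and> length x = Suc p"
      by (auto simp: degenerate_std_simplex nondeg_iff monotone_maps_def)
  qed
next
  fix \<phi> :: "nat \<Rightarrow> nat list \<Rightarrow> int"
  assume \<phi>: "\<phi> \<in> {\<phi>. \<forall>p x. \<phi> p x \<noteq> 0 \<longrightarrow> x \<in> nondeg q \<and> length x = Suc p}"
  have "{p. \<phi> p \<noteq> (\<lambda>_. 0)} \<subseteq> (\<lambda>x. length x - 1) ` nondeg q"
    using \<phi> by (force simp: fun_eq_iff image_iff)
  then have "finite {p. \<phi> p \<noteq> (\<lambda>_. 0)}"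
    using finite_nondeg finite_surj by blast
  moreover have "\<phi> p x = 0" if "x \<notin> simplices (std_simplex q) p \<or> degenerate (std_simplex q) p x" for p x
  proof (rule ccontr)
    assume "\<phi> p x \<noteq> 0"
    then have "x \<in> nondeg q" "length x = Suc p"
      using \<phi> by auto
    then show False
      using that degenerate_std_simplex[of x p q] by (auto simp: nondeg_iff std_simplex_def)
  qed
  ultimately show "\<phi> \<in> normalized_cochains (std_simplex q)"
    by (auto simp: normalized_cochains_def)
qed

lemma std_simplex_simps [simp]:
  "simplices (std_simplex q) p = monotone_maps p q"
  "simplicial_op (std_simplex q) n \<theta> x = monotone_comp x \<theta>"
  by (simp_all add: std_simplex_def)

lemma face_std_simplex:
  assumes "length x = Suc n" "i \<le> n"
  shows "face (std_simplex q) n i x = take i x @ drop (Suc i) x"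
proof -
  have "map ((!) x) [0..<i] = take i x"
    using assms by (intro nth_equalityI) auto
  moreover have "map ((!) x) [Suc i..<Suc n] = drop (Suc i) x"
    using assms by (intro nth_equalityI) (auto simp del: upt_Suc)
  ultimately show ?thesis
    by (simp add: face_def monotone_comp_def del: upt_Suc)
qed

lemma front_face_std_simplex:
  assumes "length x = Suc (p + r)"
  shows "front_face (std_simplex q) p r x = take (Suc p) x"
  unfolding front_face_def std_simplex_simps monotone_comp_def
  using assms by (intro nth_equalityI) (auto simp del: upt_Suc)

lemma back_face_std_simplex:
  assumes "length x = Suc (p + r)"
  shows "back_face (std_simplex q) p r x = drop p x"
  unfolding back_face_def std_simplex_simps monotone_comp_def
  using assms by (intro nth_equalityI) (auto simp del: upt_Suc)

section \<open>Integer cochains evaluated on vertex lists\<close>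

abbreviation simplex_cochains :: "nat \<Rightarrow> (nat \<Rightarrow> nat list \<Rightarrow> int) dgring" where
  "simplex_cochains q \<equiv> cochain_ring (std_simplex q)"

text \<open>A normalized cochain in degree p vanishes on lists of any length but p + 1, so
  evaluating in the degree given by the length loses nothing.\<close>

definition value_at :: "(nat \<Rightarrow> nat list \<Rightarrow> int) \<Rightarrow> nat list \<Rightarrow> int" where
  "value_at a x = a (length x - 1) x"

definition indicator_cochain :: "nat list \<Rightarrow> nat \<Rightarrow> nat list \<Rightarrow> int" where
  "indicator_cochain \<sigma> p x = (if x = \<sigma> \<and> length \<sigma> = Suc p then 1 else 0)"

lemma simplex_cochains_carrier:
  "carrier (simplex_cochains q) = {a. \<forall>p x. a p x \<noteq> 0 \<longrightarrow> x \<in> nondeg q \<and> length x = Suc p}"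
  by (simp add: cochain_ring_def normalized_cochains_std_simplex)

lemma simplex_cochains_simps [simp]:
  "ring.zero (simplex_cochains q) = (\<lambda>n x. 0)"
  "add (simplex_cochains q) = (\<lambda>a b n x. a n x + b n x)"
  "grading (simplex_cochains q) i = {a \<in> carrier (simplex_cochains q). \<forall>p. int p \<noteq> i \<longrightarrow> a p = (\<lambda>_. 0)}"
  by (simp_all add: cochain_ring_def)

lemma value_at_outside: "a \<in> carrier (simplex_cochains q) \<Longrightarrow> x \<notin> nondeg q \<Longrightarrow> value_at a x = 0"
  by (auto simp: simplex_cochains_carrier value_at_def)

lemma indicator_cochain_closed: "\<sigma> \<in> nondeg q \<Longrightarrow> indicator_cochain \<sigma> \<in> carrier (simplex_cochains q)"
  by (auto simp: simplex_cochains_carrier indicator_cochain_def)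

lemma value_at_indicator: "\<sigma> \<in> nondeg q \<Longrightarrow> value_at (indicator_cochain \<sigma>) x = (if x = \<sigma> then 1 else 0)"
  by (auto simp: value_at_def indicator_cochain_def nondeg_def Suc_diff_le length_greater_0_conv[symmetric]
      simp del: length_greater_0_conv)

lemma value_at_add [simp]: "value_at (\<lambda>n x. a n x + b n x) x = value_at a x + value_at b x"
  by (simp add: value_at_def)

lemma value_at_zero [simp]: "value_at (\<lambda>n x. 0) x = 0"
  by (simp add: value_at_def)

lemma abelian_group_simplex_cochains: "abelian_group (simplex_cochains q)"
proof (rule abelian_groupI)
  fix a assume "a \<in> carrier (simplex_cochains q)"
  then show "\<exists>b\<in>carrier (simplex_cochains q). b \<oplus>\<^bsub>simplex_cochains q\<^esub> a = \<zero>\<^bsub>simplex_cochains q\<^esub>"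
    by (intro bexI[of _ "\<lambda>p x. - a p x"]) (auto simp: simplex_cochains_carrier)
next
  fix a b assume "a \<in> carrier (simplex_cochains q)" "b \<in> carrier (simplex_cochains q)"
  then show "a \<oplus>\<^bsub>simplex_cochains q\<^esub> b \<in> carrier (simplex_cochains q)"
    by (auto simp: simplex_cochains_carrier) (metis add.right_neutral)+
qed (auto simp: simplex_cochains_carrier add_ac)

lemma finsum_simplex_cochains:
  assumes "finite F" "\<And>i. i \<in> F \<Longrightarrow> c i \<in> carrier (simplex_cochains q)"
  shows "finsum (simplex_cochains q) c F = (\<lambda>p x. \<Sum>i\<in>F. c i p x)"
proof -
  interpret N: abelian_group "simplex_cochains q"
    by (rule abelian_group_simplex_cochains)
  show ?thesis
    using assms by (induction F rule: finite_induct) (auto simp: N.finsum_insert Pi_iff)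
qed

lemma graded_group_simplex_cochains: "graded_group (simplex_cochains q)"
proof -
  interpret N: abelian_group "simplex_cochains q"
    by (rule abelian_group_simplex_cochains)
  have neg: "\<ominus>\<^bsub>simplex_cochains q\<^esub> a = (\<lambda>p x. - a p x)" if "a \<in> carrier (simplex_cochains q)" for a
    by (rule N.minus_equality) (use that in \<open>auto simp: simplex_cochains_carrier\<close>)
  show ?thesis
  proof (rule graded_group.intro[OF N.abelian_group_axioms graded_group_axioms.intro])
    fix i
    show "subgroup (grading (simplex_cochains q) i) (add_monoid (simplex_cochains q))"
    proof (rule N.add.subgroupI)
      show "grading (simplex_cochains q) i \<noteq> {}"
        by (auto simp: simplex_cochains_carrier intro!: exI[of _ "\<lambda>p x. 0"])
    next
      fix a assume "a \<in> grading (simplex_cochains q) i"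
      then show "\<ominus>\<^bsub>simplex_cochains q\<^esub> a \<in> grading (simplex_cochains q) i"
        by (auto simp: neg fun_eq_iff simplex_cochains_carrier)
    next
      fix a b assume "a \<in> grading (simplex_cochains q) i" "b \<in> grading (simplex_cochains q) i"
      then show "a \<oplus>\<^bsub>simplex_cochains q\<^esub> b \<in> grading (simplex_cochains q) i"
        using N.a_closed[of a b] by (auto simp: fun_eq_iff)
    qed auto
  next
    fix a assume a: "a \<in> carrier (simplex_cochains q)"
    let ?c = "\<lambda>i p. if int p = i then a p else (\<lambda>_. 0)"
    have finF: "finite {p. a p \<noteq> (\<lambda>_. 0)}"
      using a by (simp add: cochain_ring_def normalized_cochains_def)
    have N_eq: "{i. ?c i \<noteq> \<zero>\<^bsub>simplex_cochains q\<^esub>} = int ` {p. a p \<noteq> (\<lambda>_. 0)}"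
      by (force simp: fun_eq_iff)
    have c: "?c i \<in> grading (simplex_cochains q) i" for i
      using a by (auto simp: simplex_cochains_carrier)
    show "\<exists>!c. homogeneous_decomposition (simplex_cochains q) a c"
    proof (rule ex1I)
      have "a p x = (\<Sum>i\<in>int ` {p. a p \<noteq> (\<lambda>_. 0)}. ?c i p x)" for p x
        using finF by (subst sum.reindex) (auto simp: sum.delta' if_distrib[of "\<lambda>f. f x"] cong: if_cong)
      then show "homogeneous_decomposition (simplex_cochains q) a ?c"
        unfolding homogeneous_decomposition_def N_eq using c finF
        by (subst finsum_simplex_cochains) auto
    next
      fix c assume c: "homogeneous_decomposition (simplex_cochains q) a c"
      let ?N = "{i. c i \<noteq> \<zero>\<^bsub>simplex_cochains q\<^esub>}"
      have cg: "c i \<in> grading (simplex_cochains q) i" and finN: "finite ?N"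
        and sum: "a = finsum (simplex_cochains q) c ?N" for i
        using c unfolding homogeneous_decomposition_def by blast+
      have "a = (\<lambda>p x. \<Sum>i\<in>?N. c i p x)"
        using finsum_simplex_cochains[OF finN, of c q] cg sum by auto
      moreover have "(\<Sum>i\<in>?N. c i p x) = (\<Sum>i\<in>?N. if i = int p then c (int p) p x else 0)" for p x
        using cg by (intro sum.cong) (auto simp: fun_eq_iff)
      ultimately have "a p x = c (int p) p x" for p x
        using finN by (auto simp: sum.delta fun_eq_iff)
      then show "c = ?c"
        using cg by (auto simp: fun_eq_iff)
    qed
  qed
qed

text \<open>The integer counterpart of \<open>total_diff\<close> without its coefficient part. The
  common recursion lets the two differentials be compared by induction on the list.\<close>

fun alternating_sum :: "(nat list \<Rightarrow> int) \<Rightarrow> nat list \<Rightarrow> int" where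
  "alternating_sum f [] = 0"
| "alternating_sum f (a # x) = f x - alternating_sum (\<lambda>y. f (a # y)) x"

lemma alternating_sum_eq: "alternating_sum f x = (\<Sum>i<length x. (-1) ^ i * f (take i x @ drop (Suc i) x))"
  by (induction x arbitrary: f) (simp_all add: sum.lessThan_Suc_shift sum_negf del: sum.lessThan_Suc)

lemma alternating_sum_zero [simp]: "alternating_sum (\<lambda>_. 0) x = 0"
  by (induction x) simp_all

lemma alternating_sum_degenerate:
  assumes "\<And>y. \<not> distinct_adj y \<Longrightarrow> f y = 0" "\<not> distinct_adj x"
  shows "alternating_sum f x = 0"
  using assms
proof (induction x arbitrary: f)
  case (Cons a x)
  show ?case
  proof (cases "distinct_adj x")
    case False
    moreover have "f (a # y) = 0" if "\<not> distinct_adj y" for y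
      using Cons.prems(1)[of "a # y"] that by (cases y) auto
    ultimately have "alternating_sum (\<lambda>y. f (a # y)) x = 0"
      using Cons.prems by (intro Cons.IH) auto
    then show ?thesis
      using Cons.prems False by simp
  next
    case True
    then obtain z where x: "x = a # z"
      using Cons.prems by (auto simp: distinct_adj_Cons neq_Nil_conv)
    then show ?thesis
      using Cons.prems by simp
  qed
qed simp

lemma value_at_differential:
  assumes a: "a \<in> carrier (simplex_cochains q)" and x: "x \<in> nondeg q"
  shows "value_at (differential (simplex_cochains q) a) x = alternating_sum (value_at a) x"
proof (cases "length x - 1")
  \<comment> \<open>At a vertex the differential is zero by definition, and the only face is the
    empty list, where cochains vanish.\<close>
  case 0
  then obtain v where "x = [v]"
    using x by (cases x) (auto simp: nondeg_def)
  then show ?thesis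
    using value_at_outside[OF a, of "[]"] by (auto simp: value_at_def cochain_ring_def nondeg_def)
next
  case (Suc p)
  have len: "length x = Suc (Suc p)"
    using Suc by simp
  have xm: "x \<in> monotone_maps (Suc p) q"
    using x len by (simp add: nondeg_iff)
  have "value_at (differential (simplex_cochains q) a) x =
      (\<Sum>i\<le>Suc p. (-1) ^ i * a p (face (std_simplex q) (Suc p) i x))"
    using Suc xm by (simp add: value_at_def cochain_ring_def)
  also have "\<dots> = (\<Sum>i\<le>Suc p. (-1) ^ i * value_at a (take i x @ drop (Suc i) x))"
    using len by (intro sum.cong refl) (auto simp: face_std_simplex value_at_def)
  finally show ?thesis
    unfolding alternating_sum_eq len lessThan_Suc_atMost by simp
qed

lemma differential_simplex_cochains_closed:
  assumes a: "a \<in> carrier (simplex_cochains q)"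
  shows "differential (simplex_cochains q) a \<in> carrier (simplex_cochains q)"
  unfolding simplex_cochains_carrier
proof (intro CollectI allI impI)
  fix n x assume nz: "differential (simplex_cochains q) a n x \<noteq> 0"
  then obtain p where n: "n = Suc p" and x: "x \<in> monotone_maps (Suc p) q"
    by (cases n) (auto simp: cochain_ring_def split: if_splits)
  then have len: "length x = Suc (Suc p)"
    by (simp add: monotone_maps_def)
  have "differential (simplex_cochains q) a n x =
      (\<Sum>i\<le>Suc p. (-1) ^ i * a p (face (std_simplex q) (Suc p) i x))"
    using n x by (simp add: cochain_ring_def)
  also have "\<dots> = (\<Sum>i\<le>Suc p. (-1) ^ i * value_at a (take i x @ drop (Suc i) x))"
    using len by (intro sum.cong refl) (auto simp: face_std_simplex value_at_def)
  also have "\<dots> = alternating_sum (value_at a) x"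
    unfolding alternating_sum_eq len lessThan_Suc_atMost by simp
  finally have "alternating_sum (value_at a) x \<noteq> 0"
    using nz by simp
  moreover have "value_at a y = 0" if "\<not> distinct_adj y" for y
    using value_at_outside[OF a, of y] that by (auto simp: nondeg_iff)
  ultimately have "distinct_adj x"
    using alternating_sum_degenerate by blast
  then show "x \<in> nondeg q \<and> length x = Suc n"
    using x n len by (simp add: nondeg_iff)
qed

text \<open>The two parts overlap in the entry at \<open>p\<close>, which links them by
  transitivity. Thus a product is supported on nondegenerate simplices if its factors are.\<close>

lemma sorted_wrt_take_drop:
  assumes "transp P" "p < length x" "sorted_wrt P (take (Suc p) x)" "sorted_wrt P (drop p x)"
  shows "sorted_wrt P x"
proof -
  have x: "x = take p x @ x ! p # drop (Suc p) x"
    by (rule id_take_nth_drop[OF assms(2)])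
  have 1: "sorted_wrt P (take p x @ [x ! p])"
    using assms(2,3) by (simp add: take_Suc_conv_app_nth)
  have 2: "sorted_wrt P (x ! p # drop (Suc p) x)"
    using assms(2,4) by (simp add: Cons_nth_drop_Suc)
  show ?thesis
    using 1 2 assms(1) by (subst x) (auto simp: sorted_wrt_append dest: transpD)
qed

lemma mult_simplex_cochains_closed:
  assumes "a \<in> carrier (simplex_cochains q)" "b \<in> carrier (simplex_cochains q)"
  shows "a \<otimes>\<^bsub>simplex_cochains q\<^esub> b \<in> carrier (simplex_cochains q)"
  unfolding simplex_cochains_carrier
proof (intro CollectI allI impI)
  fix n x assume nz: "(a \<otimes>\<^bsub>simplex_cochains q\<^esub> b) n x \<noteq> 0"
  then have x: "x \<in> monotone_maps n q"
    by (auto simp: cochain_ring_def split: if_splits)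
  have "(\<Sum>p\<le>n. a p (front_face (std_simplex q) p (n - p) x) *
      b (n - p) (back_face (std_simplex q) p (n - p) x)) \<noteq> 0"
    using nz x by (simp add: cochain_ring_def)
  then obtain p where "p \<in> {..n}" "a p (front_face (std_simplex q) p (n - p) x) *
      b (n - p) (back_face (std_simplex q) p (n - p) x) \<noteq> 0"
    by (rule sum.not_neutral_contains_not_neutral)
  then have p: "p \<le> n" "a p (take (Suc p) x) \<noteq> 0" "b (n - p) (drop p x) \<noteq> 0"
    using x by (simp_all add: front_face_std_simplex back_face_std_simplex monotone_maps_def)
  then have "take (Suc p) x \<in> nondeg q" "drop p x \<in> nondeg q"
    using assms by (auto simp: simplex_cochains_carrier)
  then have s: "sorted_wrt (<) (take (Suc p) x)" "sorted_wrt (<) (drop p x)"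
    by (simp_all only: nondeg_def mem_Collect_eq)
  have "p < length x"
    using p(1) x by (simp add: monotone_maps_def)
  from sorted_wrt_take_drop[OF _ this s] have "sorted_wrt (<) x"
    by simp
  then show "x \<in> nondeg q \<and> length x = Suc n"
    using x by (auto simp: nondeg_def monotone_maps_def)
qed

lemma one_simplex_cochains_closed: "\<one>\<^bsub>simplex_cochains q\<^esub> \<in> carrier (simplex_cochains q)"
  unfolding simplex_cochains_carrier
  by (auto simp: cochain_ring_def nondeg_def monotone_maps_def length_Suc_conv split: if_splits)

lemma value_at_one:
  "x \<in> nondeg q \<Longrightarrow> value_at \<one>\<^bsub>simplex_cochains q\<^esub> x = (if length x = Suc 0 then 1 else 0)"
  by (cases x) (auto simp: value_at_def cochain_ring_def nondeg_def monotone_maps_def)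

text \<open>A second factor of degree \<open>j\<close> selects the one splitting whose back face has
  \<open>j + 1\<close> vertices; the front face ends in the first vertex of the back face.\<close>

lemma value_at_mult_homogeneous:
  assumes a: "a \<in> carrier (simplex_cochains q)" and b: "b \<in> grading (simplex_cochains q) (int j)"
    and x: "x \<in> nondeg q"
  shows "value_at (a \<otimes>\<^bsub>simplex_cochains q\<^esub> b) x =
    (if j < length x then value_at a (take (length x - j) x) * value_at b (drop (length x - Suc j) x) else 0)"
proof -
  obtain n where n: "length x = Suc n"
    using x by (cases x) (auto simp: nondeg_def)
  have xm: "x \<in> monotone_maps n q"
    using x n by (simp add: nondeg_iff)
  have bz: "b r = (\<lambda>_. 0)" if "r \<noteq> j" for r
    using b that by auto
  have "value_at (a \<otimes>\<^bsub>simplex_cochains q\<^esub> b) x =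
      (\<Sum>p\<le>n. a p (front_face (std_simplex q) p (n - p) x) * b (n - p) (back_face (std_simplex q) p (n - p) x))"
    using n xm by (simp add: value_at_def cochain_ring_def)
  also have "\<dots> = (\<Sum>p\<le>n. if p + j = n then a p (take (Suc p) x) * b j (drop p x) else 0)"
    using n by (intro sum.cong refl) (auto simp: front_face_std_simplex back_face_std_simplex bz)
  also have "\<dots> = (\<Sum>p\<le>n. if p = n - j then (if j \<le> n then a p (take (Suc p) x) * b j (drop p x) else 0) else 0)"
    by (intro sum.cong refl) auto
  also have "\<dots> = (if j \<le> n then a (n - j) (take (Suc (n - j)) x) * b j (drop (n - j) x) else 0)"
    by simp
  also have "\<dots> = (if j < length x then value_at a (take (length x - j) x) * value_at b (drop (length x - Suc j) x) else 0)"
    using n by (auto simp: value_at_def Suc_diff_le)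
  finally show ?thesis .
qed

section \<open>Cylinders as cochains with coefficients\<close>

lemma tensor_class_eq: "tensor_class A B c = {r + c | r. r \<in> tensor_relations A B}"
  by (auto simp: tensor_class_def tensor_free_def r_coset_def)

text \<open>On representatives, the additive map that sends a pair (a, b) to the integer a(x) times
  b. It turns out to depend only on the tensor, and its values at all \<open>x\<close> determine the
  tensor.\<close>

definition coefficient :: "('b, 'm) dgring_scheme \<Rightarrow> ((nat \<Rightarrow> nat list \<Rightarrow> int) \<times> 'b \<Rightarrow>\<^sub>0 int) \<Rightarrow> nat list \<Rightarrow> 'b" where
  "coefficient B c x = frag_eval B (\<lambda>(a, b). [value_at a x] \<cdot>\<^bsub>B\<^esub> b) c"

lemma (in ring) int_smult_l_assoc:
  assumes "x \<in> carrier R" "y \<in> carrier R"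
  shows "([n] \<cdot> x) \<otimes> y = [(n::int)] \<cdot> (x \<otimes> y)"
proof -
  interpret h: group_hom "add_monoid R" "add_monoid R" "\<lambda>x. x \<otimes> y"
    using assms(2) a_group by (auto simp: group_hom_def group_hom_axioms_def hom_def l_distr)
  show ?thesis
    using h.hom_int_pow[of x n] assms(1) by (simp add: add_pow_def)
qed

lemma (in ring) int_smult_r_assoc:
  assumes "x \<in> carrier R" "y \<in> carrier R"
  shows "x \<otimes> ([n] \<cdot> y) = [(n::int)] \<cdot> (x \<otimes> y)"
proof -
  interpret h: group_hom "add_monoid R" "add_monoid R" "\<lambda>y. x \<otimes> y"
    using assms(1) a_group by (auto simp: group_hom_def group_hom_axioms_def hom_def r_distr)
  show ?thesis
    using h.hom_int_pow[of y n] assms(2) by (simp add: add_pow_def)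
qed

lemma (in abelian_group) minus_zeroD:
  assumes "x \<ominus> y = \<zero>" "x \<in> carrier G" "y \<in> carrier G"
  shows "x = y"
proof -
  have "x = (x \<ominus> y) \<oplus> y"
    using assms(2,3) by (simp add: a_minus_def a_assoc l_neg)
  then show ?thesis
    using assms by simp
qed

lemma int_smult_additive:
  assumes "abelian_group R" "abelian_group S"
    and "\<And>x. x \<in> carrier R \<Longrightarrow> f x \<in> carrier S"
    and "\<And>x y. x \<in> carrier R \<Longrightarrow> y \<in> carrier R \<Longrightarrow> f (x \<oplus>\<^bsub>R\<^esub> y) = f x \<oplus>\<^bsub>S\<^esub> f y"
    and "x \<in> carrier R"
  shows "f ([n] \<cdot>\<^bsub>R\<^esub> x) = [(n::int)] \<cdot>\<^bsub>S\<^esub> f x"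
proof -
  interpret h: group_hom "add_monoid R" "add_monoid S" f
    using assms by (auto simp: group_hom_def group_hom_axioms_def hom_def abelian_group.a_group)
  show ?thesis
    using h.hom_int_pow[of x n] assms(5) by (simp add: add_pow_def)
qed

context dg_ring
begin

lemma differential_int_smult: "x \<in> carrier A \<Longrightarrow> differential A ([(n::int)] \<cdot> x) = [n] \<cdot> differential A x"
  by (rule int_smult_additive) (auto simp: differential_add is_abelian_group)

lemma twist_int_smult: "x \<in> carrier A \<Longrightarrow> twist A k ([(n::int)] \<cdot> x) = [n] \<cdot> twist A k x"
  by (rule int_smult_additive) (auto simp: twist_add is_abelian_group)

text \<open>With \<open>\<psi>\<close> concentrated in dimension \<open>j\<close> a single splitting
  survives, in the same \<open>take\<close> and \<open>drop\<close> form as for integer cochains,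
  together with the Koszul twist by \<open>j\<close>.\<close>

lemma cup_concentrated:
  assumes "\<And>y. \<phi> y \<in> carrier A" "\<And>y. \<psi> y \<in> carrier A" "\<And>y. length y \<noteq> Suc j \<Longrightarrow> \<psi> y = \<zero>"
  shows "cup A \<phi> \<psi> x = (if j < length x
    then twist A j (\<phi> (take (length x - j) x)) \<otimes> \<psi> (drop (length x - Suc j) x) else \<zero>)"
  using assms(1)
proof (induction x arbitrary: \<phi>)
  case (Cons a x)
  consider "length x = j" | "j < length x" | "length x < j"
    by linarith
  then show ?case
  proof cases
    case 1
    then show ?thesis
      using Cons by (simp add: assms)
  next
    case 2
    then have "length x - j = Suc (length x - Suc j)"
      by simp
    then show ?thesis
      using Cons 2 by (simp add: assms Suc_diff_le)
  next
    case 3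
    then show ?thesis
      using Cons by (simp add: assms)
  qed
qed simp

text \<open>For a pure tensor the total differential separates into the simplicial part, acting on
  the integers, and the differential of \<open>b\<close> with the sign of the dimension.\<close>

lemma total_diff_int_smult:
  assumes b: "b \<in> carrier A"
  shows "total_diff A (\<lambda>y. [f y] \<cdot> b) x =
    [alternating_sum f x] \<cdot> b \<oplus> [(if odd (length x) then f x else - f x)] \<cdot> differential A b"
proof (induction x arbitrary: f)
  case Nil
  then show ?case
    using b by (simp add: differential_int_smult add.int_pow_neg)
next
  case (Cons a x)
  let ?s = "if odd (length x) then f (a # x) else - f (a # x)"
  have "total_diff A (\<lambda>y. [f y] \<cdot> b) (a # x) =
      [f x] \<cdot> b \<oplus> \<ominus> ([alternating_sum (\<lambda>y. f (a # y)) x] \<cdot> b) \<oplus> \<ominus> ([?s] \<cdot> differential A b)"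
    using b Cons.IH[of "\<lambda>y. f (a # y)"] by (simp add: a_minus_def minus_add a_assoc)
  also have "\<dots> = [(f x - alternating_sum (\<lambda>y. f (a # y)) x)] \<cdot> b \<oplus> [(- ?s)] \<cdot> differential A b"
    using b by (simp only: add.int_pow_neg differential_closed add.int_pow_diff)
  finally show ?case
    by simp
qed

end

section \<open>Tensor relations and normal forms\<close>

locale cylinder = dg_ring B for B :: "('b, 'm) dgring_scheme" (structure) +
  fixes q :: nat
begin

sublocale cochain_algebra B "nondeg q"
  by unfold_locales (rule subcomplex_nondeg)

abbreviation "N \<equiv> simplex_cochains q"
abbreviation "P \<equiv> carrier N \<times> carrier B"
abbreviation "Rel \<equiv> tensor_relations N B"
abbreviation "K \<equiv> cochains (nondeg q) B"

sublocale N: graded_group N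
  by (rule graded_group_simplex_cochains)

lemma pure_induct [consumes 1, case_names zero pure diff]:
  assumes "Poly_Mapping.keys c \<subseteq> P" "Q 0"
    and "\<And>a b. a \<in> carrier N \<Longrightarrow> b \<in> carrier B \<Longrightarrow> Q (frag_of (a, b))"
    and "\<And>c d. Poly_Mapping.keys c \<subseteq> P \<Longrightarrow> Poly_Mapping.keys d \<subseteq> P \<Longrightarrow> Q c \<Longrightarrow> Q d \<Longrightarrow> Q (c - d)"
  shows "Q c"
  using assms(1) by (rule free_Abelian_group_induct) (use assms(2-4) in auto)

lemma keys_diff_P: "Poly_Mapping.keys c \<subseteq> P \<Longrightarrow> Poly_Mapping.keys d \<subseteq> P \<Longrightarrow> Poly_Mapping.keys (c - d) \<subseteq> P"
  using keys_diff[of c d] by blast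

lemma coefficient_closed: "Poly_Mapping.keys c \<subseteq> P \<Longrightarrow> coefficient B c x \<in> carrier B"
  unfolding coefficient_def by (rule frag_eval_closed) auto

lemma coefficient_of: "a \<in> carrier N \<Longrightarrow> b \<in> carrier B \<Longrightarrow> coefficient B (frag_of (a, b)) x = [value_at a x] \<cdot> b"
  unfolding coefficient_def by (subst frag_eval_of) auto

lemma coefficient_add: "Poly_Mapping.keys c \<subseteq> P \<Longrightarrow> Poly_Mapping.keys c' \<subseteq> P \<Longrightarrow>
    coefficient B (c + c') x = coefficient B c x \<oplus> coefficient B c' x"
  unfolding coefficient_def by (rule frag_eval_add[of P]) auto

lemma coefficient_diff: "Poly_Mapping.keys c \<subseteq> P \<Longrightarrow> Poly_Mapping.keys c' \<subseteq> P \<Longrightarrow>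
    coefficient B (c - c') x = coefficient B c x \<ominus> coefficient B c' x"
  unfolding coefficient_def by (rule frag_eval_diff[of P]) auto

lemma coefficient_zero [simp]: "coefficient B 0 x = \<zero>"
  by (simp add: coefficient_def)

lemma coefficient_in_cochains: "Poly_Mapping.keys c \<subseteq> P \<Longrightarrow> coefficient B c \<in> carrier K"
proof -
  assume c: "Poly_Mapping.keys c \<subseteq> P"
  have "coefficient B c x = \<zero>" if x: "x \<notin> nondeg q" for x
    using c
  proof (induction c rule: pure_induct)
    case (pure a b)
    then show ?case
      using x by (simp add: coefficient_of value_at_outside)
  qed (auto simp: coefficient_diff a_minus_def)
  then show ?thesis
    using c coefficient_closed by auto
qed

lemma subgroup_Rel: "subgroup Rel (tensor_free N B)"
  unfolding tensor_relations_def
proof (rule group.generate_is_subgroup)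
  show "group (tensor_free N B)"
    by (simp add: tensor_free_def)
next
  show "{frag_of (a \<oplus>\<^bsub>N\<^esub> a', b) - frag_of (a, b) - frag_of (a', b) | a a' b.
         a \<in> carrier N \<and> a' \<in> carrier N \<and> b \<in> carrier B} \<union>
      {frag_of (a, b \<oplus> b') - frag_of (a, b) - frag_of (a, b') | a b b'.
         a \<in> carrier N \<and> b \<in> carrier B \<and> b' \<in> carrier B} \<subseteq> carrier (tensor_free N B)"
    by (intro Un_least subsetI; elim CollectE exE conjE; hypsubst;
        simp only: tensor_free_def carrier_free_Abelian_group_iff; intro keys_diff_P)
      (simp_all add: N.a_closed del: simplex_cochains_simps)
qed

lemma Rel_zero: "0 \<in> Rel" and Rel_add: "r \<in> Rel \<Longrightarrow> s \<in> Rel \<Longrightarrow> r + s \<in> Rel"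
  and Rel_keys: "r \<in> Rel \<Longrightarrow> Poly_Mapping.keys r \<subseteq> P"
  using subgroup.one_closed[OF subgroup_Rel] subgroup.m_closed[OF subgroup_Rel]
    subgroup.mem_carrier[OF subgroup_Rel]
  by (simp_all add: tensor_free_def)

lemma Rel_neg: "r \<in> Rel \<Longrightarrow> - r \<in> Rel"
  using subgroup.m_inv_closed[OF subgroup_Rel, of r] Rel_keys[of r] by (simp add: tensor_free_def)

lemma Rel_diff: "r \<in> Rel \<Longrightarrow> s \<in> Rel \<Longrightarrow> r - s \<in> Rel"
  using Rel_add[of r "- s"] Rel_neg[of s] by simp

lemma Rel_left: "a \<in> carrier N \<Longrightarrow> a' \<in> carrier N \<Longrightarrow> b \<in> carrier B \<Longrightarrow>
    frag_of (\<lambda>n x. a n x + a' n x, b) - frag_of (a, b) - frag_of (a', b) \<in> Rel"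
  unfolding tensor_relations_def by (rule generate.incl) force

lemma Rel_right: "a \<in> carrier N \<Longrightarrow> b \<in> carrier B \<Longrightarrow> b' \<in> carrier B \<Longrightarrow>
    frag_of (a, b \<oplus> b') - frag_of (a, b) - frag_of (a, b') \<in> Rel"
  unfolding tensor_relations_def by (rule generate.incl) force

lemma Rel_left_zero: "b \<in> carrier B \<Longrightarrow> frag_of (\<lambda>n x. 0, b) \<in> Rel"
  using Rel_neg[OF Rel_left[of "\<lambda>n x. 0" "\<lambda>n x. 0" b]] N.zero_closed by simp

lemma Rel_right_zero: "a \<in> carrier N \<Longrightarrow> frag_of (a, \<zero>) \<in> Rel"
  using Rel_neg[OF Rel_right[of a \<zero> \<zero>]] by simp

lemma scaled_cochain_closed: "a \<in> carrier N \<Longrightarrow> (\<lambda>p x. n * a p x) \<in> carrier N"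
  by (auto simp: simplex_cochains_carrier)

text \<open>The difference of two consecutive instances of \<open>Rel_scale\<close>, so that one
  lemma serves both directions of the induction over the integers.\<close>

lemma Rel_scale_step:
  assumes "a \<in> carrier N" "b \<in> carrier B"
  shows "frag_of (\<lambda>p x. (n + 1) * a p x, b) - frag_of (a, [(n + 1)] \<cdot> b) -
      (frag_of (\<lambda>p x. n * a p x, b) - frag_of (a, [n] \<cdot> b)) \<in> Rel" (is "?r \<in> _")
proof -
  have "frag_of (\<lambda>p x. n * a p x + a p x, b) - frag_of (\<lambda>p x. n * a p x, b) - frag_of (a, b) \<in> Rel"
    using assms by (intro Rel_left scaled_cochain_closed)
  moreover have "frag_of (a, [n] \<cdot> b \<oplus> b) - frag_of (a, [n] \<cdot> b) - frag_of (a, b) \<in> Rel"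
    using assms by (intro Rel_right) auto
  moreover have "[(n + 1)] \<cdot> b = [n] \<cdot> b \<oplus> b"
    using assms by (simp add: add.int_pow_mult)
  ultimately show ?thesis
    using Rel_diff by (fastforce simp: algebra_simps)
qed

lemma Rel_scale:
  assumes "a \<in> carrier N" "b \<in> carrier B"
  shows "frag_of (\<lambda>p x. n * a p x, b) - frag_of (a, [n] \<cdot> b) \<in> Rel"
proof (induction n rule: int_induct[of _ 0])
  case base
  show ?case
    using assms by (simp add: Rel_left_zero Rel_right_zero Rel_diff)
next
  case (step1 i)
  then show ?case
    using Rel_add[OF Rel_scale_step[OF assms, of i]] by force
next
  case (step2 i)
  then show ?case
    using Rel_diff[OF _ Rel_scale_step[OF assms, of "i - 1"]] by force
qed

text \<open>Split the value at one simplex off \<open>a\<close>, move it across the tensor sign by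
  \<open>Rel_scale\<close>, and induct on the remaining support.\<close>

lemma Rel_expand_pure:
  assumes "finite F" "F \<subseteq> nondeg q" "a \<in> carrier N" "b \<in> carrier B" "\<And>x. x \<notin> F \<Longrightarrow> value_at a x = 0"
  shows "frag_of (a, b) - (\<Sum>\<sigma>\<in>F. frag_of (indicator_cochain \<sigma>, [value_at a \<sigma>] \<cdot> b)) \<in> Rel"
  using assms
proof (induction F arbitrary: a rule: finite_induct)
  case empty
  have "a p x = 0" for p x
    using empty.prems(2) empty.prems(4)[of x]
    by (cases "length x = Suc p") (auto simp: value_at_def simplex_cochains_carrier)
  then have "a = (\<lambda>n x. 0)"
    by auto
  then show ?case
    using empty Rel_left_zero by simp
next
  case (insert \<sigma> F)
  let ?\<delta> = "indicator_cochain \<sigma>"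
  let ?a = "\<lambda>p x. if x = \<sigma> then 0 else a p x"
  let ?S = "\<lambda>a. \<Sum>\<sigma>\<in>F. frag_of (indicator_cochain \<sigma>, [value_at a \<sigma>] \<cdot> b)"
  have a': "?a \<in> carrier N" and v: "value_at ?a x = (if x = \<sigma> then 0 else value_at a x)" for x
    using insert.prems by (auto simp: simplex_cochains_carrier value_at_def)
  have \<delta>: "?\<delta> \<in> carrier N"
    using insert.prems by (simp add: indicator_cochain_closed)
  have IH: "frag_of (?a, b) - ?S ?a \<in> Rel"
    by (rule insert.IH) (use insert.prems a' v in auto)
  have S: "?S ?a = ?S a"
    using insert.hyps by (intro sum.cong) (auto simp: v)
  have eq: "a = (\<lambda>p x. ?a p x + value_at a \<sigma> * ?\<delta> p x)"
    using insert.prems(2) by (auto simp: fun_eq_iff indicator_cochain_def value_at_def simplex_cochains_carrier)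
  have "frag_of (\<lambda>p x. ?a p x + value_at a \<sigma> * ?\<delta> p x, b) - frag_of (?a, b) -
      frag_of (\<lambda>p x. value_at a \<sigma> * ?\<delta> p x, b) \<in> Rel"
    by (rule Rel_left[OF a' scaled_cochain_closed[OF \<delta>] insert.prems(3)])
  then have 1: "frag_of (a, b) - frag_of (?a, b) - frag_of (\<lambda>p x. value_at a \<sigma> * ?\<delta> p x, b) \<in> Rel"
    by (simp only: eq[symmetric])
  have "frag_of (a, b) - (frag_of (?\<delta>, [value_at a \<sigma>] \<cdot> b) + ?S a) \<in> Rel"
    using Rel_add[OF 1 Rel_add[OF Rel_scale[OF \<delta> insert.prems(3), of "value_at a \<sigma>"] IH]] S
    by (simp add: algebra_simps)
  then show ?case
    using insert.hyps by simp
qed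

text \<open>The normal form of a tensor with prescribed values: one summand for each basis element
  of the integer cochains.\<close>

definition expand :: "(nat list \<Rightarrow> 'b) \<Rightarrow> ((nat \<Rightarrow> nat list \<Rightarrow> int) \<times> 'b \<Rightarrow>\<^sub>0 int)" where
  "expand \<phi> = (\<Sum>\<sigma>\<in>nondeg q. frag_of (indicator_cochain \<sigma>, \<phi> \<sigma>))"

lemma Rel_sum: "finite I \<Longrightarrow> (\<And>i. i \<in> I \<Longrightarrow> f i \<in> Rel) \<Longrightarrow> sum f I \<in> Rel"
  by (induction I rule: finite_induct) (auto simp: Rel_zero Rel_add)

lemma keys_expand: "\<phi> \<in> carrier K \<Longrightarrow> Poly_Mapping.keys (expand \<phi>) \<subseteq> P"
  using sum_closed_free_Abelian_group[of "nondeg q" "\<lambda>\<sigma>. frag_of (indicator_cochain \<sigma>, \<phi> \<sigma>)" P]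
  unfolding expand_def by (simp add: indicator_cochain_closed)

lemma coefficient_expand:
  assumes "\<phi> \<in> carrier K"
  shows "coefficient B (expand \<phi>) = \<phi>"
proof
  fix x
  have "coefficient B (expand \<phi>) x = finsum B (\<lambda>\<sigma>. coefficient B (frag_of (indicator_cochain \<sigma>, \<phi> \<sigma>)) x) (nondeg q)"
    unfolding expand_def coefficient_def
    using assms by (intro frag_eval_sum[of P]) (auto simp: finite_nondeg indicator_cochain_closed)
  also have "\<dots> = finsum B (\<lambda>\<sigma>. if x = \<sigma> then \<phi> \<sigma> else \<zero>) (nondeg q)"
    using assms by (intro finsum_cong')
      (auto simp: coefficient_of indicator_cochain_closed value_at_indicator)
  also have "\<dots> = \<phi> x"
  proof (cases "x \<in> nondeg q")
    case True
    then show ?thesis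
      using assms add.finprod_singleton[OF True finite_nondeg, of \<phi>] by auto
  next
    case False
    then have "finsum B (\<lambda>\<sigma>. if x = \<sigma> then \<phi> \<sigma> else \<zero>) (nondeg q) = finsum B (\<lambda>\<sigma>. \<zero>) (nondeg q)"
      by (intro finsum_cong') auto
    then show ?thesis
      using False assms by simp
  qed
  finally show "coefficient B (expand \<phi>) x = \<phi> x" .
qed

text \<open>Pure tensors are expanded in the indicator basis, and differences are merged simplex by
  simplex by additivity in the second slot. Hence a formal sum is recovered from its coefficients
  modulo the relations.\<close>

lemma Rel_expand:
  assumes "Poly_Mapping.keys c \<subseteq> P"
  shows "c - expand (coefficient B c) \<in> Rel"
  using assms
proof (induction c rule: pure_induct)
  case zero
  then show ?case
    unfolding expand_def
    by (auto intro!: Rel_neg[of "sum _ _", simplified] Rel_sum Rel_right_zero finite_nondeg indicator_cochain_closed)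
next
  case (diff c d)
  let ?u = "coefficient B c" and ?w = "coefficient B d"
  have "frag_of (indicator_cochain \<sigma>, ?u \<sigma>) - frag_of (indicator_cochain \<sigma>, ?w \<sigma>) -
      frag_of (indicator_cochain \<sigma>, ?u \<sigma> \<ominus> ?w \<sigma>) \<in> Rel" if "\<sigma> \<in> nondeg q" for \<sigma>
  proof -
    have "?u \<sigma> \<ominus> ?w \<sigma> \<oplus> ?w \<sigma> = ?u \<sigma>"
      using diff coefficient_closed by (simp add: a_minus_def a_assoc l_neg)
    then show ?thesis
      using Rel_right[of "indicator_cochain \<sigma>" "?u \<sigma> \<ominus> ?w \<sigma>" "?w \<sigma>"] diff that coefficient_closed
        indicator_cochain_closed[OF that] by (simp add: algebra_simps)
  qed
  then have "expand ?u - expand ?w - expand (\<lambda>\<sigma>. ?u \<sigma> \<ominus> ?w \<sigma>) \<in> Rel"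
    unfolding expand_def sum_subtractf[symmetric] by (intro Rel_sum finite_nondeg)
  moreover have "coefficient B (c - d) = (\<lambda>\<sigma>. ?u \<sigma> \<ominus> ?w \<sigma>)"
    using diff by (auto simp: coefficient_diff)
  ultimately show ?case
    using Rel_add[OF Rel_diff[OF diff(3,4)]] by (fastforce simp: algebra_simps)
next
  case (pure a b)
  have "coefficient B (frag_of (a, b)) = (\<lambda>x. [value_at a x] \<cdot> b)"
    using pure by (auto simp: coefficient_of)
  then show ?case
    using Rel_expand_pure[OF finite_nondeg order_refl, of a b] pure value_at_outside
    unfolding expand_def by auto
qed

text \<open>The expression a(x) times b is additive in both slots, so the coefficient map kills the
  generators of the relations and with them the whole subgroup.\<close>

lemma coefficient_Rel:
  assumes "r \<in> Rel"
  shows "coefficient B r x = \<zero>"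
proof -
  have a_closed: "a \<in> carrier N \<Longrightarrow> a' \<in> carrier N \<Longrightarrow> (\<lambda>n x. a n x + a' n x) \<in> carrier N" for a a'
    using N.a_closed[of a a'] by simp
  have k: "Poly_Mapping.keys (frag_of k - frag_of k') \<subseteq> P" if "k \<in> P" "k' \<in> P" for k k'
    using that keys_diff[of "frag_of k" "frag_of k'"] by auto
  have gen: "Poly_Mapping.keys r \<subseteq> P \<and> coefficient B r x = \<zero>"
    if r: "r \<in> {frag_of (a \<oplus>\<^bsub>N\<^esub> a', b) - frag_of (a, b) - frag_of (a', b) | a a' b.
         a \<in> carrier N \<and> a' \<in> carrier N \<and> b \<in> carrier B} \<union>
      {frag_of (a, b \<oplus> b') - frag_of (a, b) - frag_of (a, b') | a b b'.
         a \<in> carrier N \<and> b \<in> carrier B \<and> b' \<in> carrier B}" for r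
    using r
  proof (elim UnE CollectE exE conjE)
    fix a a' b assume r: "r = frag_of (a \<oplus>\<^bsub>N\<^esub> a', b) - frag_of (a, b) - frag_of (a', b)"
      and ab: "a \<in> carrier N" "a' \<in> carrier N" "b \<in> carrier B"
    have "Poly_Mapping.keys r \<subseteq> P"
      unfolding r using ab a_closed k by (intro order_trans[OF keys_diff] Un_least) auto
    moreover have "coefficient B r x = \<zero>"
      using ab a_closed k unfolding r
      by (simp add: coefficient_diff coefficient_of add.int_pow_mult a_minus_def)
        (simp add: a_ac r_neg r_neg1 r_neg2)
    ultimately show ?thesis ..
  next
    fix a b b' assume r: "r = frag_of (a, b \<oplus> b') - frag_of (a, b) - frag_of (a, b')"
      and ab: "a \<in> carrier N" "b \<in> carrier B" "b' \<in> carrier B"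
    have "Poly_Mapping.keys r \<subseteq> P"
      unfolding r using ab k by (intro order_trans[OF keys_diff] Un_least) auto
    moreover have "coefficient B r x = \<zero>"
      using ab k unfolding r
      by (simp add: coefficient_diff coefficient_of add.int_pow_distrib a_minus_def)
        (simp add: a_ac r_neg r_neg1 r_neg2)
    ultimately show ?thesis ..
  qed
  have "Poly_Mapping.keys r \<subseteq> P \<and> coefficient B r x = \<zero>"
    using assms unfolding tensor_relations_def
  proof (induction rule: generate.induct)
    case one
    then show ?case
      by (simp add: tensor_free_def)
  next
    case (incl h)
    then show ?case
      by (rule gen)
  next
    case (inv h)
    then show ?case
      using gen[OF inv] coefficient_diff[of 0 h x] by (simp add: tensor_free_def a_minus_def)
  next
    case (eng h1 h2)
    then show ?case
      using keys_add[of h1 h2] by (auto simp: tensor_free_def coefficient_add)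
  qed
  then show ?thesis ..
qed

text \<open>The cochains of a simplex are free on the indicator functions, so a formal sum is determined
  modulo the tensor relations by its coefficients.\<close>

lemma Rel_iff:
  assumes "Poly_Mapping.keys c \<subseteq> P" "Poly_Mapping.keys c' \<subseteq> P"
  shows "c - c' \<in> Rel \<longleftrightarrow> coefficient B c = coefficient B c'"
proof
  assume "c - c' \<in> Rel"
  from coefficient_Rel[OF this] show "coefficient B c = coefficient B c'"
    using assms coefficient_closed by (auto simp: coefficient_diff fun_eq_iff intro: minus_zeroD)
next
  assume "coefficient B c = coefficient B c'"
  then show "c - c' \<in> Rel"
    using Rel_diff[OF Rel_expand[OF assms(1)] Rel_expand[OF assms(2)]] by simp
qed

end

declare cochains_simps [simp del]

text \<open>The choice of a representative is immaterial, since coefficients are constant on each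
  coset.\<close>

definition cyl_value :: "('b, 'm) dgring_scheme \<Rightarrow> 'b cyl \<Rightarrow> nat list \<Rightarrow> 'b" where
  "cyl_value B C = coefficient B (SOME c. c \<in> C)"

lemma dg_tensor_simps [simp]:
  "carrier (dg_tensor A B) = carrier (tensor_group A B)"
  "monoid.mult (dg_tensor A B) = (\<lambda>C D. \<Union>c\<in>C. \<Union>c'\<in>D. tensor_class A B (tensor_mult_rep A B c c'))"
  "one (dg_tensor A B) = tensor_class A B (frag_of (\<one>\<^bsub>A\<^esub>, \<one>\<^bsub>B\<^esub>))"
  "ring.zero (dg_tensor A B) = \<one>\<^bsub>tensor_group A B\<^esub>"
  "add (dg_tensor A B) = (\<lambda>C D. C \<otimes>\<^bsub>tensor_group A B\<^esub> D)"
  "grading (dg_tensor A B) n = generate (tensor_group A B)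
     {tensor_class A B (frag_of (a, b)) | i j a b. i + j = n \<and> a \<in> grading A i \<and> b \<in> grading B j}"
  "differential (dg_tensor A B) = (\<lambda>C. \<Union>c\<in>C. tensor_class A B (tensor_differential_rep A B c))"
  by (simp_all add: dg_tensor_def)

lemma Cyl_eq: "Cyl q B = dg_tensor (simplex_cochains q) B"
  by (simp add: Cyl_def cochain_dgring_def)

section \<open>Cosets and their values\<close>

context cylinder
begin

sublocale K: dg_ring K
  by (rule dg_ring_cochains)

lemma coefficient_frag_of:
  "a \<in> carrier N \<Longrightarrow> b \<in> carrier B \<Longrightarrow> coefficient B (frag_of (a, b)) = (\<lambda>x. [value_at a x] \<cdot> b)"
  by (simp add: fun_eq_iff coefficient_of)

abbreviation "cls c \<equiv> tensor_class N B c"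

lemma mem_cls_iff:
  assumes "Poly_Mapping.keys c \<subseteq> P"
  shows "c' \<in> cls c \<longleftrightarrow> Poly_Mapping.keys c' \<subseteq> P \<and> coefficient B c' = coefficient B c"
proof -
  have "c' \<in> cls c \<longleftrightarrow> c' - c \<in> Rel"
    by (force simp: tensor_class_eq)
  moreover have "Poly_Mapping.keys c' \<subseteq> P" if "c' - c \<in> Rel"
    using keys_add[of "c' - c" c] Rel_keys[OF that] assms by auto
  ultimately show ?thesis
    using Rel_iff[OF _ assms, of c'] by blast
qed

lemma cls_eq_iff:
  assumes "Poly_Mapping.keys c \<subseteq> P" "Poly_Mapping.keys d \<subseteq> P"
  shows "cls c = cls d \<longleftrightarrow> coefficient B c = coefficient B d"
  using assms mem_cls_iff[of c] mem_cls_iff[of d] by (auto simp: set_eq_iff)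

lemma cyl_value_cls [simp]:
  assumes "Poly_Mapping.keys c \<subseteq> P"
  shows "cyl_value B (cls c) = coefficient B c"
proof -
  have "\<exists>c'. c' \<in> cls c"
    using mem_cls_iff[OF assms, of c] assms by auto
  then have "(SOME c'. c' \<in> cls c) \<in> cls c"
    by (rule someI_ex)
  then show ?thesis
    using mem_cls_iff[OF assms] by (simp add: cyl_value_def)
qed

lemma carrier_Cyl: "carrier (Cyl q B) = cls ` {c. Poly_Mapping.keys c \<subseteq> P}"
  by (auto simp: Cyl_eq tensor_group_def carrier_FactGroup tensor_class_def tensor_free_def)

text \<open>If the coefficients of \<open>F c\<close> depend only on those of \<open>c\<close>, all
  members of the union coincide. The target may be another cylinder, so that simplicial operators
  and changes of coefficients are covered along with the ring operations.\<close>

lemma Union_cls: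
  assumes "cylinder B2" and "Poly_Mapping.keys c \<subseteq> P"
    and "\<And>c. Poly_Mapping.keys c \<subseteq> P \<Longrightarrow> Poly_Mapping.keys (F c) \<subseteq> carrier (simplex_cochains q2) \<times> carrier B2"
    and "\<And>c. Poly_Mapping.keys c \<subseteq> P \<Longrightarrow> coefficient B2 (F c) = \<Phi> (coefficient B c)"
  shows "(\<Union>c\<in>cls c. tensor_class (simplex_cochains q2) B2 (F c)) = tensor_class (simplex_cochains q2) B2 (F c)"
proof -
  interpret C2: cylinder B2 q2
    by fact
  have "tensor_class (simplex_cochains q2) B2 (F c') = tensor_class (simplex_cochains q2) B2 (F c)" if "c' \<in> cls c" for c'
    using that assms mem_cls_iff[OF assms(2)] by (subst C2.cls_eq_iff) auto
  moreover have "c \<in> cls c"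
    using mem_cls_iff[OF assms(2)] assms(2) by blast
  ultimately show ?thesis
    by blast
qed

lemma keys_extend_P:
  assumes "Poly_Mapping.keys c \<subseteq> P" "\<And>a b. a \<in> carrier N \<Longrightarrow> b \<in> carrier B \<Longrightarrow> Poly_Mapping.keys (f (a, b)) \<subseteq> S"
  shows "Poly_Mapping.keys (frag_extend f c) \<subseteq> S"
proof (rule order_trans[OF keys_frag_extend UN_least])
  fix k assume "k \<in> Poly_Mapping.keys c"
  then have "k \<in> P"
    using assms(1) by blast
  then show "Poly_Mapping.keys (f k) \<subseteq> S"
    using assms(2) by (cases k) simp
qed

lemma keys_sum_P:
  fixes f :: "'i \<Rightarrow> (nat \<Rightarrow> nat list \<Rightarrow> int) \<times> 'b \<Rightarrow>\<^sub>0 int"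
  shows "(\<And>i. i \<in> I \<Longrightarrow> Poly_Mapping.keys (f i) \<subseteq> P) \<Longrightarrow> Poly_Mapping.keys (sum f I) \<subseteq> P"
  using sum_closed_free_Abelian_group[of I f P] by simp

lemma keys_cmul_P: "Poly_Mapping.keys c \<subseteq> P \<Longrightarrow> Poly_Mapping.keys (frag_cmul n c) \<subseteq> P"
  using keys_cmul[of n c] by blast

lemma coefficient_sum:
  "finite I \<Longrightarrow> (\<And>i. i \<in> I \<Longrightarrow> Poly_Mapping.keys (f i) \<subseteq> P) \<Longrightarrow>
    coefficient B (sum f I) x = finsum B (\<lambda>i. coefficient B (f i) x) I"
  unfolding coefficient_def by (rule frag_eval_sum[of P]) auto

lemma coefficient_cmul:
  "Poly_Mapping.keys c \<subseteq> P \<Longrightarrow> coefficient B (frag_cmul n c) x = [n] \<cdot> coefficient B c x"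
  unfolding coefficient_def by (rule frag_eval_cmul[of P]) auto

lemma coefficient_diff_K:
  assumes "Poly_Mapping.keys c \<subseteq> P" "Poly_Mapping.keys c' \<subseteq> P"
  shows "coefficient B (c - c') = coefficient B c \<ominus>\<^bsub>K\<^esub> coefficient B c'"
  using assms coefficient_in_cochains
  by (simp add: K.minus_eq cochains_neg) (simp add: fun_eq_iff coefficient_diff cochains_simps a_minus_def)

abbreviation "pure_differential a b \<equiv> frag_of (differential N a, b) +
       (\<Sum>i\<in>homogeneous_support N a.
          frag_cmul (koszul_sign i) (frag_of (homogeneous_part N a i, differential B b)))"

lemma keys_pure_differential:
  assumes "a \<in> carrier N" "b \<in> carrier B"
  shows "Poly_Mapping.keys (pure_differential a b) \<subseteq> P"
proof -
  have "Poly_Mapping.keys (frag_of (differential N a, b)) \<subseteq> P"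
    using assms by (simp add: differential_simplex_cochains_closed)
  moreover have "Poly_Mapping.keys (\<Sum>i\<in>homogeneous_support N a.
          frag_cmul (koszul_sign i) (frag_of (homogeneous_part N a i, differential B b))) \<subseteq> P"
    using assms by (intro keys_sum_P keys_cmul_P) (simp add: N.grading_closed[OF N.homogeneous_part_degree])
  ultimately show ?thesis
    by (rule order_trans[OF keys_add Un_least])
qed

text \<open>Serves differential and product alike: \<open>f\<close> is the identity for the first
  and left multiplication for the second, and \<open>s\<close> is the Koszul sign.\<close>

lemma graded_additive_value:
  fixes s :: "int \<Rightarrow> int"
  assumes "b \<in> carrier B" "\<And>a. a \<in> carrier N \<Longrightarrow> f a \<in> carrier N"
    "\<And>i a a'. a \<in> grading N i \<Longrightarrow> a' \<in> grading N i \<Longrightarrow>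
      value_at (f (a \<oplus>\<^bsub>N\<^esub> a')) x = value_at (f a) x + value_at (f a') x"
  shows "graded_additive N B (\<lambda>i a. [s i] \<cdot> ([value_at (f a) x] \<cdot> b))"
  by (intro graded_additive.intro graded_additive_axioms.intro N.graded_group_axioms is_abelian_group)
    (use assms in \<open>auto simp: add.int_pow_mult add.int_pow_distrib simp del: simplex_cochains_simps\<close>)

lemma value_at_homogeneous: "a \<in> grading N i \<Longrightarrow> x \<noteq> [] \<Longrightarrow> value_at a x \<noteq> 0 \<Longrightarrow> i = int (length x) - 1"
  by (cases x) (auto simp: value_at_def fun_eq_iff)

text \<open>The sign (-1)^i attached to the part of degree i matters only at simplices of dimension
  i. At \<open>x\<close> it can therefore be replaced by the sign of the dimension of
  \<open>x\<close>, which is the one in \<open>total_diff\<close>.\<close>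

lemma coefficient_pure_differential:
  assumes a: "a \<in> carrier N" and b: "b \<in> carrier B"
  shows "coefficient B (pure_differential a b) = differential K (coefficient B (frag_of (a, b)))"
proof
  fix x
  note closed = N.grading_closed[OF N.homogeneous_part_degree[OF a]]
  show "coefficient B (pure_differential a b) x = differential K (coefficient B (frag_of (a, b))) x"
  proof (cases "x \<in> nondeg q")
    case False
    then show ?thesis
      using coefficient_in_cochains[OF keys_pure_differential[OF a b]] by (simp add: cochains_simps)
  next
    case x: True
    let ?H = "\<lambda>i a. [koszul_sign i] \<cdot> ([value_at a x] \<cdot> differential B b)"
    let ?s = "\<lambda>a. if odd (length x) then value_at a x else - value_at a x"
    interpret H: graded_additive N B ?H
      using graded_additive_value[of "differential B b" "\<lambda>a. a" x koszul_sign] b by simp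
    have "coefficient B (pure_differential a b) x =
        [value_at (differential N a) x] \<cdot> b \<oplus> graded_sum N B ?H a"
      unfolding graded_sum_def using a b closed
      by (subst coefficient_add)
        (auto simp: coefficient_of differential_simplex_cochains_closed coefficient_sum coefficient_cmul
           keys_cmul_P N.finite_homogeneous_support intro!: keys_sum_P keys_cmul_P)
    also have "graded_sum N B ?H a = [?s a] \<cdot> differential B b"
    proof (rule H.graded_sum_eq[OF a])
      show "[?s (a \<oplus>\<^bsub>N\<^esub> a')] \<cdot> differential B b = [?s a] \<cdot> differential B b \<oplus> [?s a'] \<cdot> differential B b" for a a'
        using b by (auto simp: add.int_pow_mult[symmetric])
    next
      fix i a assume "a \<in> grading N i"
      then have "i = int (length x) - 1" if "value_at a x \<noteq> 0"
        using value_at_homogeneous[of a i x] x that Nil_notin by blast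
      then show "[?s a] \<cdot> differential B b = ?H i a"
        using b by (cases "value_at a x = 0") (auto simp: koszul_sign_smult add.int_pow_neg)
    qed
    also have "[value_at (differential N a) x] \<cdot> b = [alternating_sum (value_at a) x] \<cdot> b"
      using value_at_differential[OF a x] by simp
    also have "[alternating_sum (value_at a) x] \<cdot> b \<oplus> [?s a] \<cdot> differential B b =
        differential K (coefficient B (frag_of (a, b))) x"
      using a b x by (simp add: cochains_simps coefficient_frag_of total_diff_int_smult)
    finally show ?thesis .
  qed
qed

lemma keys_differential_rep:
  "Poly_Mapping.keys c \<subseteq> P \<Longrightarrow> Poly_Mapping.keys (tensor_differential_rep N B c) \<subseteq> P"
  unfolding tensor_differential_rep_def
  by (rule keys_extend_P) (simp_all add: keys_pure_differential del: simplex_cochains_simps)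

lemma coefficient_differential_rep:
  "Poly_Mapping.keys c \<subseteq> P \<Longrightarrow>
    coefficient B (tensor_differential_rep N B c) = differential K (coefficient B c)"
proof (induction c rule: pure_induct)
  case zero
  have "coefficient B 0 = \<zero>\<^bsub>K\<^esub>"
    by (simp add: fun_eq_iff cochains_simps)
  then show ?case
    by (simp add: tensor_differential_rep_def)
next
  case (pure a b)
  then show ?case
    using coefficient_pure_differential by (simp add: tensor_differential_rep_def)
next
  case (diff c d)
  have "tensor_differential_rep N B (c - d) = tensor_differential_rep N B c - tensor_differential_rep N B d"
    by (simp add: tensor_differential_rep_def frag_extend_diff)
  then show ?case
    using diff by (simp add: coefficient_diff_K keys_differential_rep K.differential_minus coefficient_in_cochains)
qed

section \<open>The product of tensors\<close>

abbreviation "pure_mult a b a' b' \<equiv> (\<Sum>i\<in>homogeneous_support B b. \<Sum>j\<in>homogeneous_support N a'.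
         frag_cmul (koszul_sign (i * j))
           (frag_of (a \<otimes>\<^bsub>N\<^esub> homogeneous_part N a' j, homogeneous_part B b i \<otimes> b')))"

lemma keys_pure_mult:
  assumes "a \<in> carrier N" "b \<in> carrier B" "a' \<in> carrier N" "b' \<in> carrier B"
  shows "Poly_Mapping.keys (pure_mult a b a' b') \<subseteq> P"
  using assms by (intro keys_sum_P keys_cmul_P)
    (simp add: N.grading_closed[OF N.homogeneous_part_degree] grading_closed[OF homogeneous_part_degree]
      mult_simplex_cochains_closed)

lemma value_at_mult_add:
  assumes "x \<in> nondeg q"
  shows "value_at (a \<otimes>\<^bsub>N\<^esub> (b \<oplus>\<^bsub>N\<^esub> b')) x = value_at (a \<otimes>\<^bsub>N\<^esub> b) x + value_at (a \<otimes>\<^bsub>N\<^esub> b') x"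
  using assms by (simp add: value_at_def cochain_ring_def nondeg_iff sum.distrib distrib_left)

lemma coefficient_pure_mult_homogeneous:
  assumes a: "a \<in> carrier N" and b: "b \<in> grading B i" and a': "a' \<in> grading N j" and b': "b' \<in> carrier B"
    and x: "x \<in> nondeg q"
  shows "cup B (\<lambda>y. [value_at a y] \<cdot> b) (\<lambda>y. [value_at a' y] \<cdot> b') x =
    [koszul_sign (i * j)] \<cdot> ([value_at (a \<otimes>\<^bsub>N\<^esub> a') x] \<cdot> (b \<otimes> b'))"
proof -
  note [simp] = grading_closed[OF b] b' 
  \<comment> \<open>A cochain of negative degree is zero; in that case \<open>k\<close> is set to 0,
    and otherwise \<open>k\<close> is \<open>j\<close>.\<close>
  obtain k where k: "a' \<in> grading N (int k)" "j = int k \<or> a' = (\<lambda>n x. 0)"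
  proof (cases "j < 0")
    case True
    then have "a' = (\<lambda>n x. 0)"
      using a' by auto
    then show ?thesis
      using that[of 0] N.grading_zero[of 0] by simp
  next
    case False
    then show ?thesis
      using that[of "nat j"] a' by simp
  qed
  have "value_at a' y = 0" if "length y \<noteq> Suc k" for y
    using k(1) that value_at_homogeneous[of a' "int k" y] value_at_outside[of a' q "[]"]
    by (cases "y = []") (auto simp: Nil_notin)
  then have "cup B (\<lambda>y. [value_at a y] \<cdot> b) (\<lambda>y. [value_at a' y] \<cdot> b') x =
      (if k < length x then twist B k ([value_at a (take (length x - k) x)] \<cdot> b) \<otimes>
        ([value_at a' (drop (length x - Suc k) x)] \<cdot> b') else \<zero>)"
    by (intro cup_concentrated) auto
  also have "\<dots> = [value_at (a \<otimes>\<^bsub>N\<^esub> a') x] \<cdot> (twist B k b \<otimes> b')"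
    unfolding value_at_mult_homogeneous[OF a k(1) x]
    by (simp add: twist_int_smult int_smult_l_assoc int_smult_r_assoc add.int_pow_pow mult.commute)
  also have "\<dots> = [koszul_sign (i * j)] \<cdot> ([value_at (a \<otimes>\<^bsub>N\<^esub> a') x] \<cdot> (b \<otimes> b'))"
    using k(2)
  proof
    \<comment> \<open>Twisting \<open>b\<close> of degree \<open>i\<close> by \<open>k\<close>
      multiplies it by (-1)^(i k), the Koszul sign.\<close>
    assume "j = int k"
    then have "twist B k b \<otimes> b' = [koszul_sign (i * j)] \<cdot> (b \<otimes> b')"
      by (auto simp: twist_def parity_homogeneous[OF b] koszul_sign_smult l_minus)
    then show ?thesis
      by (simp add: add.int_pow_pow mult.commute)
  next
    assume "a' = (\<lambda>n x. 0)"
    then have "value_at (a \<otimes>\<^bsub>N\<^esub> a') x = 0"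
      using value_at_mult_homogeneous[OF a k(1) x] by simp
    then show ?thesis
      by simp
  qed
  finally show ?thesis .
qed

text \<open>The two sums over degrees are removed in turn, first over the parts of \<open>a'\<close>
  for homogeneous \<open>b\<close>, then over the parts of \<open>b\<close>; both times the reason
  is that the cochain product is additive in that argument.\<close>

lemma coefficient_pure_mult:
  assumes a: "a \<in> carrier N" and b: "b \<in> carrier B" and a': "a' \<in> carrier N" and b': "b' \<in> carrier B"
  shows "coefficient B (pure_mult a b a' b') =
    coefficient B (frag_of (a, b)) \<otimes>\<^bsub>K\<^esub> coefficient B (frag_of (a', b'))"
proof
  fix x
  note closed = N.grading_closed[OF N.homogeneous_part_degree[OF a']] grading_closed[OF homogeneous_part_degree[OF b]]
  show "coefficient B (pure_mult a b a' b') x =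
    (coefficient B (frag_of (a, b)) \<otimes>\<^bsub>K\<^esub> coefficient B (frag_of (a', b'))) x"
  proof (cases "x \<in> nondeg q")
    case False
    then show ?thesis
      using coefficient_in_cochains[OF keys_pure_mult[OF assms]] by (simp add: cochains_simps)
  next
    case x: True
    let ?\<Gamma> = "\<lambda>b a'. cup B (\<lambda>y. [value_at a y] \<cdot> b) (\<lambda>y. [value_at a' y] \<cdot> b') x"
    let ?h = "\<lambda>b i j a'. [koszul_sign (i * j)] \<cdot> ([value_at (a \<otimes>\<^bsub>N\<^esub> a') x] \<cdot> (b \<otimes> b'))"
    have inner: "graded_sum N B (?h b i) a' = ?\<Gamma> b a'" if b: "b \<in> grading B i" for b i
    proof -
      interpret H: graded_additive N B "?h b i"
        by (rule graded_additive_value)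
          (use a b b' x in \<open>auto simp: mult_simplex_cochains_closed value_at_mult_add grading_closed simp del: simplex_cochains_simps\<close>)
      show ?thesis
      proof (rule H.graded_sum_eq[OF a'])
        fix c d assume "c \<in> carrier N" "d \<in> carrier N"
        then show "?\<Gamma> b (c \<oplus>\<^bsub>N\<^esub> d) = ?\<Gamma> b c \<oplus> ?\<Gamma> b d"
          using b b' grading_closed[OF b] by (simp add: add.int_pow_mult cup_add_right)
      qed (rule coefficient_pure_mult_homogeneous[OF a b _ b' x])
    qed
    interpret G: graded_additive B B "\<lambda>i b. ?\<Gamma> b a'"
    proof (intro graded_additive.intro graded_additive_axioms.intro graded_group_axioms is_abelian_group)
      fix c d i assume "c \<in> grading B i" "d \<in> grading B i"
      then show "?\<Gamma> (c \<oplus> d) a' = ?\<Gamma> c a' \<oplus> ?\<Gamma> d a'"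
        using b' by (simp add: grading_closed add.int_pow_distrib cup_add_left)
    qed (simp add: b' grading_closed)
    have "coefficient B (pure_mult a b a' b') x =
        finsum B (\<lambda>i. finsum B (\<lambda>j. ?h (homogeneous_part B b i) i j (homogeneous_part N a' j))
          (homogeneous_support N a')) (homogeneous_support B b)"
      using closed a b a' b'
      by (subst coefficient_sum)
        (auto simp: coefficient_sum coefficient_cmul coefficient_of keys_cmul_P mult_simplex_cochains_closed
          N.finite_homogeneous_support finite_homogeneous_support
          intro!: keys_sum_P keys_cmul_P finsum_cong' finsum_closed simp del: simplex_cochains_simps)
    also have "\<dots> = finsum B (\<lambda>i. ?\<Gamma> (homogeneous_part B b i) a') (homogeneous_support B b)"
      using inner[unfolded graded_sum_def] homogeneous_part_degree[OF b] b' closed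
      by (intro finsum_cong') auto
    also have "\<dots> = graded_sum B B (\<lambda>i b. ?\<Gamma> b a') b"
      by (simp add: graded_sum_def)
    also have "\<dots> = ?\<Gamma> b a'"
      using b' by (intro G.graded_sum_eq[OF b]) (auto simp: add.int_pow_distrib cup_add_left)
    also have "\<dots> = (coefficient B (frag_of (a, b)) \<otimes>\<^bsub>K\<^esub> coefficient B (frag_of (a', b'))) x"
      using assms x by (simp add: cochains_simps coefficient_frag_of)
    finally show ?thesis .
  qed
qed

end

context cylinder
begin

lemma tensor_mult_rep_of: "tensor_mult_rep N B (frag_of (a, b)) (frag_of (a', b')) = pure_mult a b a' b'"
  by (simp add: tensor_mult_rep_def)

lemma tensor_mult_rep_diff_left:
  "tensor_mult_rep N B (c - d) c' = tensor_mult_rep N B c c' - tensor_mult_rep N B d c'"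
  by (simp add: tensor_mult_rep_def frag_extend_diff)

lemma tensor_mult_rep_diff_right:
  "tensor_mult_rep N B (frag_of k) (c - d) = tensor_mult_rep N B (frag_of k) c - tensor_mult_rep N B (frag_of k) d"
  by (cases k) (simp add: tensor_mult_rep_def frag_extend_diff)

lemma keys_mult_rep:
  assumes "Poly_Mapping.keys c \<subseteq> P" "Poly_Mapping.keys c' \<subseteq> P"
  shows "Poly_Mapping.keys (tensor_mult_rep N B c c') \<subseteq> P"
  unfolding tensor_mult_rep_def
  using assms by (intro keys_extend_P) (simp_all, intro keys_extend_P, simp_all add: keys_pure_mult)

lemma coefficient_zero_K: "coefficient B 0 = \<zero>\<^bsub>K\<^esub>"
  by (simp add: fun_eq_iff cochains_simps)

lemma coefficient_mult_rep:
  assumes c: "Poly_Mapping.keys c \<subseteq> P" and c': "Poly_Mapping.keys c' \<subseteq> P"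
  shows "coefficient B (tensor_mult_rep N B c c') = coefficient B c \<otimes>\<^bsub>K\<^esub> coefficient B c'"
  using c
proof (induction c rule: pure_induct)
  case zero
  then show ?case
    using c' coefficient_in_cochains by (simp add: tensor_mult_rep_def coefficient_zero_K)
next
  case (pure a b)
  then have ab: "Poly_Mapping.keys (frag_of (a, b)) \<subseteq> P"
    by simp
  show ?case
    using c'
  proof (induction c' rule: pure_induct)
    case zero
    then show ?case
      using ab coefficient_in_cochains by (simp add: tensor_mult_rep_def coefficient_zero_K)
  next
    case (pure a' b')
    then show ?case
      using coefficient_pure_mult \<open>a \<in> carrier N\<close> \<open>b \<in> carrier B\<close> by (simp add: tensor_mult_rep_of)
  next
    case (diff c d)
    then show ?case
      using ab coefficient_in_cochains
      by (simp add: tensor_mult_rep_diff_right coefficient_diff_K keys_mult_rep K.minus_eq K.r_distr K.r_minus)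
  qed
next
  case (diff c d)
  then show ?case
    using c' coefficient_in_cochains
    by (simp add: tensor_mult_rep_diff_left coefficient_diff_K keys_mult_rep K.minus_eq K.l_distr K.l_minus)
qed

section \<open>The isomorphism between the cylinder and the cochains\<close>

lemma CylE:
  assumes "C \<in> carrier (Cyl q B)"
  obtains c where "Poly_Mapping.keys c \<subseteq> P" "C = cls c"
  using assms by (auto simp: carrier_Cyl)

lemma cls_in_Cyl: "Poly_Mapping.keys c \<subseteq> P \<Longrightarrow> cls c \<in> carrier (Cyl q B)"
  by (auto simp: carrier_Cyl)

lemma Cyl_add: "Poly_Mapping.keys c \<subseteq> P \<Longrightarrow> Poly_Mapping.keys d \<subseteq> P \<Longrightarrow>
    cls c \<oplus>\<^bsub>Cyl q B\<^esub> cls d = cls (c + d)"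
proof -
  assume c: "Poly_Mapping.keys c \<subseteq> P" and d: "Poly_Mapping.keys d \<subseteq> P"
  have "comm_group (tensor_free N B)"
    by (simp add: tensor_free_def abelian_free_Abelian_group)
  from normal.rcos_sum[OF comm_group.subgroup_imp_normal[OF this subgroup_Rel], of c d]
  have "cls c <#>\<^bsub>tensor_free N B\<^esub> cls d = cls (c \<otimes>\<^bsub>tensor_free N B\<^esub> d)"
    using c d by (simp add: tensor_class_def tensor_free_def)
  then show ?thesis
    by (simp add: Cyl_eq tensor_group_def FactGroup_def tensor_free_def)
qed

lemma Cyl_mult: "Poly_Mapping.keys c \<subseteq> P \<Longrightarrow> Poly_Mapping.keys d \<subseteq> P \<Longrightarrow>
    cls c \<otimes>\<^bsub>Cyl q B\<^esub> cls d = cls (tensor_mult_rep N B c d)"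
proof -
  assume c: "Poly_Mapping.keys c \<subseteq> P" and d: "Poly_Mapping.keys d \<subseteq> P"
  have "(\<Union>c'\<in>cls c. \<Union>d'\<in>cls d. cls (tensor_mult_rep N B c' d')) =
      (\<Union>c'\<in>cls c. cls (tensor_mult_rep N B c' d))"
    using c d mem_cls_iff[OF c]
    by (intro SUP_cong refl Union_cls[where \<Phi> = "\<lambda>\<phi>. coefficient B _ \<otimes>\<^bsub>K\<^esub> \<phi>"])
      (auto simp: keys_mult_rep coefficient_mult_rep cylinder_axioms simp del: simplex_cochains_simps)
  also have "\<dots> = cls (tensor_mult_rep N B c d)"
    using c d by (intro Union_cls[where \<Phi> = "\<lambda>\<phi>. \<phi> \<otimes>\<^bsub>K\<^esub> coefficient B d"])
      (auto simp: keys_mult_rep coefficient_mult_rep cylinder_axioms simp del: simplex_cochains_simps)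
  finally show ?thesis
    by (simp add: Cyl_eq)
qed

lemma Cyl_differential: "Poly_Mapping.keys c \<subseteq> P \<Longrightarrow>
    differential (Cyl q B) (cls c) = cls (tensor_differential_rep N B c)"
  unfolding Cyl_eq dg_tensor_simps
  by (rule Union_cls[where \<Phi> = "differential K"])
    (simp_all add: cylinder_axioms keys_differential_rep coefficient_differential_rep)

lemma Cyl_one: "\<one>\<^bsub>Cyl q B\<^esub> = cls (frag_of (\<one>\<^bsub>N\<^esub>, \<one>))" and keys_one: "Poly_Mapping.keys (frag_of (\<one>\<^bsub>N\<^esub>, \<one>)) \<subseteq> P"
  by (simp_all add: Cyl_eq one_simplex_cochains_closed)

lemma coefficient_one: "coefficient B (frag_of (\<one>\<^bsub>N\<^esub>, \<one>)) = \<one>\<^bsub>K\<^esub>"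
proof
  fix x
  show "coefficient B (frag_of (\<one>\<^bsub>N\<^esub>, \<one>)) x = \<one>\<^bsub>K\<^esub> x"
    by (cases "x \<in> nondeg q")
      (auto simp: coefficient_of one_simplex_cochains_closed cochains_simps value_at_one
        value_at_outside[OF one_simplex_cochains_closed])
qed

lemma cyl_value_closed: "C \<in> carrier (Cyl q B) \<Longrightarrow> cyl_value B C \<in> carrier K"
  by (erule CylE) (simp add: coefficient_in_cochains)

lemma cyl_value_inj: "C \<in> carrier (Cyl q B) \<Longrightarrow> D \<in> carrier (Cyl q B) \<Longrightarrow>
    cyl_value B C = cyl_value B D \<Longrightarrow> C = D"
  by (elim CylE) (simp add: cls_eq_iff)

lemma expand_in_Cyl: "\<phi> \<in> carrier K \<Longrightarrow> cls (expand \<phi>) \<in> carrier (Cyl q B)"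
  by (intro cls_in_Cyl keys_expand)

lemma cyl_value_expand: "\<phi> \<in> carrier K \<Longrightarrow> cyl_value B (cls (expand \<phi>)) = \<phi>"
  by (simp add: keys_expand coefficient_expand)

text \<open>The value at \<open>x\<close> is nonzero only if \<open>x\<close> has dimension
  \<open>i\<close>, and there the degree demanded of it is \<open>j\<close>.\<close>

lemma coefficient_pure_degree:
  assumes a: "a \<in> grading N i" and b: "b \<in> grading B j"
  shows "coefficient B (frag_of (a, b)) \<in> grading K (i + j)"
proof -
  have cl: "a \<in> carrier N" "b \<in> carrier B"
    using N.grading_closed[OF a] grading_closed[OF b] .
  have "[value_at a x] \<cdot> b \<in> grading B (i + j + 1 - int (length x))" for x
  proof (cases "value_at a x = 0")
    case False
    then have "x \<noteq> []"
      using value_at_outside[OF cl(1), of "[]"] Nil_notin by auto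
    then have "i + j + 1 - int (length x) = j"
      using value_at_homogeneous[OF a _ False] by simp
    moreover have "[n] \<cdot> b \<in> grading B j" for n :: int
    proof (induction n rule: int_induct[of _ 0])
      case (step2 n)
      then show ?case
        using grading_minus[OF step2(2) b] cl by (simp add: add.int_pow_diff a_minus_def)
    qed (use b cl in \<open>simp_all add: add.int_pow_mult grading_add\<close>)
    ultimately show ?thesis
      by (simp only:)
  qed simp
  then show ?thesis
    using cl coefficient_in_cochains[of "frag_of (a, b)"] by (simp add: coefficient_frag_of cochains_simps)
qed

text \<open>Degree \<open>n\<close> of a tensor product is a generated subgroup, so the proof is an
  induction over \<open>generate\<close>, with membership in the carrier carried along.\<close>

lemma Cyl_grading_value: "C \<in> grading (Cyl q B) n \<Longrightarrow> cyl_value B C \<in> grading K n"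
proof -
  have norm: "Rel \<lhd> tensor_free N B"
    by (intro comm_group.subgroup_imp_normal subgroup_Rel) (simp add: tensor_free_def abelian_free_Abelian_group)
  interpret Q: group "tensor_group N B"
    unfolding tensor_group_def by (rule normal.factorgroup_is_group[OF norm])
  have carr: "carrier (tensor_group N B) = carrier (Cyl q B)"
    by (simp add: Cyl_eq)
  have "C \<in> carrier (Cyl q B) \<and> cyl_value B C \<in> grading K n" if "C \<in> grading (Cyl q B) n" for C
    using that unfolding Cyl_eq dg_tensor_simps
  proof (induction rule: generate.induct)
    case one
    have "\<one>\<^bsub>tensor_group N B\<^esub> = cls 0"
      by (auto simp: tensor_group_def FactGroup_def tensor_class_eq)
    then show ?case
      using cls_in_Cyl[of 0] by (simp add: coefficient_zero_K Cyl_eq)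
  next
    case (incl C)
    then show ?case
      using coefficient_pure_degree N.grading_closed grading_closed cls_in_Cyl
      by (auto simp: carr simp del: simplex_cochains_simps dg_tensor_simps)
  next
    case (inv C)
    then obtain a b i j where C: "C = cls (frag_of (a, b))" and ij: "i + j = n" "a \<in> grading N i" "b \<in> grading B j"
      by blast
    have keys: "Poly_Mapping.keys (frag_of (a, b)) \<subseteq> P"
      using ij N.grading_closed grading_closed by (simp del: simplex_cochains_simps)
    have "inv\<^bsub>tensor_group N B\<^esub> C = cls (- frag_of (a, b))"
    proof (rule Q.inv_equality)
      have "cls (- frag_of (a, b)) \<otimes>\<^bsub>tensor_group N B\<^esub> C = cls 0"
        using Cyl_add[of "- frag_of (a, b)" "frag_of (a, b)"] keys by (simp add: C Cyl_eq)
      then show "cls (- frag_of (a, b)) \<otimes>\<^bsub>tensor_group N B\<^esub> C = \<one>\<^bsub>tensor_group N B\<^esub>"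
        by (auto simp: tensor_group_def FactGroup_def tensor_class_eq)
    qed (use keys cls_in_Cyl in \<open>simp_all only: C carr keys_minus\<close>)
    moreover have "coefficient B (- frag_of (a, b)) = \<zero>\<^bsub>K\<^esub> \<ominus>\<^bsub>K\<^esub> coefficient B (frag_of (a, b))"
      using coefficient_diff_K[of 0 "frag_of (a, b)"] keys by (simp add: coefficient_zero_K)
    ultimately show ?case
      using keys ij coefficient_pure_degree[of a i b j] cls_in_Cyl[of "- frag_of (a, b)"] K.grading_minus[of _ n]
      by (simp add: Cyl_eq)
  next
    case (eng C D)
    then have "C \<in> carrier (Cyl q B)" "D \<in> carrier (Cyl q B)"
      by (simp_all only: carr)
    then obtain c d where c: "Poly_Mapping.keys c \<subseteq> P" "C = cls c" and d: "Poly_Mapping.keys d \<subseteq> P" "D = cls d"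
      by (elim CylE) blast
    have cd: "Poly_Mapping.keys (c + d) \<subseteq> P"
      by (rule order_trans[OF keys_add Un_least[OF c(1) d(1)]])
    have "C \<otimes>\<^bsub>tensor_group N B\<^esub> D = cls (c + d)"
      using Cyl_add[OF c(1) d(1)] c d by (simp add: Cyl_eq)
    moreover have "coefficient B (c + d) = coefficient B c \<oplus>\<^bsub>K\<^esub> coefficient B d"
      using c d by (simp add: fun_eq_iff coefficient_add cochains_simps)
    ultimately show ?case
      using eng c d cd cls_in_Cyl[OF cd] K.grading_add[of _ n] by (simp add: Cyl_eq)
  qed
  then show "C \<in> grading (Cyl q B) n \<Longrightarrow> cyl_value B C \<in> grading K n"
    by blast
qed

lemma indicator_cochain_degree: "\<sigma> \<in> nondeg q \<Longrightarrow> indicator_cochain \<sigma> \<in> grading N (int (length \<sigma>) - 1)"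
  using indicator_cochain_closed[of \<sigma> q] by (auto simp: fun_eq_iff indicator_cochain_def)

text \<open>Each summand of the normal form is a pure tensor whose two degrees, the dimension of the
  simplex and \<open>n\<close> minus that dimension, add up to \<open>n\<close>.\<close>

lemma expand_degree:
  assumes \<phi>: "\<phi> \<in> grading K n"
  shows "cls (expand \<phi>) \<in> grading (Cyl q B) n"
proof -
  let ?f = "\<lambda>\<sigma>. frag_of (indicator_cochain \<sigma>, \<phi> \<sigma>)"
  have "Poly_Mapping.keys (sum ?f F) \<subseteq> P \<and> cls (sum ?f F) \<in> grading (Cyl q B) n" if "finite F" "F \<subseteq> nondeg q" for F
    using that
  proof (induction F rule: finite_induct)
    case empty
    have "\<one>\<^bsub>tensor_group N B\<^esub> = cls 0"
      by (auto simp: tensor_group_def FactGroup_def tensor_class_eq)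
    then show ?case
      using generate.one[of "tensor_group N B"] by (simp add: Cyl_eq)
  next
    case (insert \<sigma> F)
    then have \<sigma>: "\<sigma> \<in> nondeg q" and IH: "Poly_Mapping.keys (sum ?f F) \<subseteq> P" "cls (sum ?f F) \<in> grading (Cyl q B) n"
      by auto
    have deg: "\<phi> \<sigma> \<in> grading B (n + 1 - int (length \<sigma>))"
      using \<phi> by (simp add: cochains_simps)
    have keys: "Poly_Mapping.keys (?f \<sigma>) \<subseteq> P"
      using grading_closed[OF deg] indicator_cochain_closed[OF \<sigma>] by simp
    have "cls (?f \<sigma>) \<in> grading (Cyl q B) n"
      unfolding Cyl_eq dg_tensor_simps
      by (rule generate.incl) (use deg indicator_cochain_degree[OF \<sigma>] in \<open>force simp del: simplex_cochains_simps\<close>)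
    then have "cls (?f \<sigma> + sum ?f F) \<in> grading (Cyl q B) n"
      using IH(2) unfolding Cyl_add[OF keys IH(1), symmetric] unfolding Cyl_eq dg_tensor_simps by (rule generate.eng)
    moreover have "Poly_Mapping.keys (?f \<sigma> + sum ?f F) \<subseteq> P"
      by (rule order_trans[OF keys_add Un_least[OF keys IH(1)]])
    ultimately show ?case
      using insert.hyps by simp
  qed
  then show ?thesis
    unfolding expand_def using finite_nondeg by blast
qed

lemma dg_hom_cyl_value: "dg_hom (Cyl q B) K (cyl_value B)"
  unfolding dg_hom_def
proof (intro conjI allI ballI image_subsetI)
  show "cyl_value B \<in> ring_hom (Cyl q B) K"
  proof (rule ring_hom_memI)
    fix C D assume "C \<in> carrier (Cyl q B)" "D \<in> carrier (Cyl q B)"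
    then obtain c d where c: "Poly_Mapping.keys c \<subseteq> P" "C = cls c" and d: "Poly_Mapping.keys d \<subseteq> P" "D = cls d"
      by (elim CylE) blast
    show "cyl_value B (C \<otimes>\<^bsub>Cyl q B\<^esub> D) = cyl_value B C \<otimes>\<^bsub>K\<^esub> cyl_value B D"
      using c d by (simp add: Cyl_mult keys_mult_rep coefficient_mult_rep)
    have "Poly_Mapping.keys (c + d) \<subseteq> P"
      by (rule order_trans[OF keys_add Un_least[OF c(1) d(1)]])
    then show "cyl_value B (C \<oplus>\<^bsub>Cyl q B\<^esub> D) = cyl_value B C \<oplus>\<^bsub>K\<^esub> cyl_value B D"
      using c d by (simp add: Cyl_add fun_eq_iff coefficient_add cochains_simps)
  qed (use keys_one in \<open>simp_all add: cyl_value_closed Cyl_one coefficient_one\<close>)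
next
  fix C assume "C \<in> carrier (Cyl q B)"
  then show "cyl_value B (differential (Cyl q B) C) = differential K (cyl_value B C)"
    by (elim CylE) (simp add: Cyl_differential keys_differential_rep coefficient_differential_rep)
qed (rule Cyl_grading_value)

lemma Cyl_mult_closed: "C \<in> carrier (Cyl q B) \<Longrightarrow> D \<in> carrier (Cyl q B) \<Longrightarrow> C \<otimes>\<^bsub>Cyl q B\<^esub> D \<in> carrier (Cyl q B)"
  by (elim CylE) (simp add: Cyl_mult keys_mult_rep cls_in_Cyl)

lemma Cyl_add_closed: "C \<in> carrier (Cyl q B) \<Longrightarrow> D \<in> carrier (Cyl q B) \<Longrightarrow> C \<oplus>\<^bsub>Cyl q B\<^esub> D \<in> carrier (Cyl q B)"
  by (elim CylE) (simp add: Cyl_add cls_in_Cyl order_trans[OF keys_add Un_least])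

lemma Cyl_differential_closed: "C \<in> carrier (Cyl q B) \<Longrightarrow> differential (Cyl q B) C \<in> carrier (Cyl q B)"
  by (elim CylE) (simp add: Cyl_differential keys_differential_rep cls_in_Cyl)

text \<open>The inverse of \<open>dg_hom_cyl_value\<close>. Values determine the coset, so every
  equation is checked on values; degrees are left to \<open>expand_degree\<close>.\<close>

lemma dg_hom_expand: "dg_hom K (Cyl q B) (\<lambda>\<phi>. cls (expand \<phi>))"
proof -
  note v = cyl_value_expand expand_in_Cyl dg_hom_add[OF dg_hom_cyl_value] dg_hom_mult[OF dg_hom_cyl_value]
    dg_hom_one[OF dg_hom_cyl_value] dg_hom_differential[OF dg_hom_cyl_value] Cyl_mult_closed
    Cyl_add_closed Cyl_differential_closed
  show ?thesis
    unfolding dg_hom_def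
  proof (intro conjI allI ballI image_subsetI)
    have "\<one>\<^bsub>Cyl q B\<^esub> \<in> carrier (Cyl q B)"
      using keys_one by (simp add: Cyl_one cls_in_Cyl)
    then show "(\<lambda>\<phi>. cls (expand \<phi>)) \<in> ring_hom K (Cyl q B)"
      by (intro ring_hom_memI cyl_value_inj) (simp_all add: v)
  next
    fix \<phi> assume "\<phi> \<in> carrier K"
    then show "cls (expand (differential K \<phi>)) = differential (Cyl q B) (cls (expand \<phi>))"
      by (intro cyl_value_inj) (simp_all add: v)
  qed (rule expand_degree)
qed

end

lemma cylinderI: "dg_ring B \<Longrightarrow> cylinder B"
  by (simp add: cylinder_def)

section \<open>Simplicial operators and change of coefficients on cylinders\<close>

lemma nth_nondeg:
  assumes "\<theta> \<in> monotone_maps p q" "x \<in> nondeg p" "distinct_adj (map ((!) \<theta>) x)"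
  shows "map ((!) \<theta>) x \<in> nondeg q"
proof -
  have "x \<in> monotone_maps (length x - 1) p"
    using assms(2) by (simp add: nondeg_iff)
  then have "monotone_comp \<theta> x \<in> monotone_maps (length x - 1) q"
    by (rule monotone_comp_closed[OF assms(1)])
  then show ?thesis
    using assms(3) by (simp add: nondeg_iff monotone_comp_def)
qed

lemma nondegI: "x \<in> monotone_maps p q \<Longrightarrow> distinct_adj x \<Longrightarrow> x \<in> nondeg q \<and> length x = Suc p"
  by (auto simp: nondeg_iff monotone_maps_def)

lemma distinct_adj_mapD: "distinct_adj (map f x) \<Longrightarrow> distinct_adj x"
  by (induction x rule: induct_list012) auto

lemma cochain_map_closed:
  assumes "\<theta> \<in> monotone_maps p q" "a \<in> carrier (simplex_cochains q)"
  shows "cochain_map (std_simplex p) (\<lambda>r x. monotone_comp \<theta> x) a \<in> carrier (simplex_cochains p)"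
proof -
  have "x \<in> nondeg p \<and> length x = Suc r" if "x \<in> monotone_maps r p" "a r (monotone_comp \<theta> x) \<noteq> 0" for r x
  proof -
    have "monotone_comp \<theta> x \<in> nondeg q"
      using assms(2) that(2) by (auto simp: simplex_cochains_carrier)
    then have "distinct_adj x"
      by (auto simp: nondeg_iff monotone_comp_def dest: distinct_adj_mapD)
    then show ?thesis
      by (rule nondegI[OF that(1)])
  qed
  then show ?thesis
    by (auto simp: simplex_cochains_carrier cochain_map_def)
qed

context dg_ring
begin

text \<open>On values a simplicial operator relabels vertices; lists that become degenerate leave
  \<open>nondeg q\<close>, where the values are zero.\<close>

lemma cyl_value_Cyl_op:
  assumes \<theta>: "\<theta> \<in> monotone_maps p q" and C: "C \<in> carrier (Cyl q A)"
  shows "Cyl_op A \<theta> C \<in> carrier (Cyl p A)"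
    and "cyl_value A (Cyl_op A \<theta> C) = pullback (nondeg p) A ((!) \<theta>) (cyl_value A C)"
proof -
  interpret Q: cylinder A q by (intro cylinderI dg_ring_axioms)
  interpret Q': cylinder A p by (intro cylinderI dg_ring_axioms)
  define f where "f = cochain_map (std_simplex p) (\<lambda>r x. monotone_comp \<theta> x)"
  define F where "F = frag_extend (\<lambda>(a, b :: 'a). frag_of (f a, b))"
  have f: "f a \<in> carrier Q'.N" if "a \<in> carrier Q.N" for a
    unfolding f_def by (rule cochain_map_closed[OF \<theta> that])
  have val: "value_at (f a) x = (if x \<in> nondeg p then value_at a (map ((!) \<theta>) x) else 0)"
    if "a \<in> carrier Q.N" for a x
    using value_at_outside[OF f[OF that], of x]
    by (auto simp: value_at_def f_def cochain_map_def monotone_comp_def nondeg_iff)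
  have keys: "Poly_Mapping.keys (F c) \<subseteq> Q'.P" if "Poly_Mapping.keys c \<subseteq> Q.P" for c
    unfolding F_def by (rule Q.keys_extend_P[OF that]) (simp add: f)
  have coeff: "coefficient A (F c) = pullback (nondeg p) A ((!) \<theta>) (coefficient A c)" if "Poly_Mapping.keys c \<subseteq> Q.P" for c
    using that
  proof (induction c rule: Q.pure_induct)
    case zero
    then show ?case
      by (simp add: F_def fun_eq_iff pullback_def)
  next
    case (pure a b)
    then show ?case
      by (auto simp: F_def fun_eq_iff pullback_def Q.coefficient_of Q'.coefficient_of f val)
  next
    case (diff c d)
    have "F (c - d) = F c - F d"
      by (simp add: F_def frag_extend_diff)
    then show ?case
      using diff keys by (auto simp: fun_eq_iff pullback_def Q.coefficient_diff Q'.coefficient_diff a_minus_def)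
  qed
  obtain c where c: "Poly_Mapping.keys c \<subseteq> Q.P" "C = Q.cls c"
    using C by (rule Q.CylE)
  have "length \<theta> - 1 = p"
    using \<theta> by (simp add: monotone_maps_def)
  then have "Cyl_op A \<theta> C = (\<Union>c\<in>Q.cls c. Q'.cls (F c))"
    by (simp add: Cyl_op_def Let_def dg_tensor_map_def c(2) F_def f_def)
  also have "\<dots> = Q'.cls (F c)"
    by (rule Q.Union_cls[where \<Phi> = "pullback (nondeg p) A ((!) \<theta>)", OF Q'.cylinder_axioms c(1) keys coeff])
  finally have eq: "Cyl_op A \<theta> C = Q'.cls (F c)" .
  show "Cyl_op A \<theta> C \<in> carrier (Cyl p A)"
    unfolding eq by (rule Q'.cls_in_Cyl[OF keys[OF c(1)]])
  show "cyl_value A (Cyl_op A \<theta> C) = pullback (nondeg p) A ((!) \<theta>) (cyl_value A C)"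
    unfolding eq using c keys[OF c(1)] coeff[OF c(1)] by simp
qed

end

lemma cyl_value_Cyl_map:
  assumes B': "dg_ring B'" and B: "dg_ring B" and v: "dg_hom B' B v" and C: "C \<in> carrier (Cyl q B')"
  shows "Cyl_map q B v C \<in> carrier (Cyl q B)"
    and "cyl_value B (Cyl_map q B v C) = (\<lambda>x. v (cyl_value B' C x))"
proof -
  interpret Q: cylinder B' q by (intro cylinderI B')
  interpret Q': cylinder B q by (intro cylinderI B)
  define F where "F = frag_extend (\<lambda>(a :: nat \<Rightarrow> nat list \<Rightarrow> int, b). frag_of (a, v b))"
  have keys: "Poly_Mapping.keys (F c) \<subseteq> Q'.P" if "Poly_Mapping.keys c \<subseteq> Q.P" for c
    unfolding F_def by (rule Q.keys_extend_P[OF that]) (simp add: dg_hom_closed[OF v])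
  have smult: "v ([n] \<cdot>\<^bsub>B'\<^esub> b) = [(n::int)] \<cdot>\<^bsub>B\<^esub> v b" if "b \<in> carrier B'" for n b
    using that by (intro int_smult_additive)
      (auto simp: dg_hom_closed[OF v] dg_hom_add[OF v] Q.is_abelian_group Q'.is_abelian_group)
  have coeff: "coefficient B (F c) = (\<lambda>x. v (coefficient B' c x))" if "Poly_Mapping.keys c \<subseteq> Q.P" for c
    using that
  proof (induction c rule: Q.pure_induct)
    case zero
    then show ?case
      by (simp add: F_def fun_eq_iff dg_hom_zero[OF B' B v])
  next
    case (pure a b)
    then show ?case
      by (auto simp: F_def fun_eq_iff Q.coefficient_of Q'.coefficient_of dg_hom_closed[OF v] smult)
  next
    case (diff c d)
    have "F (c - d) = F c - F d"
      by (simp add: F_def frag_extend_diff)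
    then show ?case
      using diff keys
      by (auto simp: fun_eq_iff Q.coefficient_diff Q'.coefficient_diff dg_hom_minus[OF B' B v] Q.coefficient_closed)
  qed
  obtain c where c: "Poly_Mapping.keys c \<subseteq> Q.P" "C = Q.cls c"
    using C by (rule Q.CylE)
  have "Cyl_map q B v C = (\<Union>c\<in>Q.cls c. Q'.cls (F c))"
    by (simp add: Cyl_map_def dg_tensor_map_def c(2) F_def)
  also have "\<dots> = Q'.cls (F c)"
    by (rule Q.Union_cls[where \<Phi> = "\<lambda>\<phi> x. v (\<phi> x)", OF Q'.cylinder_axioms c(1) keys coeff])
  finally have eq: "Cyl_map q B v C = Q'.cls (F c)" .
  show "Cyl_map q B v C \<in> carrier (Cyl q B)"
    unfolding eq by (rule Q'.cls_in_Cyl[OF keys[OF c(1)]])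
  show "cyl_value B (Cyl_map q B v C) = (\<lambda>x. v (cyl_value B' C x))"
    unfolding eq using c keys[OF c(1)] coeff[OF c(1)] by simp
qed

section \<open>Lifting along free presentations\<close>

lemmas frag_keys_induct = free_Abelian_group_induct[consumes 1, case_names zero diff word]

definition word_eval :: "('e, 'm) ring_scheme \<Rightarrow> ('x \<Rightarrow> 'e) \<Rightarrow> 'x list \<Rightarrow> 'e" where
  "word_eval E s w = foldr (\<lambda>x y. s x \<otimes>\<^bsub>E\<^esub> y) w \<one>\<^bsub>E\<^esub>"

definition free_eval :: "('e, 'm) ring_scheme \<Rightarrow> ('x \<Rightarrow> 'e) \<Rightarrow> ('x list \<Rightarrow>\<^sub>0 int) \<Rightarrow> 'e" where
  "free_eval E s p = frag_eval E (word_eval E s) p"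

lemma word_eval_simps [simp]:
  "word_eval E s [] = \<one>\<^bsub>E\<^esub>" "word_eval E s (x # w) = s x \<otimes>\<^bsub>E\<^esub> word_eval E s w"
  by (simp_all add: word_eval_def)

lemma word_eval_cong: "(\<And>x. x \<in> set w \<Longrightarrow> s x = t x) \<Longrightarrow> word_eval E s w = word_eval E t w"
  by (induction w) simp_all

lemma free_ring_simps [simp]:
  "carrier (free_ring X dg) = {p. Poly_Mapping.keys p \<subseteq> lists X}"
  "monoid.mult (free_ring X dg) = (\<lambda>p q. frag_extend (\<lambda>u. frag_extend (\<lambda>w. frag_of (u @ w)) q) p)"
  "one (free_ring X dg) = frag_of []"
  "ring.zero (free_ring X dg) = 0"
  "add (free_ring X dg) = (+)"
  "grading (free_ring X dg) i = {p. \<forall>w\<in>Poly_Mapping.keys p. w \<in> lists X \<and> sum_list (map dg w) = i}"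
  by (simp_all add: free_ring_def)

lemma free_ring_mult_closed:
  assumes "Poly_Mapping.keys p \<subseteq> lists X" "Poly_Mapping.keys q \<subseteq> lists X"
  shows "Poly_Mapping.keys (frag_extend (\<lambda>u. frag_extend (\<lambda>w. frag_of (u @ w)) q) p) \<subseteq> lists X"
proof (intro order_trans[OF keys_frag_extend] UN_least)
  fix u w assume "u \<in> Poly_Mapping.keys p" "w \<in> Poly_Mapping.keys q"
  then show "Poly_Mapping.keys (frag_of (u @ w)) \<subseteq> lists X"
    using assms by auto
qed

context ring
begin

lemma word_eval_closed [simp]: "(\<And>x. s x \<in> carrier R) \<Longrightarrow> word_eval R s w \<in> carrier R"
  by (induction w) simp_all

lemma word_eval_append: "(\<And>x. s x \<in> carrier R) \<Longrightarrow> word_eval R s (u @ w) = word_eval R s u \<otimes> word_eval R s w"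
  by (induction u) (simp_all add: m_assoc)

lemma free_eval_cong:
  assumes "Poly_Mapping.keys p \<subseteq> lists Y" "\<And>x. x \<in> Y \<Longrightarrow> s x = t x" "\<And>x. t x \<in> carrier R"
  shows "free_eval R s p = free_eval R t p"
proof -
  have "word_eval R s w = word_eval R t w" if "w \<in> Poly_Mapping.keys p" for w
    using assms(1,2) that by (intro word_eval_cong) blast
  then show ?thesis
    unfolding free_eval_def using assms(3) by (intro frag_eval_cong) auto
qed

context
  fixes s :: "'x \<Rightarrow> 'a"
  assumes s: "\<And>x. s x \<in> carrier R"
begin

lemma free_eval_closed [simp]: "free_eval R s p \<in> carrier R"
  unfolding free_eval_def by (rule frag_eval_closed) (simp add: s)

lemma free_eval_of [simp]: "free_eval R s (frag_of w) = word_eval R s w"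
  unfolding free_eval_def by (rule frag_eval_of) (simp add: s)

lemma free_eval_zero [simp]: "free_eval R s 0 = \<zero>"
  by (simp add: free_eval_def)

lemma free_eval_add: "free_eval R s (p + q) = free_eval R s p \<oplus> free_eval R s q"
  unfolding free_eval_def by (rule frag_eval_add[of UNIV]) (auto simp: s)

lemma free_eval_diff: "free_eval R s (p - q) = free_eval R s p \<ominus> free_eval R s q"
  unfolding free_eval_def by (rule frag_eval_diff[of UNIV]) (auto simp: s)

lemma free_eval_mult:
  "free_eval R s (frag_extend (\<lambda>u. frag_extend (\<lambda>w. frag_of (u @ w)) q) p) = free_eval R s p \<otimes> free_eval R s q"
  using subset_UNIV
proof (induction p rule: frag_induction)
  case (one u)
  show ?case
    using subset_UNIV
  proof (induction q rule: frag_induction)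
    case (one w)
    then show ?case
      by (simp add: s word_eval_append)
  next
    case (diff a b)
    then show ?case
      using s by (simp add: frag_extend_diff free_eval_diff minus_eq r_distr r_minus)
  qed (simp add: s)
next
  case (diff a b)
  then show ?case
    using s by (simp add: frag_extend_diff free_eval_diff minus_eq l_distr l_minus)
qed simp

end

end

section \<open>Presentations by noncommutative polynomials\<close>

locale free_presentation = dg_ring A for A :: "('a, 'm) dgring_scheme" (structure) +
  fixes X :: "'x set" and dg :: "'x \<Rightarrow> int" and \<psi> :: "('x list \<Rightarrow>\<^sub>0 int) \<Rightarrow> 'a"
  assumes iso: "\<psi> \<in> ring_iso (free_ring X dg) A"
    and degree: "\<psi> ` grading (free_ring X dg) i = grading A i"
begin

abbreviation "poly_over Y \<equiv> {p :: 'x list \<Rightarrow>\<^sub>0 int. Poly_Mapping.keys p \<subseteq> lists Y}"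

text \<open>The coordinates of an element of \<open>A\<close> as a polynomial; maps out of
  \<open>A\<close> are evaluations of these coordinates at chosen values of the generators.\<close>

definition "\<eta> = inv_into (poly_over X) \<psi>"

lemma bij: "bij_betw \<psi> (poly_over X) (carrier A)" and hom: "\<psi> \<in> ring_hom (free_ring X dg) A"
  using iso by (simp_all add: ring_iso_def)

lemma psi_closed: "p \<in> poly_over X \<Longrightarrow> \<psi> p \<in> carrier A"
  and psi_add: "p \<in> poly_over X \<Longrightarrow> q \<in> poly_over X \<Longrightarrow> \<psi> (p + q) = \<psi> p \<oplus> \<psi> q"
  and psi_mult: "p \<in> poly_over X \<Longrightarrow> q \<in> poly_over X \<Longrightarrow>
    \<psi> (frag_extend (\<lambda>u. frag_extend (\<lambda>w. frag_of (u @ w)) q) p) = \<psi> p \<otimes> \<psi> q"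
  and psi_one: "\<psi> (frag_of []) = \<one>"
  using ring_hom_closed[OF hom] ring_hom_add[OF hom] ring_hom_mult[OF hom] ring_hom_one[OF hom] by simp_all

lemma eta_closed: "a \<in> carrier A \<Longrightarrow> \<eta> a \<in> poly_over X"
  and psi_eta: "a \<in> carrier A \<Longrightarrow> \<psi> (\<eta> a) = a"
  and eta_psi: "p \<in> poly_over X \<Longrightarrow> \<eta> (\<psi> p) = p"
  unfolding \<eta>_def using bij bij_betw_inv_into_right[OF bij] bij_betw_inv_into_left[OF bij]
    bij_betw_apply[OF bij_betw_inv_into[OF bij]] by auto

lemma eta_add: "a \<in> carrier A \<Longrightarrow> b \<in> carrier A \<Longrightarrow> \<eta> (a \<oplus> b) = \<eta> a + \<eta> b"
proof -
  assume a: "a \<in> carrier A" and b: "b \<in> carrier A"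
  have "\<eta> a + \<eta> b \<in> poly_over X"
    using eta_closed[OF a] eta_closed[OF b] keys_add[of "\<eta> a" "\<eta> b"] by blast
  moreover have "\<psi> (\<eta> a + \<eta> b) = a \<oplus> b"
    using psi_add[OF eta_closed[OF a] eta_closed[OF b]] a b by (simp add: psi_eta)
  ultimately show ?thesis
    using eta_psi by metis
qed

lemma eta_mult: "a \<in> carrier A \<Longrightarrow> b \<in> carrier A \<Longrightarrow>
    \<eta> (a \<otimes> b) = frag_extend (\<lambda>u. frag_extend (\<lambda>w. frag_of (u @ w)) (\<eta> b)) (\<eta> a)"
  (is "_ \<Longrightarrow> _ \<Longrightarrow> _ = ?m")
proof -
  assume a: "a \<in> carrier A" and b: "b \<in> carrier A"
  have "?m \<in> poly_over X"
    using eta_closed[OF a] eta_closed[OF b] free_ring_mult_closed by blast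
  moreover have "\<psi> ?m = a \<otimes> b"
    using psi_mult[OF eta_closed[OF a] eta_closed[OF b]] a b by (simp add: psi_eta)
  ultimately show ?thesis
    using eta_psi by metis
qed

lemma psi_zero: "\<psi> 0 = \<zero>"
  using psi_add[of 0 0] psi_closed[of 0] add.l_cancel_one[of "\<psi> 0" "\<psi> 0"] by simp

lemma psi_diff: "p \<in> poly_over X \<Longrightarrow> q \<in> poly_over X \<Longrightarrow> \<psi> (p - q) = \<psi> p \<ominus> \<psi> q"
proof -
  assume p: "p \<in> poly_over X" and q: "q \<in> poly_over X"
  have pq: "p - q \<in> poly_over X"
    using p q keys_diff[of p q] by blast
  have "\<psi> p = \<psi> (p - q) \<oplus> \<psi> q"
    using psi_add[OF pq q] by simp
  then show ?thesis
    using psi_closed[OF pq] psi_closed[OF q] by (simp add: minus_eq a_assoc r_neg)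
qed

lemma psi_letter: "x \<in> X \<Longrightarrow> \<psi> (frag_of [x]) \<in> grading A (dg x)"
  using degree[of "dg x"] by auto

lemma psi_word: "x \<in> X \<Longrightarrow> w \<in> lists X \<Longrightarrow> \<psi> (frag_of (x # w)) = \<psi> (frag_of [x]) \<otimes> \<psi> (frag_of w)"
  using psi_mult[of "frag_of [x]" "frag_of w"] by simp

lemma eta_degree: "a \<in> grading A i \<Longrightarrow> w \<in> Poly_Mapping.keys (\<eta> a) \<Longrightarrow> sum_list (map dg w) = i"
proof -
  assume "a \<in> grading A i" and w: "w \<in> Poly_Mapping.keys (\<eta> a)"
  then obtain p where p: "p \<in> grading (free_ring X dg) i" "a = \<psi> p"
    using degree[of i] by blast
  then have "\<eta> a = p"
    by (auto intro!: eta_psi)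
  then show ?thesis
    using p w by simp
qed

end

text \<open>\<open>R a e\<close> says that \<open>e\<close> is an admissible value of the lift at \<open>a\<close>.\<close>

locale free_lift = free_presentation A X dg \<psi> + E: dg_ring E
  for A :: "('a, 'm) dgring_scheme" (structure) and X :: "'x set" and dg \<psi>
    and E :: "('e, 'n) dgring_scheme" +
  fixes R :: "'a \<Rightarrow> 'e \<Rightarrow> bool"
  assumes R_one: "R \<one> \<one>\<^bsub>E\<^esub>"
    and R_zero: "R \<zero> \<zero>\<^bsub>E\<^esub>"
    and R_minus: "\<lbrakk>a \<in> carrier A; b \<in> carrier A; c \<in> carrier E; e \<in> carrier E; R a c; R b e\<rbrakk> \<Longrightarrow>
      R (a \<ominus> b) (c \<ominus>\<^bsub>E\<^esub> e)"
    and R_mult: "\<lbrakk>a \<in> carrier A; b \<in> carrier A; c \<in> carrier E; e \<in> carrier E; R a c; R b e\<rbrakk> \<Longrightarrow>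
      R (a \<otimes> b) (c \<otimes>\<^bsub>E\<^esub> e)"
    and R_lift: "\<lbrakk>a \<in> grading A i; z \<in> grading E (i + 1); differential E z = \<zero>\<^bsub>E\<^esub>; R (differential A a) z\<rbrakk> \<Longrightarrow>
      \<exists>e\<in>grading E i. R a e \<and> differential E e = z"
begin

abbreviation "G s a \<equiv> free_eval E s (\<eta> a)"

lemma G_hom: "(\<And>x. s x \<in> carrier E) \<Longrightarrow> (\<lambda>a. G s a) \<in> ring_hom A E"
proof (rule ring_hom_memI)
  assume s: "\<And>x. s x \<in> carrier E"
  have "\<eta> \<one> = frag_of []"
    using eta_psi[of "frag_of []"] psi_one by simp
  then show "G s \<one> = \<one>\<^bsub>E\<^esub>"
    using s by simp
qed (simp_all add: eta_add eta_mult E.free_eval_add E.free_eval_mult)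

lemma free_eval_degree:
  assumes "\<And>x. s x \<in> carrier E" "\<And>x. x \<in> Y \<Longrightarrow> s x \<in> grading E (dg x)" "p \<in> poly_over Y"
    "\<And>w. w \<in> Poly_Mapping.keys p \<Longrightarrow> sum_list (map dg w) = i"
  shows "free_eval E s p \<in> grading E i"
proof -
  have word: "word_eval E s w \<in> grading E (sum_list (map dg w))" if "w \<in> lists Y" for w
    using that by (induction w) (auto intro!: E.one_degree E.mult_degree assms(2))
  have smult: "[n] \<cdot>\<^bsub>E\<^esub> y \<in> grading E i" if y: "y \<in> grading E i" for y and n :: int
  proof (induction n rule: int_induct[of _ 0])
    case (step2 n)
    then show ?case
      using E.grading_minus[OF step2(2) y] E.grading_closed[OF y] by (simp add: E.add.int_pow_diff a_minus_def)
  qed (use y E.grading_closed[OF y] in \<open>simp_all add: E.add.int_pow_mult E.grading_add\<close>)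
  have "word_eval E s w \<in> grading E i" if "w \<in> Poly_Mapping.keys p" for w
    using word[of w] assms(3) assms(4)[OF that] that by auto
  then show ?thesis
    unfolding free_eval_def frag_eval_def by (intro E.grading_finsum smult) auto
qed

text \<open>What is asked of the value at one generator. The last clause says that the extended map
  commutes with the differential at \<open>x\<close>.\<close>

definition good :: "('x \<Rightarrow> 'e) \<Rightarrow> 'x \<Rightarrow> bool" where
  "good s x \<longleftrightarrow> s x \<in> grading E (dg x) \<and> R (\<psi> (frag_of [x])) (s x) \<and>
     differential E (s x) = G s (differential A (\<psi> (frag_of [x])))"

lemma poly_over_mono: "p \<in> poly_over Y \<Longrightarrow> Y \<subseteq> X \<Longrightarrow> p \<in> poly_over X"
  by (simp add: order_trans[OF _ lists_mono])

context
  fixes s :: "'x \<Rightarrow> 'e" and Y :: "'x set"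
  assumes s: "\<And>x. s x \<in> carrier E" and Y: "Y \<subseteq> X" and good: "\<And>x. x \<in> Y \<Longrightarrow> good s x"
begin

text \<open>Polynomials arise from words by differences and words from letters by products, and
  \<open>R\<close> is stable under both.\<close>

lemma R_free_eval: "p \<in> poly_over Y \<Longrightarrow> R (\<psi> p) (free_eval E s p)"
proof -
  assume "p \<in> poly_over Y"
  then have "Poly_Mapping.keys p \<subseteq> lists Y"
    by simp
  then show ?thesis
  proof (induction p rule: frag_keys_induct)
    case zero
    then show ?case
      using s by (simp add: psi_zero R_zero)
  next
    case (diff p q)
    then have "p \<in> poly_over X" "q \<in> poly_over X"
      using poly_over_mono Y by auto
    then show ?case
      using diff s by (simp only: psi_diff E.free_eval_diff) (intro R_minus, simp_all add: psi_closed)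
  next
    case (word w)
    then show ?case
    proof (induction w)
      case (Cons x w)
      then have x: "x \<in> X" "w \<in> lists X" and "R (\<psi> (frag_of [x])) (s x)"
        using Y good lists_mono[OF Y] by (auto simp: good_def)
      moreover have "\<psi> (frag_of [x]) \<in> carrier A" "\<psi> (frag_of w) \<in> carrier A"
        using x by (auto intro!: psi_closed)
      ultimately show ?case
        unfolding psi_word[OF x] using Cons s by (simp add: R_mult)
    qed (simp add: s psi_one R_one)
  qed
qed

text \<open>Both sides are additive and obey the same Leibniz rule along a word, because
  \<open>G s\<close> is a ring homomorphism; on letters the claim is the last clause of
  \<open>good\<close>.\<close>

lemma differential_free_eval:
  "p \<in> poly_over Y \<Longrightarrow> differential E (free_eval E s p) = G s (differential A (\<psi> p))"
proof -
  note hom_add = ring_hom_add[OF G_hom[OF s]] and hom_mult = ring_hom_mult[OF G_hom[OF s]]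
  have G_minus: "G s (a \<ominus> b) = G s a \<ominus>\<^bsub>E\<^esub> G s b" if "a \<in> carrier A" "b \<in> carrier A" for a b
  proof -
    have "G s a = G s (a \<ominus> b) \<oplus>\<^bsub>E\<^esub> G s b"
      using hom_add[of "a \<ominus> b" b] that by (simp add: minus_eq a_assoc l_neg)
    then show ?thesis
      using s by (simp add: E.minus_eq E.a_assoc E.r_neg)
  qed
  have G_smult: "G s ([n] \<cdot> a) = [n] \<cdot>\<^bsub>E\<^esub> G s a" if "a \<in> carrier A" for a and n :: int
    by (rule int_smult_additive[OF is_abelian_group E.is_abelian_group])
      (use that s hom_add in auto)
  have G_psi: "G s (\<psi> p) = free_eval E s p" if "p \<in> poly_over X" for p
    using eta_psi[OF that] by simp
  assume "p \<in> poly_over Y"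
  then have "Poly_Mapping.keys p \<subseteq> lists Y"
    by simp
  then show ?thesis
  proof (induction p rule: frag_keys_induct)
    case zero
    then show ?case
      using s G_psi[of 0] by (simp add: psi_zero)
  next
    case (diff p q)
    then have "p \<in> poly_over X" "q \<in> poly_over X"
      using poly_over_mono Y by auto
    then show ?case
      using diff s by (simp add: psi_diff E.free_eval_diff psi_closed differential_minus E.differential_minus G_minus)
  next
    case (word w)
    then show ?case
    proof (induction w)
      case Nil
      have "differential A \<one> = \<zero>"
        using leibniz[OF one_degree, of \<one>] add.l_cancel_one[of "differential A \<one>" "differential A \<one>"]
        by (simp add: koszul_sign_def)
      moreover have "differential E \<one>\<^bsub>E\<^esub> = \<zero>\<^bsub>E\<^esub>"
        using E.leibniz[OF E.one_degree, of "\<one>\<^bsub>E\<^esub>"] E.add.l_cancel_one[of "differential E \<one>\<^bsub>E\<^esub>" "differential E \<one>\<^bsub>E\<^esub>"]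
        by (simp add: koszul_sign_def)
      ultimately show ?case
        using s G_psi[of 0] by (simp add: psi_one psi_zero)
    next
      case (Cons x w)
      then have x: "x \<in> X" "w \<in> lists X" "good s x"
        using Y good lists_mono[OF Y] by auto
      let ?x = "\<psi> (frag_of [x])" and ?w = "\<psi> (frag_of w)"
      have cl: "?x \<in> carrier A" "?w \<in> carrier A"
        using x by (auto intro!: psi_closed)
      have "G s (differential A (\<psi> (frag_of (x # w)))) =
          G s (differential A ?x) \<otimes>\<^bsub>E\<^esub> G s ?w \<oplus>\<^bsub>E\<^esub>
          [koszul_sign (dg x)] \<cdot>\<^bsub>E\<^esub> (G s ?x \<otimes>\<^bsub>E\<^esub> G s (differential A ?w))"
        unfolding psi_word[OF x(1,2)] leibniz[OF psi_letter[OF x(1)] cl(2)]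
        using cl by (simp add: hom_add hom_mult G_smult)
      also have "\<dots> = differential E (s x) \<otimes>\<^bsub>E\<^esub> word_eval E s w \<oplus>\<^bsub>E\<^esub>
          [koszul_sign (dg x)] \<cdot>\<^bsub>E\<^esub> (s x \<otimes>\<^bsub>E\<^esub> differential E (word_eval E s w))"
        using x Cons s by (simp add: G_psi good_def)
      also have "\<dots> = differential E (s x \<otimes>\<^bsub>E\<^esub> word_eval E s w)"
        using x s by (simp add: E.leibniz[of _ "dg x"] good_def)
      finally show ?case
        using s by simp
    qed
  qed
qed

end

text \<open>The differential of a generator involves generators of smaller rank only, so values can
  be chosen by well-founded recursion on the rank; each step is an instance of
  \<open>R_lift\<close>.\<close>

lemma exists_lift_if_filtered:
  fixes rank :: "'x \<Rightarrow> nat"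
  assumes rank: "\<And>x. x \<in> X \<Longrightarrow>
      \<eta> (differential A (\<psi> (frag_of [x]))) \<in> poly_over {y \<in> X. rank y < rank x}"
  shows "\<exists>g. dg_hom A E g \<and> (\<forall>a\<in>carrier A. R a (g a))"
proof -
  let ?Y = "\<lambda>x. {y \<in> X. rank y < rank x}"
  \<comment> \<open>Values at generators of rank not below that of \<open>x\<close> are replaced by
    zero, so the step at \<open>x\<close> consults earlier values only, and all values it uses are
    in the carrier by induction.\<close>
  define trunc where "trunc x s y = (if y \<in> ?Y x then s y else \<zero>\<^bsub>E\<^esub>)" for x and s :: "'x \<Rightarrow> 'e" and y
  define p where "p x = \<eta> (differential A (\<psi> (frag_of [x])))" for x
  define B where "B s x = (if x \<in> X then SOME e. e \<in> grading E (dg x) \<and> R (\<psi> (frag_of [x])) e \<and>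
      differential E e = free_eval E (trunc x s) (p x) else \<zero>\<^bsub>E\<^esub>)" for s x
  define s where "s = wfrec (measure rank) B"
  have trunc_cut: "trunc x (cut s (measure rank) x) = trunc x s" for x s
    by (auto simp: fun_eq_iff trunc_def cut_def)
  have s_eq: "s x = B s x" for x
    unfolding s_def by (subst wfrec[OF wf_measure]) (simp add: B_def trunc_cut)
  have p: "p x \<in> poly_over (?Y x)" if "x \<in> X" for x
    unfolding p_def using rank[OF that] .
  have step: "good s x" if "x \<in> X" for x
    using that
  proof (induction "rank x" arbitrary: x rule: less_induct)
    case less
    let ?t = "trunc x s"
    have good: "good s y" if "y \<in> ?Y x" for y
      using less that by auto
    then have t: "?t y \<in> carrier E" for y
      using E.grading_closed by (auto simp: trunc_def good_def)
    have eval_eq: "free_eval E s q = free_eval E ?t q" if "q \<in> poly_over (?Y x)" for q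
      by (rule E.free_eval_cong[of _ "?Y x"]) (use that t in \<open>auto simp: trunc_def\<close>)
    have good_t: "good ?t y" if y: "y \<in> ?Y x" for y
    proof -
      have "p y \<in> poly_over (?Y y)"
        using p y by simp
      moreover have "lists (?Y y) \<subseteq> lists (?Y x)"
        using y by (intro lists_mono) auto
      ultimately have "p y \<in> poly_over (?Y x)"
        by auto
      then show ?thesis
        using good[OF y] eval_eq y by (simp add: good_def p_def) (simp add: trunc_def)
    qed
    have x: "\<psi> (frag_of [x]) \<in> grading A (dg x)"
      using less.prems by (rule psi_letter)
    have dx: "differential A (\<psi> (frag_of [x])) \<in> grading A (dg x + 1)"
      using x by (rule differential_degree)
    have px: "\<psi> (p x) = differential A (\<psi> (frag_of [x]))"
      unfolding p_def by (rule psi_eta) (rule grading_closed[OF dx])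
    have sub: "?Y x \<subseteq> X"
      by auto
    have "free_eval E ?t (p x) \<in> grading E (dg x + 1)"
      by (rule free_eval_degree[OF t _ p[OF less.prems]])
        (use good_t eta_degree[OF dx] in \<open>auto simp: good_def p_def\<close>)
    moreover have "R (differential A (\<psi> (frag_of [x]))) (free_eval E ?t (p x))"
      using R_free_eval[OF t sub good_t p[OF less.prems]] by (simp add: px)
    \<comment> \<open>The prescribed differential is a cocycle: its own differential is the
      evaluation of the second differential of the generator.\<close>
    moreover have "differential E (free_eval E ?t (p x)) = \<zero>\<^bsub>E\<^esub>"
    proof -
      have "differential A (\<psi> (p x)) = \<psi> 0"
        using grading_closed[OF x] by (simp add: px differential_square psi_zero)
      then show ?thesis
        using differential_free_eval[OF t sub good_t p[OF less.prems]] eta_psi[of 0] t by simp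
    qed
    ultimately have "\<exists>e. e \<in> grading E (dg x) \<and> R (\<psi> (frag_of [x])) e \<and>
        differential E e = free_eval E ?t (p x)"
      using R_lift[OF x] by blast
    from someI_ex[OF this] have "s x \<in> grading E (dg x) \<and> R (\<psi> (frag_of [x])) (s x) \<and>
        differential E (s x) = free_eval E ?t (p x)"
      unfolding s_eq[of x] B_def using less.prems by simp
    then show ?case
      using eval_eq[OF p[OF less.prems]] by (simp add: good_def p_def)
  qed
  have s: "s x \<in> carrier E" for x
    using step[of x] s_eq[of x] E.grading_closed by (cases "x \<in> X") (auto simp: good_def B_def)
  have "dg_hom A E (\<lambda>a. G s a)"
    unfolding dg_hom_def
  proof (intro conjI allI ballI image_subsetI)
    show "(\<lambda>a. G s a) \<in> ring_hom A E"
      by (rule G_hom[OF s])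
  next
    fix i a assume a: "a \<in> grading A i"
    show "G s a \<in> grading E i"
      by (rule free_eval_degree[OF s _ eta_closed[OF grading_closed[OF a]] eta_degree[OF a]])
        (use step in \<open>auto simp: good_def\<close>)
  next
    fix a assume a: "a \<in> carrier A"
    show "G s (differential A a) = differential E (G s a)"
      using differential_free_eval[OF s order_refl step eta_closed[OF a]] psi_eta[OF a] by simp
  qed
  moreover have "R a (G s a)" if a: "a \<in> carrier A" for a
    using R_free_eval[OF s order_refl step eta_closed[OF a]] psi_eta[OF a] by simp
  ultimately show ?thesis
    by blast
qed

end

theorem semi_free_lift:
  fixes A :: "('a, 'm) dgring_scheme" and E :: "('e, 'n) dgring_scheme" and R :: "'a \<Rightarrow> 'e \<Rightarrow> bool"
  assumes "dg_ring A" "semi_free A" "dg_ring E"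
    and "R \<one>\<^bsub>A\<^esub> \<one>\<^bsub>E\<^esub>" "R \<zero>\<^bsub>A\<^esub> \<zero>\<^bsub>E\<^esub>"
    and "\<And>a b c e. \<lbrakk>a \<in> carrier A; b \<in> carrier A; c \<in> carrier E; e \<in> carrier E; R a c; R b e\<rbrakk> \<Longrightarrow>
      R (a \<ominus>\<^bsub>A\<^esub> b) (c \<ominus>\<^bsub>E\<^esub> e)"
    and "\<And>a b c e. \<lbrakk>a \<in> carrier A; b \<in> carrier A; c \<in> carrier E; e \<in> carrier E; R a c; R b e\<rbrakk> \<Longrightarrow>
      R (a \<otimes>\<^bsub>A\<^esub> b) (c \<otimes>\<^bsub>E\<^esub> e)"
    and "\<And>a z i. \<lbrakk>a \<in> grading A i; z \<in> grading E (i + 1); differential E z = \<zero>\<^bsub>E\<^esub>; R (differential A a) z\<rbrakk> \<Longrightarrow>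
      \<exists>e\<in>grading E i. R a e \<and> differential E e = z"
  shows "\<exists>g. dg_hom A E g \<and> (\<forall>a\<in>carrier A. R a (g a))"
proof -
  obtain X :: "'a set" and dg F \<psi> where *: "filtered_graded_set X dg F \<and>
        \<psi> \<in> ring_iso (free_ring X dg) A \<and>
        (\<forall>i. \<psi> ` grading (free_ring X dg) i = grading A i) \<and>
        (\<forall>j\<ge>0. \<forall>x\<in>F j.
           differential A (\<psi> (frag_of [x])) \<in> \<psi> ` free_ring_filtration F (j - 1))"
    using assms(2) unfolding semi_free_def by (elim exE)
  from * have F: "filtered_graded_set X dg F"
    by (elim conjE)
  from * have \<psi>: "\<psi> \<in> ring_iso (free_ring X dg) A" "\<psi> ` grading (free_ring X dg) i = grading A i" for i
    by (simp_all del: free_ring_simps)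
  from * have d: "differential A (\<psi> (frag_of [x])) \<in> \<psi> ` free_ring_filtration F (j - 1)" if "j \<ge> 0" "x \<in> F j" for j x
    using that by (simp del: free_ring_simps)
  interpret A: dg_ring A by fact
  interpret E: dg_ring E by fact
  interpret free_presentation A X dg \<psi>
    by unfold_locales (use \<psi> in auto)
  interpret free_lift A X dg \<psi> E R
    by unfold_locales (use assms in auto)
  \<comment> \<open>The rank is the first filtration step containing the generator; it is a natural
    number because \<open>F (-1)\<close> is empty.\<close>
  define rank where "rank x = (LEAST n. x \<in> F (int n))" for x
  have F_X: "F j \<subseteq> X" if "j \<ge> -1" for j
    using F that by (auto simp: filtered_graded_set_def)
  have rank_le: "rank x \<le> n" if "x \<in> F (int n)" for x n
    unfolding rank_def using that by (rule Least_le)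
  have in_rank: "x \<in> F (int (rank x))" if "x \<in> X" for x
  proof -
    obtain j where "j \<ge> -1" "x \<in> F j"
      using F \<open>x \<in> X\<close> by (auto simp: filtered_graded_set_def)
    moreover have "F (-1) = {}"
      using F by (simp add: filtered_graded_set_def)
    ultimately have "x \<in> F (int (nat j))"
      by (cases "j = -1") auto
    then show ?thesis
      unfolding rank_def by (rule LeastI)
  qed
  show ?thesis
  proof (rule exists_lift_if_filtered[of rank])
    fix x assume x: "x \<in> X"
    obtain q where q: "q \<in> free_ring_filtration F (int (rank x) - 1)"
      "differential A (\<psi> (frag_of [x])) = \<psi> q"
      using d[OF _ in_rank[OF x]] by auto
    have "q \<in> poly_over {y \<in> X. rank y < rank x}"
    proof (cases "rank x")
      \<comment> \<open>The filtration step below 0 is zero, so a generator of rank 0 is a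
        cocycle.\<close>
      case 0
      then show ?thesis
        using q(1) by (simp add: free_ring_filtration_def)
    next
      case (Suc n)
      then have "Poly_Mapping.keys q \<subseteq> lists (F (int n))"
        using q(1) by (simp add: free_ring_filtration_def)
      moreover have "F (int n) \<subseteq> {y \<in> X. rank y < rank x}"
        using F_X[of "int n"] rank_le[of _ n] Suc by (auto simp: less_Suc_eq_le)
      ultimately show ?thesis
        by (simp add: order_trans[OF _ lists_mono])
    qed
    moreover from this have "q \<in> poly_over X"
      by (rule poly_over_mono) auto
    ultimately show "\<eta> (differential A (\<psi> (frag_of [x]))) \<in> poly_over {y \<in> X. rank y < rank x}"
      unfolding q(2) by (simp only: eta_psi)
  qed
qed

section \<open>Extending cochain-valued homomorphisms\<close>

text \<open>The relation says that \<open>e\<close> has the prescribed images under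
  \<open>p1\<close> and \<open>p2\<close>. Homomorphisms make it stable under the ring operations,
  so only the solution of \<open>d e = z\<close> has to be supplied.\<close>

lemma semi_free_lift_over:
  assumes A: "dg_ring A" "semi_free A" and E: "dg_ring E" "dg_ring E1" "dg_ring E2"
    and p1: "dg_hom E E1 p1" and f1: "dg_hom A E1 f1" and p2: "dg_hom E E2 p2" and f2: "dg_hom A E2 f2"
    and lift: "\<And>a z i. \<lbrakk>a \<in> grading A i; z \<in> grading E (i + 1); differential E z = \<zero>\<^bsub>E\<^esub>;
      p1 z = differential E1 (f1 a); p2 z = differential E2 (f2 a)\<rbrakk> \<Longrightarrow>
      \<exists>e\<in>grading E i. p1 e = f1 a \<and> p2 e = f2 a \<and> differential E e = z"
  shows "\<exists>g. dg_hom A E g \<and> (\<forall>a\<in>carrier A. p1 (g a) = f1 a \<and> p2 (g a) = f2 a)"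
proof -
  interpret A: dg_ring A by fact
  have "\<exists>g. dg_hom A E g \<and> (\<forall>a\<in>carrier A. (\<lambda>a e. p1 e = f1 a \<and> p2 e = f2 a) a (g a))"
  proof (rule semi_free_lift[OF A E(1)])
    fix a z i assume "a \<in> grading A i" "z \<in> grading E (i + 1)" "differential E z = \<zero>\<^bsub>E\<^esub>"
      "p1 z = f1 (differential A a) \<and> p2 z = f2 (differential A a)"
    then show "\<exists>e\<in>grading E i. (p1 e = f1 a \<and> p2 e = f2 a) \<and> differential E e = z"
      using lift[of a i z] A.grading_closed dg_hom_differential[OF f1] dg_hom_differential[OF f2] by auto
  qed (simp_all add: dg_hom_one[OF p1] dg_hom_one[OF p2] dg_hom_one[OF f1] dg_hom_one[OF f2]
      dg_hom_zero[OF E(1,2) p1] dg_hom_zero[OF E(1,3) p2] dg_hom_zero[OF A(1) E(2) f1] dg_hom_zero[OF A(1) E(3) f2]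
      dg_hom_minus[OF E(1,2) p1] dg_hom_minus[OF E(1,3) p2] dg_hom_minus[OF A(1) E(2) f1] dg_hom_minus[OF A(1) E(3) f2]
      dg_hom_mult[OF p1] dg_hom_mult[OF p2] dg_hom_mult[OF f1] dg_hom_mult[OF f2])
  then show ?thesis
    by simp
qed

section \<open>Horns and boundaries as subcomplexes\<close>

definition top_simplex :: "nat \<Rightarrow> nat list" where
  "top_simplex q = [0..<Suc q]"

definition top_face :: "nat \<Rightarrow> nat \<Rightarrow> nat list" where
  "top_face q k = take k (top_simplex q) @ drop (Suc k) (top_simplex q)"

definition horn :: "nat \<Rightarrow> nat \<Rightarrow> nat list set" where
  "horn q k = {x \<in> nondeg q. \<exists>i\<le>q. i \<noteq> k \<and> i \<notin> set x}"

definition boundary :: "nat \<Rightarrow> nat list set" where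
  "boundary q = {x \<in> nondeg q. \<exists>i\<le>q. i \<notin> set x}"

lemma length_top_simplex [simp]: "length (top_simplex q) = Suc q"
  by (simp add: top_simplex_def)

lemma top_simplex_nondeg: "top_simplex q \<in> nondeg q"
  by (auto simp: top_simplex_def nondeg_def simp del: upt_Suc)

lemma top_face_eq: "k \<le> q \<Longrightarrow> top_face q k = [0..<k] @ [Suc k..<Suc q]"
  by (simp add: top_face_def top_simplex_def take_upt drop_upt del: upt_Suc)

lemma set_top_face: "k \<le> q \<Longrightarrow> set (top_face q k) = {..q} - {k}"
  by (auto simp: top_face_eq simp del: upt_Suc)

lemma length_top_face [simp]: "k \<le> q \<Longrightarrow> length (top_face q k) = q"
  by (simp add: top_face_def)

lemma top_face_nondeg: "k \<le> q \<Longrightarrow> 0 < q \<Longrightarrow> top_face q k \<in> nondeg q"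
proof -
  assume "k \<le> q" "0 < q"
  then have "top_face q k \<noteq> []"
    using length_top_face[of k q] by (metis list.size(3) less_irrefl)
  then show ?thesis
    using nondeg_subseq[OF top_simplex_nondeg] subseq_remove[of k "top_simplex q"]
    unfolding top_face_def by blast
qed

text \<open>A strictly increasing list is determined by its set of entries; this identifies the
  simplices missing from a horn or a boundary by their vertices.\<close>

lemma nondeg_set_eq: "x \<in> nondeg q \<Longrightarrow> y \<in> nondeg q \<Longrightarrow> set x = set y \<Longrightarrow> x = y"
  by (auto simp: nondeg_def strict_sorted_equal)

lemma set_top_simplex: "set (top_simplex q) = {..q}"
  by (auto simp: top_simplex_def simp del: upt_Suc)

lemma not_boundary: "x \<in> nondeg q \<Longrightarrow> x \<notin> boundary q \<Longrightarrow> x = top_simplex q"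
  by (rule nondeg_set_eq[OF _ top_simplex_nondeg])
    (auto simp: boundary_def set_top_simplex nondeg_def)

lemma not_horn:
  assumes "x \<in> nondeg q" "x \<notin> horn q k" "k \<le> q"
  shows "x = top_simplex q \<or> x = top_face q k"
proof (cases "k \<in> set x")
  case True
  then have "x \<notin> boundary q"
    using assms by (auto simp: horn_def boundary_def)
  then show ?thesis
    using not_boundary assms by blast
next
  case False
  then have "set x = {..q} - {k}"
    using assms by (auto simp: horn_def nondeg_def)
  moreover have "x \<noteq> []"
    using assms(1) by (auto simp: nondeg_def)
  \<comment> \<open>If \<open>q\<close> were 0, then \<open>k\<close> would be 0 as well and
    \<open>x\<close> would be empty.\<close>
  ultimately have "0 < q"
    using assms(3) by (cases q) auto
  then show ?thesis
    using nondeg_set_eq[OF assms(1) top_face_nondeg[OF assms(3)]] \<open>set x = _\<close> set_top_face[OF assms(3)] by simp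
qed

lemma top_simplex_notin: "top_simplex q \<notin> boundary q" "top_simplex q \<notin> horn q k"
  by (auto simp: boundary_def horn_def set_top_simplex)

lemma top_face_notin: "k \<le> q \<Longrightarrow> top_face q k \<notin> horn q k"
  by (auto simp: horn_def set_top_face)

lemma top_face_in_horn: "j \<le> q \<Longrightarrow> j \<noteq> k \<Longrightarrow> 0 < q \<Longrightarrow> top_face q j \<in> horn q k"
  by (auto simp: horn_def set_top_face top_face_nondeg)

lemma top_face_in_boundary: "j \<le> q \<Longrightarrow> 0 < q \<Longrightarrow> top_face q j \<in> boundary q"
  by (auto simp: boundary_def set_top_face top_face_nondeg)

lemma subcomplex_horn: "subcomplex (horn q k)"
  by (rule subcomplexI_nondeg[of _ q]) (use nondeg_subseq set_mono_subseq in \<open>fastforce simp: horn_def\<close>)+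

lemma subcomplex_boundary: "subcomplex (boundary q)"
  by (rule subcomplexI_nondeg[of _ q]) (use nondeg_subseq set_mono_subseq in \<open>fastforce simp: boundary_def\<close>)+

lemma pullback_id: "pullback L B id \<phi> = (\<lambda>x. if x \<in> L then \<phi> x else \<zero>\<^bsub>B\<^esub>)"
  by (simp add: fun_eq_iff pullback_def)

locale cochain_extension = K: cochain_algebra B M + L: cochain_algebra B L
  for B :: "('b, 'm) dgring_scheme" (structure) and M L :: "nat list set" +
  assumes sub: "L \<subseteq> M"
begin

lemma dg_hom_restrict: "dg_hom (cochains M B) (cochains L B) (pullback L B id)"
  using sub by (intro dg_hom_pullback) (auto simp: K.dg_ring_axioms K.subcomplex L.subcomplex)

lemma total_diff_on_L:
  assumes "x \<in> L" "\<And>y. y \<in> L \<Longrightarrow> \<phi> y = \<psi> y" "\<phi> [] = \<zero>" "\<psi> [] = \<zero>"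
  shows "total_diff B \<phi> x = total_diff B \<psi> x"
proof (rule total_diff_cong_subseq)
  fix y assume "subseq y x"
  then show "\<phi> y = \<psi> y"
    using assms L.L_subseq[OF assms(1), of y] by (cases "y = []") auto
qed

end

text \<open>Restriction to the horn has an acyclic kernel: a cochain vanishing on the horn has two
  free values, on the missing face and on the top simplex, and the simplicial differential links
  them by the identity up to sign.\<close>

theorem horn_extension:
  fixes A :: "('a, 'k) dgring_scheme" and B :: "('b, 'm) dgring_scheme" (structure)
  assumes A: "dg_ring A" "semi_free A" and B: "dg_ring B" and k: "k \<le> q" "0 < q"
    and G: "dg_hom A (cochains (horn q k) B) G"
  shows "\<exists>g. dg_hom A (cochains (nondeg q) B) g \<and> (\<forall>a\<in>carrier A. \<forall>x\<in>horn q k. g a x = G a x)"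
proof -
  let ?L = "horn q k" and ?M = "nondeg q" and ?\<tau> = "top_simplex q" and ?\<sigma> = "top_face q k"
  interpret A: dg_ring A by fact
  interpret dg_ring B by fact
  interpret X: cochain_extension B ?M ?L
    by unfold_locales (auto simp: subcomplex_nondeg subcomplex_horn, simp add: horn_def)
  let ?K = "cochains ?M B" and ?KL = "cochains ?L B"
  have K: "dg_ring ?K" and KL: "dg_ring ?KL"
    by (rule X.K.dg_ring_cochains, rule X.L.dg_ring_cochains)
  interpret K: dg_ring ?K by fact
  interpret KL: dg_ring ?KL by fact
  note p = X.dg_hom_restrict
  have "\<exists>g. dg_hom A ?K g \<and> (\<forall>a\<in>carrier A. pullback ?L B id (g a) = G a \<and> pullback ?L B id (g a) = G a)"
  \<comment> \<open>The only constraint is the restriction to the horn; it is supplied for both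
    pairs of maps.\<close>
  proof (rule semi_free_lift_over[OF A K KL KL p G p G])
    fix a z i assume a: "a \<in> grading A i" and z: "z \<in> grading ?K (i + 1)" and dz: "differential ?K z = \<zero>\<^bsub>?K\<^esub>"
      and zL: "pullback ?L B id z = differential ?KL (G a)"
    have Ga: "G a \<in> grading ?KL i"
      using dg_hom_degree[OF G a] .
    have Ga_deg: "G a x \<in> grading B (i + 1 - int (length x))" and Ga_out: "x \<notin> ?L \<Longrightarrow> G a x = \<zero>" for x
      using Ga by (simp_all add: cochains_simps)
    have Ga_c [simp]: "G a x \<in> carrier B" for x
      using Ga_deg by (rule grading_closed)
    have z_deg: "z x \<in> grading B (i + 2 - int (length x))" and z_out: "x \<notin> ?M \<Longrightarrow> z x = \<zero>" for x
      using z by (simp_all add: cochains_simps algebra_simps)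
    have z_c [simp]: "z x \<in> carrier B" for x
      using z_deg by (rule grading_closed)
    have zK: "z \<in> carrier ?K"
      using z by (rule K.grading_closed)
    have z_L: "z x = total_diff B (G a) x" if "x \<in> ?L" for x
      using fun_cong[OF zL, of x] that by (simp add: pullback_id cochains_simps)
    txt \<open>The value on the missing face is forced by \<open>d e = z\<close> at the top simplex, where \<open>e\<close> is set to zero.\<close>
    define u where "u = z ?\<tau> \<ominus> total_diff B (G a) ?\<tau>"
    \<comment> \<open>The face opposite vertex \<open>k\<close> enters the differential with the
      sign (-1)^k, which \<open>c\<close> undoes.\<close>
    define c where "c = (if even k then u else \<ominus> u)"
    have "total_diff B (G a) ?\<tau> \<in> grading B (i + 1 + 1 - int (length ?\<tau>))"
      by (rule total_diff_degree) (rule Ga_deg)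
    then have u: "u \<in> grading B (i + 1 - int q)"
      unfolding u_def using z_deg[of ?\<tau>] by (intro grading_minus) (simp_all add: algebra_simps)
    then have c: "c \<in> grading B (i + 1 - int q)" and [simp]: "u \<in> carrier B"
      by (auto simp: c_def grading_neg grading_closed)
    have [simp]: "c \<in> carrier B"
      using c by (rule grading_closed)
    define \<chi> where "\<chi> x = (if x = ?\<sigma> then c else \<zero>)" for x
    define e where "e x = G a x \<oplus> \<chi> x" for x
    have \<sigma>: "?\<sigma> \<in> ?M" "?\<sigma> \<notin> ?L" "?\<sigma> \<noteq> ?\<tau>" "?\<sigma> \<noteq> []" "length ?\<sigma> = q"
      using k top_face_nondeg[of k q] top_face_notin[of k q] length_top_face[of k q]
      by (auto simp del: length_top_face)
    have e_L: "e x = G a x" if "x \<in> ?L" for x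
      using that \<sigma> by (auto simp: e_def \<chi>_def)
    have e: "e \<in> grading ?K i"
      using Ga_deg c \<sigma> Ga_out X.sub by (auto simp: cochains_simps e_def \<chi>_def intro!: grading_add)
    have eK: "e \<in> carrier ?K"
      using e by (rule K.grading_closed)
    then have e_c [simp]: "e x \<in> carrier B" for x
      by (simp add: cochains_simps)
    have \<chi>_c [simp]: "\<chi> x \<in> carrier B" for x
      by (simp add: \<chi>_def)
    have faces: "top_face q j \<noteq> ?\<sigma>" if "j \<le> q" "j \<noteq> k" for j
      using set_top_face[OF that(1)] set_top_face[OF k(1)] that k by (metis Diff_iff atMost_iff singleton_iff)
    have "total_diff B \<chi> ?\<tau> = (if even k then \<chi> ?\<sigma> else \<ominus> \<chi> ?\<sigma>)"
      unfolding top_face_def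
      by (rule total_diff_single_face)
        (use \<sigma> k faces in \<open>auto simp: \<chi>_def top_face_def[symmetric] less_Suc_eq_le\<close>)
    then have "total_diff B \<chi> ?\<tau> = u"
      by (simp add: \<chi>_def c_def)
    then have "total_diff B e ?\<tau> = total_diff B (G a) ?\<tau> \<oplus> u"
      unfolding e_def by (subst total_diff_add) auto
    also have "\<dots> = z ?\<tau>"
      by (simp add: u_def a_minus_def a_lcomm r_neg)
    finally have de_\<tau>: "total_diff B e ?\<tau> = z ?\<tau>" .
    txt \<open>Since \<open>w\<close> is a cocycle that vanishes everywhere else, it vanishes on the missing face too.\<close>
    define w where "w x = differential ?K e x \<ominus> z x" for x
    have dK: "differential ?K e \<in> carrier ?K"
      using eK by simp
    have w_eq: "w = differential ?K e \<ominus>\<^bsub>?K\<^esub> z"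
      using zK by (simp add: K.minus_eq X.K.cochains_neg) (simp add: w_def fun_eq_iff a_minus_def cochains_simps)
    have wK: "w \<in> carrier ?K"
      unfolding w_eq using dK zK by simp
    have w_c: "w x \<in> carrier B" for x
      using wK by (simp add: cochains_simps)
    have w_L: "w x = \<zero>" if "x \<in> ?L" for x
    proof -
      have "total_diff B e x = total_diff B (G a) x"
        by (rule X.total_diff_on_L[OF that e_L]) (use X.L.Nil_notin \<sigma> Ga_out in \<open>auto simp: e_def \<chi>_def\<close>)
      then show ?thesis
        using that X.sub z_L[OF that] by (auto simp: w_def cochains_simps minus_eq r_neg)
    qed
    have w_\<tau>: "w ?\<tau> = \<zero>"
      using de_\<tau> by (simp add: w_def cochains_simps top_simplex_nondeg minus_eq r_neg)
    have "differential ?K w = \<zero>\<^bsub>?K\<^esub>"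
      unfolding w_eq using dK zK eK dz by (simp add: K.differential_add K.differential_neg K.differential_square K.minus_eq)
    then have "total_diff B w ?\<tau> = \<zero>"
      using top_simplex_nondeg[of q] by (metis (mono_tags) cochains_simps(4,7))
    moreover have "total_diff B w ?\<tau> = (if even k then w ?\<sigma> else \<ominus> w ?\<sigma>)"
      unfolding top_face_def
      by (rule total_diff_single_face)
        (use w_c w_\<tau> w_L k top_face_in_horn in \<open>auto simp: top_face_def[symmetric] less_Suc_eq_le\<close>)
    ultimately have w_\<sigma>: "w ?\<sigma> = \<zero>"
      using w_c[of ?\<sigma>] add.inv_eq_1_iff by (auto split: if_splits)
    have "w x = \<zero>" for x
      using not_horn[of x q k] k w_L[of x] w_\<tau> w_\<sigma> wK by (cases "x \<in> ?M") (auto simp: cochains_simps)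
    then have "differential ?K e x = z x" for x
      using dK minus_zeroD[of "differential ?K e x" "z x"] by (simp add: w_def cochains_simps)
    moreover have "pullback ?L B id e = G a"
      using e_L Ga_out by (auto simp: pullback_id)
    ultimately show "\<exists>e\<in>grading ?K i. pullback ?L B id e = G a \<and> pullback ?L B id e = G a \<and> differential ?K e = z"
      using e by blast
  qed
  then obtain g where g: "dg_hom A ?K g" "\<And>a. a \<in> carrier A \<Longrightarrow> pullback ?L B id (g a) = G a"
    by blast
  have "g a x = G a x" if "a \<in> carrier A" "x \<in> ?L" for a x
    using fun_cong[OF g(2)[OF that(1)], of x] that(2) by (simp add: pullback_id)
  then show ?thesis
    using g(1) by blast
qed

text \<open>Since \<open>v u\<close> is a coboundary, injectivity on cohomology gives
  \<open>x0\<close> with differential \<open>u\<close>. Then \<open>v x0\<close> differs from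
  \<open>y\<close> by a cocycle, which by surjectivity on cohomology is the image of a cocycle
  \<open>t\<close> up to a coboundary; surjectivity of \<open>v\<close> lifts that
  coboundary.\<close>

lemma quasi_iso_lift:
  fixes B' :: "('b, 'm) dgring_scheme" and B :: "('c, 'n) dgring_scheme"
  assumes B': "dg_ring B'" and B: "dg_ring B" and v: "dg_hom B' B v"
    and surj: "v ` carrier B' = carrier B" and qi: "quasi_iso B' B v"
    and u: "u \<in> grading B' (i + 1)" "differential B' u = \<zero>\<^bsub>B'\<^esub>"
    and y: "y \<in> grading B i" "v u = differential B y"
  shows "\<exists>x\<in>grading B' i. v x = y \<and> differential B' x = u"
proof -
  interpret B': dg_ring B' by fact
  interpret B: dg_ring B by fact
  note v_simps = dg_hom_closed[OF v] dg_hom_add[OF v] dg_hom_minus[OF B' B v] dg_hom_degree[OF v]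
    dg_hom_differential[OF v] dg_hom_zero[OF B' B v] dg_hom_neg[OF B' B v]
  \<comment> \<open>As \<open>v\<close> preserves degrees, the part of degree \<open>j\<close> of
    any preimage of \<open>b\<close> is again a preimage.\<close>
  have surj_deg: "\<exists>x\<in>grading B' j. v x = b" if b: "b \<in> grading B j" for b j
  proof -
    obtain x where x: "x \<in> carrier B'" "v x = b"
      using B.grading_closed[OF b] unfolding surj[symmetric] by (elim imageE) simp
    define c where "c = homogeneous_part B' x"
    have c: "c k \<in> grading B' k" for k
      unfolding c_def by (rule B'.homogeneous_part_degree[OF x(1)])
    have fin: "finite (homogeneous_support B' x)" and x_eq: "x = finsum B' c (homogeneous_support B' x)"
      unfolding c_def using B'.finite_homogeneous_support[OF x(1)] B'.homogeneous_part_sum[OF x(1)] by blast+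
    have "v (finsum B' c F) = finsum B (\<lambda>k. v (c k)) F" if "finite F" for F
      using that by (induction F rule: finite_induct)
        (use B'.grading_closed[OF c] in \<open>simp_all add: v_simps B'.finsum_insert B.finsum_insert Pi_iff\<close>)
    from this[OF fin] have b_eq: "b = finsum B (\<lambda>k. v (c k)) (homogeneous_support B' x)"
      using x(2) x_eq by metis
    have "homogeneous_decomposition B b (\<lambda>k. v (c k))"
      by (rule B.homogeneous_decompositionI[OF v_simps(4)[OF c] fin _ b_eq])
        (simp add: c_def homogeneous_support_def v_simps)
    then have "v (c j) = b"
      using B.homogeneous_part_eqI B.homogeneous_part_homogeneous[OF b] by metis
    then show ?thesis
      using c by blast
  qed
  have cob': "coboundaries B' j \<subseteq> carrier B'" and cob: "coboundaries B j \<subseteq> carrier B" for j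
    using B'.grading_closed B.grading_closed by (auto simp: coboundaries_def)
  define cls where "cls j t = coboundaries B' j #>\<^bsub>cocycle_group B' j\<^esub> t" for j t
  have coset: "cls j t = {s \<oplus>\<^bsub>B'\<^esub> t | s. s \<in> coboundaries B' j}" for j t
    by (auto simp: cls_def r_coset_def cocycle_group_def)
  have mem_self: "t \<in> cls j t" if "t \<in> carrier B'" for t j
    unfolding coset coboundaries_def using that
    by (auto intro!: exI[of _ "\<zero>\<^bsub>B'\<^esub>"] image_eqI[of _ _ "\<zero>\<^bsub>B'\<^esub>"])
  \<comment> \<open>The product of cosets adds coboundaries from both rings; those of
    \<open>B'\<close> are mapped among those of \<open>B\<close> and are absorbed there.\<close>
  have map_cls: "cohomology_map B v j (cls j t) = {s \<oplus>\<^bsub>B\<^esub> v t | s. s \<in> coboundaries B j}"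
    if t: "t \<in> carrier B'" for j t
  proof -
    have sum: "(s1 \<oplus>\<^bsub>B\<^esub> v s2) \<in> coboundaries B j" if "s1 \<in> coboundaries B j" "s2 \<in> coboundaries B' j" for s1 s2
    proof -
      obtain a b where "a \<in> grading B (j - 1)" "s1 = differential B a" "b \<in> grading B' (j - 1)" "s2 = differential B' b"
        using \<open>s1 \<in> _\<close> \<open>s2 \<in> _\<close> by (auto simp: coboundaries_def)
      then have "s1 \<oplus>\<^bsub>B\<^esub> v s2 = differential B (a \<oplus>\<^bsub>B\<^esub> v b)" "a \<oplus>\<^bsub>B\<^esub> v b \<in> grading B (j - 1)"
        using B.grading_closed B'.grading_closed
        by (simp_all add: v_simps B.differential_add B.grading_add)
      then show ?thesis
        by (auto simp: coboundaries_def)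
    qed
    have "cohomology_map B v j (cls j t) =
        {s1 \<oplus>\<^bsub>B\<^esub> v (s2 \<oplus>\<^bsub>B'\<^esub> t) | s1 s2. s1 \<in> coboundaries B j \<and> s2 \<in> coboundaries B' j}"
      by (auto simp: cohomology_map_def set_mult_def cocycle_group_def coset)
    also have "\<dots> = {s \<oplus>\<^bsub>B\<^esub> v t | s. s \<in> coboundaries B j}"
    proof (intro equalityI subsetI)
      fix r assume "r \<in> {s1 \<oplus>\<^bsub>B\<^esub> v (s2 \<oplus>\<^bsub>B'\<^esub> t) | s1 s2. s1 \<in> coboundaries B j \<and> s2 \<in> coboundaries B' j}"
      then obtain s1 s2 where s: "s1 \<in> coboundaries B j" "s2 \<in> coboundaries B' j" and r: "r = s1 \<oplus>\<^bsub>B\<^esub> v (s2 \<oplus>\<^bsub>B'\<^esub> t)"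
        by blast
      have "s1 \<in> carrier B" "s2 \<in> carrier B'"
        using s cob cob' by auto
      then have "r = (s1 \<oplus>\<^bsub>B\<^esub> v s2) \<oplus>\<^bsub>B\<^esub> v t"
        unfolding r using t by (simp add: v_simps B.a_assoc)
      then show "r \<in> {s \<oplus>\<^bsub>B\<^esub> v t | s. s \<in> coboundaries B j}"
        using sum[OF s] by blast
    next
      fix r assume "r \<in> {s \<oplus>\<^bsub>B\<^esub> v t | s. s \<in> coboundaries B j}"
      moreover have "\<zero>\<^bsub>B'\<^esub> \<in> coboundaries B' j"
        by (auto simp: coboundaries_def intro!: image_eqI[of _ _ "\<zero>\<^bsub>B'\<^esub>"])
      ultimately show "r \<in> {s1 \<oplus>\<^bsub>B\<^esub> v (s2 \<oplus>\<^bsub>B'\<^esub> t) | s1 s2. s1 \<in> coboundaries B j \<and> s2 \<in> coboundaries B' j}"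
        using t B'.l_zero[OF t] by force
    qed
    finally show ?thesis .
  qed
  have carrier_coh: "carrier (cohomology B' j) = cls j ` cocycles B' j" for j
    by (auto simp: cohomology_def carrier_FactGroup cls_def cocycle_group_def)
  have bij: "bij_betw (cohomology_map B v j) (carrier (cohomology B' j)) (carrier (cohomology B j))" for j
    using qi by (simp add: quasi_iso_def iso_def)
  have yc: "y \<in> carrier B" and uc: "u \<in> carrier B'"
    using y u B.grading_closed B'.grading_closed by blast+
  have "\<exists>x0\<in>grading B' i. differential B' x0 = u"
  proof -
    have uz: "u \<in> cocycles B' (i + 1)" "\<zero>\<^bsub>B'\<^esub> \<in> cocycles B' (i + 1)"
      using u by (auto simp: cocycles_def)
    have "cohomology_map B v (i + 1) (cls (i + 1) u) = cohomology_map B v (i + 1) (cls (i + 1) \<zero>\<^bsub>B'\<^esub>)"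
    proof -
      have "{s \<oplus>\<^bsub>B\<^esub> differential B y | s. s \<in> coboundaries B (i + 1)} = coboundaries B (i + 1)"
      proof (intro equalityI subsetI)
        fix r assume "r \<in> {s \<oplus>\<^bsub>B\<^esub> differential B y | s. s \<in> coboundaries B (i + 1)}"
        then obtain a where a: "a \<in> grading B i" "r = differential B a \<oplus>\<^bsub>B\<^esub> differential B y"
          by (auto simp: coboundaries_def)
        then have "r = differential B (a \<oplus>\<^bsub>B\<^esub> y)"
          using yc B.grading_closed by (simp add: B.differential_add)
        then show "r \<in> coboundaries B (i + 1)"
          using a y B.grading_add[of a i y] by (auto simp: coboundaries_def)
      next
        fix r assume "r \<in> coboundaries B (i + 1)"
        then obtain a where a: "a \<in> grading B i" "r = differential B a"
          by (auto simp: coboundaries_def)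
        then have "r = differential B (a \<ominus>\<^bsub>B\<^esub> y) \<oplus>\<^bsub>B\<^esub> differential B y"
          using yc B.grading_closed[OF a(1)] by (simp add: B.differential_add B.differential_neg B.minus_eq B.a_assoc B.l_neg)
        moreover have "differential B (a \<ominus>\<^bsub>B\<^esub> y) \<in> coboundaries B (i + 1)"
          using a y B.grading_minus[of a i y] by (auto simp: coboundaries_def)
        ultimately show "r \<in> {s \<oplus>\<^bsub>B\<^esub> differential B y | s. s \<in> coboundaries B (i + 1)}"
          by blast
      qed
      moreover have "{s \<oplus>\<^bsub>B\<^esub> \<zero>\<^bsub>B\<^esub> | s. s \<in> coboundaries B (i + 1)} = coboundaries B (i + 1)"
        using cob[of "i + 1"] B.r_zero by force
      ultimately show ?thesis
        using map_cls[OF uc] map_cls[OF B'.zero_closed] by (simp add: y v_simps)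
    qed
    then have "cls (i + 1) u = cls (i + 1) \<zero>\<^bsub>B'\<^esub>"
      using bij[of "i + 1"] uz unfolding carrier_coh by (meson bij_betw_imp_inj_on imageI inj_on_eq_iff)
    then have "u \<in> cls (i + 1) \<zero>\<^bsub>B'\<^esub>"
      using mem_self[OF uc, of "i + 1"] by simp
    then obtain s where "s \<in> coboundaries B' (i + 1)" "u = s \<oplus>\<^bsub>B'\<^esub> \<zero>\<^bsub>B'\<^esub>"
      unfolding coset by blast
    then show ?thesis
      using cob' by (auto simp: coboundaries_def B'.grading_closed)
  qed
  then obtain x0 where x0: "x0 \<in> grading B' i" "differential B' x0 = u"
    by blast
  have x0c: "x0 \<in> carrier B'"
    using x0 B'.grading_closed by blast
  define r where "r = v x0 \<ominus>\<^bsub>B\<^esub> y"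
  have r: "r \<in> grading B i"
    unfolding r_def by (rule B.grading_minus[OF v_simps(4)[OF x0(1)] y(1)])
  have "differential B (v x0) = differential B y"
    using dg_hom_differential[OF v x0c] x0 y by simp
  then have dr: "differential B r = \<zero>\<^bsub>B\<^esub>"
    unfolding r_def using v_simps(1)[OF x0c] yc by (simp add: B.differential_add B.differential_neg B.minus_eq B.r_neg)
  have "r \<in> carrier (cocycle_group B i)"
    using r dr by (simp add: cocycle_group_def cocycles_def)
  then have "coboundaries B i #>\<^bsub>cocycle_group B i\<^esub> r \<in> carrier (cohomology B i)"
    unfolding cohomology_def carrier_FactGroup by (rule imageI)
  then have "coboundaries B i #>\<^bsub>cocycle_group B i\<^esub> r \<in> cohomology_map B v i ` cls i ` cocycles B' i"
    by (simp only: bij_betw_imp_surj_on[OF bij] carrier_coh[symmetric])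
  then obtain t where t: "t \<in> cocycles B' i" "cohomology_map B v i (cls i t) = coboundaries B i #>\<^bsub>cocycle_group B i\<^esub> r"
    by (elim imageE) simp
  have tc: "t \<in> carrier B'" "t \<in> grading B' i" "differential B' t = \<zero>\<^bsub>B'\<^esub>"
    using t B'.grading_closed by (auto simp: cocycles_def)
  have "v t \<in> cohomology_map B v i (cls i t)"
    unfolding map_cls[OF tc(1)] coboundaries_def using v_simps(1)[OF tc(1)]
    by (auto intro!: exI[of _ "\<zero>\<^bsub>B\<^esub>"] image_eqI[of _ _ "\<zero>\<^bsub>B\<^esub>"])
  then obtain a where a: "a \<in> grading B (i - 1)" "v t = differential B a \<oplus>\<^bsub>B\<^esub> r"
    unfolding t(2) by (auto simp: r_coset_def cocycle_group_def coboundaries_def)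
  obtain a' where a': "a' \<in> grading B' (i - 1)" "v a' = a"
    using surj_deg[OF a(1)] by blast
  have ac: "a \<in> carrier B" "a' \<in> carrier B'" and da': "differential B' a' \<in> grading B' i"
    using a a' B.grading_closed B'.grading_closed B'.differential_degree[of a' "i - 1"] by auto
  \<comment> \<open>With \<open>v t = d a + r\<close> and \<open>v x0 = r + y\<close>, subtracting
    \<open>t\<close> and adding \<open>d a'\<close> makes the image \<open>y\<close>. Both
    corrections are cocycles, so the differential stays \<open>u\<close>.\<close>
  define x where "x = (x0 \<ominus>\<^bsub>B'\<^esub> t) \<oplus>\<^bsub>B'\<^esub> differential B' a'"
  have "x \<in> grading B' i"
    unfolding x_def using x0 tc da' by (intro B'.grading_add B'.grading_minus)
  moreover have "differential B' x = u"
    unfolding x_def using x0 tc ac x0c uc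
    by (simp add: B'.differential_add B'.differential_neg B'.differential_square B'.minus_eq)
  moreover have "v x = y"
  proof -
    have rc: "r \<in> carrier B" and vx: "v x0 = r \<oplus>\<^bsub>B\<^esub> y"
      using B.grading_closed[OF r] x0c yc by (auto simp: r_def B.minus_eq B.a_assoc B.l_neg v_simps)
    have "v x = (v x0 \<ominus>\<^bsub>B\<^esub> v t) \<oplus>\<^bsub>B\<^esub> differential B a"
      unfolding x_def using x0c tc ac a' by (simp add: v_simps)
    also have "\<dots> = ((r \<oplus>\<^bsub>B\<^esub> y) \<ominus>\<^bsub>B\<^esub> (differential B a \<oplus>\<^bsub>B\<^esub> r)) \<oplus>\<^bsub>B\<^esub> differential B a"
      by (simp add: vx a)
    also have "\<dots> = y"
      using rc yc B.differential_closed[OF ac(1)] by algebra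
    finally show ?thesis .
  qed
  ultimately show ?thesis
    by blast
qed

text \<open>Off the boundary only the value at the top simplex is free. Its differential is
  prescribed by \<open>z\<close> and its image under \<open>v\<close> by \<open>g\<close>; the work
  lies in showing that these data meet the premises of \<open>lift\<close>.\<close>

theorem boundary_extension:
  fixes A :: "('a, 'k) dgring_scheme" and B' :: "('b, 'm) dgring_scheme" (structure)
    and B :: "('c, 'n) dgring_scheme"
  assumes A: "dg_ring A" "semi_free A" and B': "dg_ring B'" and B: "dg_ring B" and v: "dg_hom B' B v"
    and lift: "\<And>u y i. \<lbrakk>u \<in> grading B' (i + 1); differential B' u = \<zero>; y \<in> grading B i; v u = differential B y\<rbrakk> \<Longrightarrow>
      \<exists>x\<in>grading B' i. v x = y \<and> differential B' x = u"
    and G: "dg_hom A (cochains (boundary q) B') G" and g: "dg_hom A (cochains (nondeg q) B) g"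
    and compatible: "\<And>a x. a \<in> carrier A \<Longrightarrow> x \<in> boundary q \<Longrightarrow> v (G a x) = g a x"
  shows "\<exists>h. dg_hom A (cochains (nondeg q) B') h \<and>
    (\<forall>a\<in>carrier A. (\<forall>x\<in>boundary q. h a x = G a x) \<and> (\<forall>x. v (h a x) = g a x))"
proof -
  let ?L = "boundary q" and ?M = "nondeg q" and ?\<tau> = "top_simplex q"
  interpret A: dg_ring A by fact
  interpret dg_ring B' by fact
  interpret B: dg_ring B by fact
  interpret X: cochain_extension B' ?M ?L
    by unfold_locales (auto simp: subcomplex_nondeg subcomplex_boundary, simp add: boundary_def)
  interpret Y: cochain_algebra B ?M
    by unfold_locales (rule subcomplex_nondeg)
  let ?K = "cochains ?M B'" and ?KL = "cochains ?L B'" and ?KB = "cochains ?M B"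
  have K: "dg_ring ?K" and KL: "dg_ring ?KL" and KB: "dg_ring ?KB"
    by (rule X.K.dg_ring_cochains, rule X.L.dg_ring_cochains, rule Y.dg_ring_cochains)
  interpret K: dg_ring ?K by fact
  interpret KL: dg_ring ?KL by fact
  interpret KB: dg_ring ?KB by fact
  note p = X.dg_hom_restrict
  note V = dg_hom_coefficients[OF B' B v subcomplex_nondeg[of q]]
  note v_simps = dg_hom_closed[OF v] dg_hom_add[OF v] dg_hom_minus[OF B' B v] dg_hom_degree[OF v]
    dg_hom_differential[OF v] dg_hom_zero[OF B' B v] dg_hom_neg[OF B' B v]
  have "\<exists>h. dg_hom A ?K h \<and> (\<forall>a\<in>carrier A. pullback ?L B' id (h a) = G a \<and> (\<lambda>x. v (h a x)) = g a)"
  proof (rule semi_free_lift_over[OF A K KL KB p G V g])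
    fix a z i assume a: "a \<in> grading A i" and z: "z \<in> grading ?K (i + 1)" and dz: "differential ?K z = \<zero>\<^bsub>?K\<^esub>"
      and zL: "pullback ?L B' id z = differential ?KL (G a)" and vz: "(\<lambda>x. v (z x)) = differential ?KB (g a)"
    have aA: "a \<in> carrier A"
      using a by (rule A.grading_closed)
    have Ga: "G a \<in> grading ?KL i" and ga: "g a \<in> grading ?KB i"
      using dg_hom_degree[OF G a] dg_hom_degree[OF g a] .
    have Ga_deg: "G a x \<in> grading B' (i + 1 - int (length x))" and Ga_out: "x \<notin> ?L \<Longrightarrow> G a x = \<zero>" for x
      using Ga by (simp_all add: cochains_simps)
    have ga_deg: "g a x \<in> grading B (i + 1 - int (length x))" and ga_out: "x \<notin> ?M \<Longrightarrow> g a x = \<zero>\<^bsub>B\<^esub>" for x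
      using ga by (simp_all add: cochains_simps)
    have Ga_c [simp]: "G a x \<in> carrier B'" and ga_c [simp]: "g a x \<in> carrier B" for x
      using grading_closed[OF Ga_deg] B.grading_closed[OF ga_deg] .
    have z_deg: "z x \<in> grading B' (i + 2 - int (length x))" and z_out: "x \<notin> ?M \<Longrightarrow> z x = \<zero>" for x
      using z by (simp_all add: cochains_simps algebra_simps)
    have z_c [simp]: "z x \<in> carrier B'" for x
      using z_deg by (rule grading_closed)
    have zK: "z \<in> carrier ?K"
      using z by (rule K.grading_closed)
    have z_L: "z x = total_diff B' (G a) x" if "x \<in> ?L" for x
      using fun_cong[OF zL, of x] that by (simp add: pullback_id cochains_simps)
    have e0: "G a \<in> grading ?K i"
      using Ga_deg Ga_out X.sub by (auto simp: cochains_simps)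
    have e0K: "G a \<in> carrier ?K"
      using e0 by (rule K.grading_closed)
    \<comment> \<open>In dimension 0 the only face is the empty list, where all cochains
      vanish.\<close>
    have faces: "take j ?\<tau> @ drop (Suc j) ?\<tau> \<in> ?L \<or> take j ?\<tau> @ drop (Suc j) ?\<tau> = []" if "j < length ?\<tau>" for j
    proof (cases "q = 0")
      case True
      then show ?thesis
        using that by (simp add: top_simplex_def)
    next
      case False
      then show ?thesis
        using that top_face_in_boundary[of j q] by (simp add: top_face_def)
    qed
    define u where "u = z ?\<tau> \<ominus> total_diff B' (G a) ?\<tau>"
    \<comment> \<open>At the top simplex the differential of the coefficient carries the sign
      (-1)^q, which \<open>s\<close> undoes.\<close>
    define s where "s = (if odd (length ?\<tau>) then u else \<ominus> u)"
    have "total_diff B' (G a) ?\<tau> \<in> grading B' (i + 1 + 1 - int (length ?\<tau>))"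
      by (rule total_diff_degree) (rule Ga_deg)
    then have u: "u \<in> grading B' (i - int q + 1)"
      unfolding u_def using z_deg[of ?\<tau>] by (intro grading_minus) (simp_all add: algebra_simps)
    then have s: "s \<in> grading B' (i - int q + 1)" and [simp]: "u \<in> carrier B'"
      by (auto simp: s_def grading_neg grading_closed)
    \<comment> \<open>The cocycle \<open>w\<close> vanishes on the boundary and has the value
      \<open>u\<close> at the top, so the vanishing of its differential says that \<open>u\<close>
      is a cocycle.\<close>
    define w where "w = z \<ominus>\<^bsub>?K\<^esub> differential ?K (G a)"
    have dK: "differential ?K (G a) \<in> carrier ?K"
      using e0K by simp
    have w_eq: "w x = z x \<ominus> differential ?K (G a) x" for x
      unfolding w_def using dK
      by (simp add: K.minus_eq X.K.cochains_neg) (simp add: a_minus_def cochains_simps)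
    have wK: "w \<in> carrier ?K"
      unfolding w_def using dK zK by simp
    have w_c: "w x \<in> carrier B'" for x
      using wK by (simp add: cochains_simps)
    have w_L: "w x = \<zero>" if "x \<in> ?L" for x
      using that X.sub z_L[OF that] by (auto simp: w_eq cochains_simps minus_eq r_neg)
    have w_\<tau>: "w ?\<tau> = u"
      by (simp add: w_eq u_def cochains_simps top_simplex_nondeg)
    have w_Nil: "w [] = \<zero>"
      using wK X.K.Nil_notin by (simp add: cochains_simps)
    have "differential ?K w = \<zero>\<^bsub>?K\<^esub>"
      unfolding w_def using dK zK e0K dz by (simp add: K.differential_add K.differential_neg K.differential_square K.minus_eq)
    then have "total_diff B' w ?\<tau> = \<zero>"
      using top_simplex_nondeg[of q] by (metis (mono_tags) cochains_simps(4,7))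
    moreover have "total_diff B' w ?\<tau> = (if odd (length ?\<tau>) then differential B' (w ?\<tau>) else \<ominus> differential B' (w ?\<tau>))"
      using faces w_L w_Nil w_c by (intro total_diff_no_face) metis+
    ultimately have "differential B' u = \<zero>"
      using add.inv_eq_1_iff[of "differential B' u"] by (simp add: w_\<tau> split: if_splits)
    then have ds: "differential B' s = \<zero>"
      by (simp add: s_def differential_neg)
    have vs: "v s = differential B (g a ?\<tau>)"
    proof -
      \<comment> \<open>The difference of \<open>g a\<close> and the image of \<open>G a\<close>
        vanishes on the boundary, so its total differential at the top simplex is, up to sign, the
        differential of \<open>g a ?\<tau>\<close>.\<close>
      let ?\<delta> = "\<lambda>x. g a x \<oplus>\<^bsub>B\<^esub> \<ominus>\<^bsub>B\<^esub> v (G a x)"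
      have \<delta>: "?\<delta> x = \<zero>\<^bsub>B\<^esub>" if "x \<in> ?L \<or> x = []" for x
        using that compatible[OF aA, of x] X.L.Nil_notin X.K.Nil_notin Ga_out[of "[]"] ga_out[of "[]"] ga_c[of x]
        by (auto simp: v_simps B.r_neg simp del: ga_c)
      have "v (z ?\<tau>) = total_diff B (g a) ?\<tau>"
        using fun_cong[OF vz, of ?\<tau>] by (simp add: cochains_simps top_simplex_nondeg)
      moreover have "v (total_diff B' (G a) ?\<tau>) = total_diff B (\<lambda>x. v (G a x)) ?\<tau>"
        using fun_cong[OF dg_hom_differential[OF V e0K], of ?\<tau>] by (simp add: cochains_simps top_simplex_nondeg)
      ultimately have "v u = total_diff B (g a) ?\<tau> \<ominus>\<^bsub>B\<^esub> total_diff B (\<lambda>x. v (G a x)) ?\<tau>"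
        by (simp add: u_def v_simps)
      also have "\<dots> = total_diff B ?\<delta> ?\<tau>"
        by (subst B.total_diff_add) (simp_all add: v_simps B.total_diff_neg a_minus_def)
      also have "\<dots> = (if odd (length ?\<tau>) then differential B (?\<delta> ?\<tau>) else \<ominus>\<^bsub>B\<^esub> differential B (?\<delta> ?\<tau>))"
        using faces \<delta> by (intro B.total_diff_no_face) (simp_all add: v_simps)
      also have "?\<delta> ?\<tau> = g a ?\<tau>"
        using Ga_out[OF top_simplex_notin(1)] by (simp add: v_simps)
      finally show ?thesis
        by (auto simp: s_def v_simps)
    qed
    have "g a ?\<tau> \<in> grading B (i - int q)"
      using ga_deg[of ?\<tau>] by simp
    then obtain b where b: "b \<in> grading B' (i - int q)" "v b = g a ?\<tau>" "differential B' b = s"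
      using lift[OF s ds _ vs] by blast
    have bc [simp]: "b \<in> carrier B'"
      using b by (auto intro: grading_closed)
    define \<chi> where "\<chi> x = (if x = ?\<tau> then b else \<zero>)" for x
    define e where "e x = G a x \<oplus> \<chi> x" for x
    have \<chi>_c [simp]: "\<chi> x \<in> carrier B'" for x
      by (simp add: \<chi>_def)
    have e_L: "e x = G a x" if "x \<in> ?L" for x
      using that top_simplex_notin by (auto simp: e_def \<chi>_def)
    have e: "e \<in> grading ?K i"
      using Ga_deg Ga_deg[of ?\<tau>] b(1) Ga_out X.sub top_simplex_nondeg[of q]
      by (auto simp: cochains_simps e_def \<chi>_def intro!: grading_add)
    have "differential ?K e x = z x" for x
    proof (cases "x \<in> ?L")
      case True
      have "total_diff B' e x = total_diff B' (G a) x"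
        by (rule X.total_diff_on_L[OF True e_L])
          (use X.L.Nil_notin X.K.Nil_notin top_simplex_nondeg[of q] Ga_out in \<open>auto simp: e_def \<chi>_def\<close>)
      then show ?thesis
        using True X.sub z_L by (auto simp: cochains_simps)
    next
      case False
      show ?thesis
      proof (cases "x \<in> ?M")
        case True
        then have x: "x = ?\<tau>"
          using not_boundary False by blast
        have nt: "take j ?\<tau> @ drop (Suc j) ?\<tau> \<noteq> ?\<tau>" if "j < length ?\<tau>" for j
          using faces[OF that] top_simplex_notin(1) top_simplex_nondeg[of q] X.K.Nil_notin by metis
        have "total_diff B' \<chi> ?\<tau> = (if odd (length ?\<tau>) then differential B' (\<chi> ?\<tau>) else \<ominus> differential B' (\<chi> ?\<tau>))"
          using nt by (intro total_diff_no_face) (simp_all add: \<chi>_def)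
        also have "\<dots> = u"
          using b by (simp add: \<chi>_def s_def)
        finally have "total_diff B' e ?\<tau> = total_diff B' (G a) ?\<tau> \<oplus> u"
          unfolding e_def by (subst total_diff_add) auto
        also have "\<dots> = z ?\<tau>"
          by (simp add: u_def a_minus_def a_lcomm r_neg)
        finally show ?thesis
          using True x by (simp add: cochains_simps)
      qed (simp add: cochains_simps z_out)
    qed
    moreover have "pullback ?L B' id e = G a"
      using e_L Ga_out by (auto simp: pullback_id)
    moreover have "v (e x) = g a x" for x
    proof (cases "x = ?\<tau>")
      case True
      then show ?thesis
        using Ga_out[OF top_simplex_notin(1)] b by (simp add: e_def \<chi>_def)
    next
      case False
      then have "e x = G a x"
        by (simp add: e_def \<chi>_def)
      then show ?thesis
        using False not_boundary[of x q] compatible[OF aA, of x] Ga_out[of x] ga_out[of x] X.sub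
        by (cases "x \<in> ?L"; cases "x \<in> ?M") (auto simp: v_simps)
    qed
    ultimately show "\<exists>e\<in>grading ?K i. pullback ?L B' id e = G a \<and> (\<lambda>x. v (e x)) = g a \<and> differential ?K e = z"
      using e by blast
  qed
  then obtain h where h: "dg_hom A ?K h" "\<And>a. a \<in> carrier A \<Longrightarrow> pullback ?L B' id (h a) = G a"
    "\<And>a. a \<in> carrier A \<Longrightarrow> (\<lambda>x. v (h a x)) = g a"
    by blast
  have "h a x = G a x" if "a \<in> carrier A" "x \<in> ?L" for a x
    using fun_cong[OF h(2)[OF that(1)], of x] that(2) by (simp add: pullback_id)
  moreover have "v (h a x) = g a x" if "a \<in> carrier A" for a x
    using fun_cong[OF h(3)[OF that], of x] .
  ultimately show ?thesis
    using h(1) by blast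
qed

section \<open>The fundamental groupoid in low dimensions\<close>

context simplicial_set
begin

lemma op_op_eq:
  assumes "x \<in> simplices X n" "\<theta> \<in> monotone_maps m n" "\<eta> \<in> monotone_maps l m"
    "\<theta>' \<in> monotone_maps m' n" "\<eta>' \<in> monotone_maps l m'" "monotone_comp \<theta> \<eta> = monotone_comp \<theta>' \<eta>'"
  shows "simplicial_op X m \<eta> (simplicial_op X n \<theta> x) = simplicial_op X m' \<eta>' (simplicial_op X n \<theta>' x)"
  using op_comp[OF assms(2,3,1)] op_comp[OF assms(4,5,1)] assms(6) by simp

lemma op_op_id:
  assumes "x \<in> simplices X n" "\<theta> \<in> monotone_maps m n" "\<eta> \<in> monotone_maps n m" "monotone_comp \<theta> \<eta> = [0..<Suc n]"
  shows "simplicial_op X m \<eta> (simplicial_op X n \<theta> x) = x"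
  using op_comp[OF assms(2,3,1)] assms(4) op_id[OF assms(1)] by simp

lemma face_closed: "x \<in> simplices X (Suc n) \<Longrightarrow> i \<le> Suc n \<Longrightarrow> face X (Suc n) i x \<in> simplices X n"
  unfolding face_def by (rule op_closed) (auto simp: monotone_maps_def sorted_append simp del: upt_Suc)

lemma degen_closed: "x \<in> simplices X n \<Longrightarrow> i \<le> n \<Longrightarrow> degen X n i x \<in> simplices X (Suc n)"
  unfolding degen_def by (rule op_closed) (auto simp: monotone_maps_def sorted_append simp del: upt_Suc)

lemma face_face_1:
  assumes "x \<in> simplices X 2"
  shows "face X 1 0 (face X 2 2 x) = face X 1 1 (face X 2 0 x)"
    "face X 1 1 (face X 2 1 x) = face X 1 1 (face X 2 2 x)"
    "face X 1 0 (face X 2 1 x) = face X 1 0 (face X 2 0 x)"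
  unfolding face_def
  by (rule op_op_eq[OF assms]; simp add: monotone_maps_def monotone_comp_def numeral_2_eq_2 upt_rec)+

lemma face_face_2:
  assumes "x \<in> simplices X 3" "i < j" "j \<le> 3"
  shows "face X 2 i (face X 3 j x) = face X 2 (j - 1) (face X 3 i x)"
proof -
  have "i = 0 \<and> j = 1 \<or> i = 0 \<and> j = 2 \<or> i = 0 \<and> j = 3 \<or> i = 1 \<and> j = 2 \<or> i = 1 \<and> j = 3 \<or> i = 2 \<and> j = 3"
    using assms(2,3) by presburger
  then consider "i = 0" "j = 1" | "i = 0" "j = 2" | "i = 0" "j = 3" | "i = 1" "j = 2" | "i = 1" "j = 3" | "i = 2" "j = 3"
    by blast
  then show ?thesis
    unfolding face_def
    by cases
      (hypsubst, rule op_op_eq[OF assms(1)];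
        simp add: monotone_maps_def monotone_comp_def numeral_2_eq_2 numeral_3_eq_3 upt_rec)+
qed

lemma face_degen_0:
  assumes "x \<in> simplices X 0"
  shows "face X 1 0 (degen X 0 0 x) = x" "face X 1 1 (degen X 0 0 x) = x"
  unfolding face_def degen_def
  by (rule op_op_id[OF assms]; simp add: monotone_maps_def monotone_comp_def upt_rec)+

lemma face_degen_1:
  assumes "x \<in> simplices X 1"
  shows "face X 2 0 (degen X 1 0 x) = x" "face X 2 1 (degen X 1 0 x) = x"
    "face X 2 1 (degen X 1 1 x) = x" "face X 2 2 (degen X 1 1 x) = x"
    "face X 2 2 (degen X 1 0 x) = degen X 0 0 (face X 1 1 x)"
    "face X 2 0 (degen X 1 1 x) = degen X 0 0 (face X 1 0 x)"
  unfolding face_def degen_def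
  by ((rule op_op_id[OF assms] | rule op_op_eq[OF assms]);
      simp add: monotone_maps_def monotone_comp_def numeral_2_eq_2 upt_rec)+

end

section \<open>Composition and homotopy of edges from horn fillers\<close>

definition fills_horn :: "'s sset \<Rightarrow> nat \<Rightarrow> nat \<Rightarrow> bool" where
  "fills_horn S n k \<longleftrightarrow> (\<forall>f. (\<forall>i\<le>n. i \<noteq> k \<longrightarrow> f i \<in> simplices S (n - 1)) \<and>
     (\<forall>i j. i < j \<and> j \<le> n \<and> i \<noteq> k \<and> j \<noteq> k \<longrightarrow> face S (n - 1) i (f j) = face S (n - 1) (j - 1) (f i)) \<longrightarrow>
     (\<exists>h\<in>simplices S n. \<forall>i\<le>n. i \<noteq> k \<longrightarrow> face S n i h = f i))"

text \<open>Each horn has its role: (2,1) composes edges, (2,0) gives left inverses, and (3,1) and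
  (3,2) give the equivalence relation, independence of representatives and associativity.\<close>

locale low_kan = simplicial_set S for S :: "'s sset" +
  assumes horn_2_0: "fills_horn S 2 0" and horn_2_1: "fills_horn S 2 1"
    and horn_3_1: "fills_horn S 3 1" and horn_3_2: "fills_horn S 3 2"
begin

abbreviation "src g \<equiv> face S 1 1 g"
abbreviation "tgt g \<equiv> face S 1 0 g"
abbreviation "ide x \<equiv> degen S 0 0 x"
abbreviation "cls g \<equiv> edge_homotopy S `` {g}"

text \<open>\<open>triangle a b c\<close> exhibits \<open>b\<close> as a composite of \<open>c\<close> followed by \<open>a\<close>.\<close>

definition triangle :: "'s \<Rightarrow> 's \<Rightarrow> 's \<Rightarrow> bool" where
  "triangle a b c \<longleftrightarrow> (\<exists>h\<in>simplices S 2. face S 2 0 h = a \<and> face S 2 1 h = b \<and> face S 2 2 h = c)"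

lemma edge_ends: "g \<in> simplices S 1 \<Longrightarrow> src g \<in> simplices S 0" "g \<in> simplices S 1 \<Longrightarrow> tgt g \<in> simplices S 0"
  using face_closed[of g 0] by simp_all

lemma ide_edge: "x \<in> simplices S 0 \<Longrightarrow> ide x \<in> simplices S 1" "x \<in> simplices S 0 \<Longrightarrow> src (ide x) = x"
  "x \<in> simplices S 0 \<Longrightarrow> tgt (ide x) = x"
  using degen_closed[of x 0 0] face_degen_0 by simp_all

lemma triangleD:
  assumes "triangle a b c"
  shows "a \<in> simplices S 1" "b \<in> simplices S 1" "c \<in> simplices S 1"
    "tgt c = src a" "src b = src c" "tgt b = tgt a"
  using assms face_closed[of _ 1] face_face_1 by (auto simp: triangle_def numeral_2_eq_2[symmetric])

lemma triangle_ide: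
  assumes "g \<in> simplices S 1"
  shows "triangle (ide (tgt g)) g g" "triangle g g (ide (src g))"
  using degen_closed[OF assms, of 0] degen_closed[OF assms, of 1] face_degen_1[OF assms]
  unfolding triangle_def by (auto simp: numeral_2_eq_2[symmetric])

lemma triangle_compose:
  assumes "a \<in> simplices S 1" "c \<in> simplices S 1" "tgt c = src a"
  shows "\<exists>b. triangle a b c"
proof -
  let ?f = "\<lambda>i::nat. if i = 0 then a else c"
  have "\<exists>h\<in>simplices S 2. \<forall>i\<le>2. i \<noteq> 1 \<longrightarrow> face S 2 i h = ?f i"
  proof (rule horn_2_1[unfolded fills_horn_def, rule_format], intro conjI allI impI)
    fix i j :: nat assume "i < j \<and> j \<le> 2 \<and> i \<noteq> 1 \<and> j \<noteq> 1"
    then have "i = 0" "j = 2"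
      by auto
    then show "face S (2 - 1) i (?f j) = face S (2 - 1) (j - 1) (?f i)"
      using assms by simp
  qed (use assms in auto)
  then obtain h where h: "h \<in> simplices S 2" "\<forall>i\<le>2. i \<noteq> 1 \<longrightarrow> face S 2 i h = ?f i"
    by blast
  then have "face S 2 0 h = a" "face S 2 2 h = c"
    using h(2)[rule_format, of 0] h(2)[rule_format, of 2] by auto
  then show ?thesis
    using h(1) by (auto simp: triangle_def)
qed

text \<open>Filling the horn at vertex 0 solves for the edge that follows \<open>c\<close>; if
  \<open>b\<close> is an identity, the solution is a left inverse of \<open>c\<close>.\<close>

lemma triangle_divide:
  assumes "b \<in> simplices S 1" "c \<in> simplices S 1" "src b = src c"
  shows "\<exists>a. triangle a b c"
proof -
  let ?f = "\<lambda>i::nat. if i = 1 then b else c"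
  have "\<exists>h\<in>simplices S 2. \<forall>i\<le>2. i \<noteq> 0 \<longrightarrow> face S 2 i h = ?f i"
  proof (rule horn_2_0[unfolded fills_horn_def, rule_format], intro conjI allI impI)
    fix i j :: nat assume "i < j \<and> j \<le> 2 \<and> i \<noteq> 0 \<and> j \<noteq> 0"
    then have "i = 1" "j = 2"
      by auto
    then show "face S (2 - 1) i (?f j) = face S (2 - 1) (j - 1) (?f i)"
      using assms by simp
  qed (use assms in auto)
  then obtain h where h: "h \<in> simplices S 2" "\<forall>i\<le>2. i \<noteq> 0 \<longrightarrow> face S 2 i h = ?f i"
    by blast
  then have "face S 2 1 h = b" "face S 2 2 h = c"
    using h(2)[rule_format, of 1] h(2)[rule_format, of 2] by auto
  then show ?thesis
    using h(1) by (auto simp: triangle_def)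
qed

text \<open>The names \<open>eij\<close> refer to the edges of a tetrahedron with vertices 0, 1, 2, 3.\<close>

lemma tetrahedron_face_1:
  assumes "triangle e12 e02 e01" "triangle e13 e03 e01" "triangle e23 e13 e12"
  shows "triangle e23 e03 e02"
proof -
  obtain h3 h2 h0 where h: "h3 \<in> simplices S 2" "h2 \<in> simplices S 2" "h0 \<in> simplices S 2"
    "face S 2 0 h3 = e12" "face S 2 1 h3 = e02" "face S 2 2 h3 = e01"
    "face S 2 0 h2 = e13" "face S 2 1 h2 = e03" "face S 2 2 h2 = e01"
    "face S 2 0 h0 = e23" "face S 2 1 h0 = e13" "face S 2 2 h0 = e12"
    using assms unfolding triangle_def by blast
  let ?f = "\<lambda>i::nat. if i = 0 then h0 else if i = 2 then h2 else h3"
  have "\<exists>h\<in>simplices S 3. \<forall>i\<le>3. i \<noteq> 1 \<longrightarrow> face S 3 i h = ?f i"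
  proof (rule horn_3_1[unfolded fills_horn_def, rule_format], intro conjI allI impI)
    fix i j :: nat assume "i < j \<and> j \<le> 3 \<and> i \<noteq> 1 \<and> j \<noteq> 1"
    then consider "i = 0" "j = 2" | "i = 0" "j = 3" | "i = 2" "j = 3"
      by linarith
    then show "face S (3 - 1) i (?f j) = face S (3 - 1) (j - 1) (?f i)"
      using h by cases simp_all
  qed (use h in auto)
  then obtain H where H: "H \<in> simplices S 3" "\<forall>i\<le>3. i \<noteq> 1 \<longrightarrow> face S 3 i H = ?f i"
    by blast
  have "face S 3 1 H \<in> simplices S 2"
    using face_closed[of H 2 1] H(1) by (simp add: numeral_3_eq_3 numeral_2_eq_2)
  moreover have "face S 2 0 (face S 3 1 H) = e23"
    using face_face_2[OF H(1), of 0 1] H(2)[rule_format, of 0] h by simp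
  moreover have "face S 2 1 (face S 3 1 H) = e03"
    using face_face_2[OF H(1), of 1 2] H(2)[rule_format, of 2] h by simp
  moreover have "face S 2 2 (face S 3 1 H) = e02"
    using face_face_2[OF H(1), of 1 3] H(2)[rule_format, of 3] h by simp
  ultimately show ?thesis
    unfolding triangle_def by blast
qed

text \<open>The horn at vertex 2: its filler supplies the face with the edges 01, 13 and 03.\<close>

lemma tetrahedron_face_2:
  assumes "triangle e12 e02 e01" "triangle e23 e03 e02" "triangle e23 e13 e12"
  shows "triangle e13 e03 e01"
proof -
  obtain h3 h1 h0 where h: "h3 \<in> simplices S 2" "h1 \<in> simplices S 2" "h0 \<in> simplices S 2"
    "face S 2 0 h3 = e12" "face S 2 1 h3 = e02" "face S 2 2 h3 = e01"
    "face S 2 0 h1 = e23" "face S 2 1 h1 = e03" "face S 2 2 h1 = e02"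
    "face S 2 0 h0 = e23" "face S 2 1 h0 = e13" "face S 2 2 h0 = e12"
    using assms unfolding triangle_def by blast
  let ?f = "\<lambda>i::nat. if i = 0 then h0 else if i = 1 then h1 else h3"
  have "\<exists>h\<in>simplices S 3. \<forall>i\<le>3. i \<noteq> 2 \<longrightarrow> face S 3 i h = ?f i"
  proof (rule horn_3_2[unfolded fills_horn_def, rule_format], intro conjI allI impI)
    fix i j :: nat assume "i < j \<and> j \<le> 3 \<and> i \<noteq> 2 \<and> j \<noteq> 2"
    then consider "i = 0" "j = 1" | "i = 0" "j = 3" | "i = 1" "j = 3"
      by linarith
    then show "face S (3 - 1) i (?f j) = face S (3 - 1) (j - 1) (?f i)"
      using h by cases simp_all
  qed (use h in auto)
  then obtain H where H: "H \<in> simplices S 3" "\<forall>i\<le>3. i \<noteq> 2 \<longrightarrow> face S 3 i H = ?f i"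
    by blast
  have "face S 3 2 H \<in> simplices S 2"
    using face_closed[of H 2 2] H(1) by (simp add: numeral_3_eq_3 numeral_2_eq_2)
  moreover have "face S 2 0 (face S 3 2 H) = e13"
    using face_face_2[OF H(1), of 0 2] H(2)[rule_format, of 0] h by simp
  moreover have "face S 2 1 (face S 3 2 H) = e03"
    using face_face_2[OF H(1), of 1 2] H(2)[rule_format, of 1] h by simp
  moreover have "face S 2 2 (face S 3 2 H) = e01"
    using face_face_2[OF H(1), of 2 3] H(2)[rule_format, of 3] h by simp
  ultimately show ?thesis
    unfolding triangle_def by blast
qed

lemma homotopy_iff:
  "(g, g') \<in> edge_homotopy S \<longleftrightarrow> triangle (ide (tgt g)) g' g \<and> g \<in> simplices S 1 \<and> tgt g' = tgt g"
proof
  assume "(g, g') \<in> edge_homotopy S"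
  then show "triangle (ide (tgt g)) g' g \<and> g \<in> simplices S 1 \<and> tgt g' = tgt g"
    by (auto simp: edge_homotopy_def edges_def triangle_def)
next
  assume "triangle (ide (tgt g)) g' g \<and> g \<in> simplices S 1 \<and> tgt g' = tgt g"
  then show "(g, g') \<in> edge_homotopy S"
    using triangleD[of "ide (tgt g)" g' g] edge_ends
    unfolding edge_homotopy_def edges_def triangle_def[symmetric] by auto
qed

lemma homotopy_ends:
  "(g, g') \<in> edge_homotopy S \<Longrightarrow> g' \<in> simplices S 1 \<and> src g' = src g \<and> tgt g' = tgt g"
  using triangleD(2,5)[of "ide (tgt g)" g' g] by (simp add: homotopy_iff)

lemma homotopyI: "triangle (ide y) g' g \<Longrightarrow> y = tgt g \<Longrightarrow> (g, g') \<in> edge_homotopy S"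
  using triangleD[of "ide (tgt g)" g' g] ide_edge[OF edge_ends(2)] by (simp add: homotopy_iff)

lemma homotopy_refl: "g \<in> simplices S 1 \<Longrightarrow> (g, g) \<in> edge_homotopy S"
  by (rule homotopyI[OF triangle_ide(1) refl])

text \<open>Take a tetrahedron whose last three vertices coincide and are joined by identities, with
  \<open>g\<close>, \<open>g'\<close> and \<open>g''\<close> issuing from vertex 0. Together with
  reflexivity this gives symmetry and transitivity.\<close>

lemma homotopy_euclid:
  assumes "(g, g') \<in> edge_homotopy S" "(g, g'') \<in> edge_homotopy S"
  shows "(g', g'') \<in> edge_homotopy S"
proof -
  let ?e = "ide (tgt g)"
  have e: "?e \<in> simplices S 1" "tgt ?e = tgt g"
    using assms edge_ends ide_edge by (auto simp: homotopy_iff)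
  have "triangle ?e ?e ?e"
    using triangle_ide(1)[OF e(1)] e by simp
  then have "triangle ?e g'' g'"
    using assms by (intro tetrahedron_face_1[of ?e g' g ?e g'' ?e]) (auto simp: homotopy_iff)
  then show ?thesis
    using homotopy_ends[OF assms(1)] by (auto intro: homotopyI)
qed

lemma homotopy_sym: "(g, g') \<in> edge_homotopy S \<Longrightarrow> (g', g) \<in> edge_homotopy S"
  using homotopy_euclid homotopy_refl homotopy_iff by blast

lemma homotopy_trans:
  "(g, g') \<in> edge_homotopy S \<Longrightarrow> (g', g'') \<in> edge_homotopy S \<Longrightarrow> (g, g'') \<in> edge_homotopy S"
  using homotopy_euclid homotopy_sym by blast

lemma cls_eq_iff: "g \<in> simplices S 1 \<Longrightarrow> cls g = cls g' \<longleftrightarrow> (g, g') \<in> edge_homotopy S"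
  using homotopy_refl homotopy_sym homotopy_trans by blast

text \<open>The tetrahedron has the two triangles as faces on \<open>c\<close> followed by
  \<open>a\<close>, with an identity added after \<open>a\<close>; its remaining face is the
  homotopy.\<close>

lemma triangle_unique:
  assumes "triangle a b c" "triangle a b' c"
  shows "(b, b') \<in> edge_homotopy S"
proof -
  have "triangle (ide (tgt a)) b' b"
    using triangle_ide(1)[OF triangleD(1)[OF assms(1)]] assms
    by (intro tetrahedron_face_1[of a b c a b' "ide (tgt a)"]) auto
  then show ?thesis
    using triangleD(6)[OF assms(1)] by (auto intro: homotopyI)
qed

text \<open>Here and in the next two lemmas, the known faces of the tetrahedron are the triangle to
  be modified, the given homotopy and a degenerate triangle.\<close>

lemma triangle_cong_left:
  assumes "triangle a b c" "(a, a') \<in> edge_homotopy S"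
  shows "triangle a' b c"
  using assms triangle_ide(1)[OF triangleD(2)[OF assms(1)]] triangleD(6)[OF assms(1)]
  by (intro tetrahedron_face_2[of a b c "ide (tgt a)" b a']) (auto simp: homotopy_iff)

lemma triangle_cong_right:
  assumes "triangle a b c" "(c, c') \<in> edge_homotopy S"
  shows "triangle a b c'"
  using assms triangle_ide(2)[OF triangleD(1)[OF assms(1)]] triangleD(4)[OF assms(1)]
  by (intro tetrahedron_face_1[of "ide (tgt c)" c' c a b a]) (auto simp: homotopy_iff)

lemma triangle_cong_mid:
  assumes "triangle a b c" "(b, b') \<in> edge_homotopy S"
  shows "triangle a b' c"
  using assms triangle_ide(1)[OF triangleD(1)[OF assms(1)]] triangleD(6)[OF assms(1)]
  by (intro tetrahedron_face_2[of a b c "ide (tgt a)" b' a]) (auto simp: homotopy_iff)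

abbreviation "FG \<equiv> fundamental_groupoid S"

lemma Hom_eq: "Hom FG x y = cls ` edges S x y"
  by (auto simp: fundamental_groupoid_def quotient_def)

text \<open>The congruence lemmas move all representatives to \<open>a\<close> and \<open>c\<close>;
  uniqueness and congruence in the middle edge then show that the composites form exactly one
  class.\<close>

lemma Comp_cls:
  assumes "triangle a b c"
  shows "Comp FG (cls a) (cls c) = cls b"
proof (intro equalityI subsetI)
  fix b' assume "b' \<in> Comp FG (cls a) (cls c)"
  then obtain a' c' where "(a, a') \<in> edge_homotopy S" "(c, c') \<in> edge_homotopy S" "triangle a' b' c'"
    by (auto simp: fundamental_groupoid_def triangle_def)
  then have "triangle a b' c"
    using triangle_cong_left triangle_cong_right homotopy_sym by blast
  then show "b' \<in> cls b"
    using triangle_unique[OF assms] by blast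
next
  fix b' assume "b' \<in> cls b"
  then have "triangle a b' c"
    using triangle_cong_mid[OF assms] by blast
  then show "b' \<in> Comp FG (cls a) (cls c)"
    using homotopy_refl[OF triangleD(1)[OF assms]] homotopy_refl[OF triangleD(3)[OF assms]]
      triangleD(2)[of a b' c]
    by (auto simp: fundamental_groupoid_def triangle_def)
qed

lemma edgesD: "g \<in> edges S x y \<Longrightarrow> g \<in> simplices S 1 \<and> src g = x \<and> tgt g = y"
  by (auto simp: edges_def)

lemma Idt_eq: "Idt FG x = cls (ide x)"
  by (simp add: fundamental_groupoid_def)

theorem groupoid_fundamental_groupoid: "groupoid FG"
proof
  fix x y x' y' f assume "f \<in> Hom FG x y" "f \<in> Hom FG x' y'"
  then obtain g g' where g: "g \<in> edges S x y" "g' \<in> edges S x' y'" "cls g = cls g'"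
    by (auto simp: Hom_eq)
  then have "(g, g') \<in> edge_homotopy S"
    using cls_eq_iff edgesD by blast
  then show "x = x' \<and> y = y'"
    using homotopy_ends[of g g'] edgesD[OF g(1)] edgesD[OF g(2)] by auto
next
  fix x y z f g assume "f \<in> Hom FG x y" "g \<in> Hom FG y z"
  then obtain c a where ca: "c \<in> edges S x y" "f = cls c" "a \<in> edges S y z" "g = cls a"
    by (auto simp: Hom_eq)
  then obtain b where b: "triangle a b c"
    using triangle_compose[of a c] edgesD by metis
  then have "b \<in> edges S x z"
    using triangleD[OF b] ca by (auto simp: edges_def)
  then show "Comp FG g f \<in> Hom FG x z"
    using Comp_cls[OF b] ca by (auto simp: Hom_eq)
next
  fix w x y z f g h assume "f \<in> Hom FG w x" "g \<in> Hom FG x y" "h \<in> Hom FG y z"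
  then obtain c a e where ca: "c \<in> edges S w x" "f = cls c" "a \<in> edges S x y" "g = cls a" "e \<in> edges S y z" "h = cls e"
    by (auto simp: Hom_eq)
  then obtain p r where p: "triangle a p c" and r: "triangle e r a"
    using triangle_compose[of a c] triangle_compose[of e a] edgesD by metis
  then obtain s where s: "triangle e s p"
    using triangle_compose[of e p] triangleD[OF p] triangleD[OF r] ca edgesD by metis
  \<comment> \<open>One tetrahedron on the three edges shows that \<open>s\<close>, a composite of
    \<open>p\<close> followed by \<open>e\<close>, is also a composite of \<open>c\<close> followed
    by \<open>r\<close>.\<close>
  have "triangle r s c"
    by (rule tetrahedron_face_2[OF p s r])
  then show "Comp FG h (Comp FG g f) = Comp FG (Comp FG h g) f"
    using p r s ca by (simp add: Comp_cls)
next
  fix x assume "x \<in> Obj FG"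
  then have "ide x \<in> edges S x x"
    using ide_edge[of x] by (simp add: edges_def fundamental_groupoid_def)
  then show "Idt FG x \<in> Hom FG x x"
    unfolding Hom_eq Idt_eq by (rule imageI)
next
  fix x y f assume "f \<in> Hom FG x y"
  then obtain c where c: "c \<in> edges S x y" "f = cls c"
    by (auto simp: Hom_eq)
  then show "Comp FG (Idt FG y) f = f" "Comp FG f (Idt FG x) = f"
    using triangle_ide[of c] edgesD[OF c(1)] by (auto simp: Idt_eq Comp_cls)
next
  fix x y f assume xy: "x \<in> Obj FG" "y \<in> Obj FG" and "f \<in> Hom FG x y"
  then obtain c where c: "c \<in> edges S x y" "f = cls c"
    by (auto simp: Hom_eq)
  have c1: "c \<in> simplices S 1" "src c = x" "tgt c = y"
    using edgesD[OF c(1)] by auto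
  have ob: "x \<in> simplices S 0" "y \<in> simplices S 0"
    using xy by (auto simp: fundamental_groupoid_def)
  \<comment> \<open>Division gives a left inverse \<open>a\<close> of \<open>c\<close> and a left
    inverse \<open>c'\<close> of \<open>a\<close>. Associativity makes \<open>c'\<close> homotopic
    to \<open>c\<close>, so \<open>a\<close> is a right inverse too.\<close>
  obtain a where a: "triangle a (ide x) c"
    using triangle_divide[of "ide x" c] ide_edge[OF ob(1)] c1 by auto
  have a1: "a \<in> simplices S 1" "src a = y" "tgt a = x"
    using triangleD[OF a] ide_edge[OF ob(1)] c1 by auto
  obtain c' where c': "triangle c' (ide y) a"
    using triangle_divide[of "ide y" a] ide_edge[OF ob(2)] a1 by auto
  have "triangle (ide y) c c"
    using triangle_ide(1)[OF c1(1)] c1 by simp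
  from tetrahedron_face_1[OF a this c'] have "triangle c' c (ide x)" .
  moreover have "triangle c' c' (ide x)"
    using triangle_ide(2)[OF triangleD(1)[OF c']] triangleD(4)[OF c'] a1 by simp
  ultimately have "(c', c) \<in> edge_homotopy S"
    using triangle_unique by blast
  then have "triangle c (ide y) a"
    by (rule triangle_cong_left[OF c'])
  then have "Comp FG (cls a) f = Idt FG x" "Comp FG f (cls a) = Idt FG y"
    using a c by (simp_all add: Comp_cls Idt_eq)
  moreover have "cls a \<in> Hom FG y x"
    using a1 by (auto simp: Hom_eq edges_def)
  ultimately show "\<exists>g\<in>Hom FG y x. Comp FG g f = Idt FG x \<and> Comp FG f g = Idt FG y"
    by blast
qed

end

text \<open>The liftings in dimensions 0, 1 and 2 give surjectivity on objects, fullness and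
  faithfulness. In dimension 2 the bare existence of a triangle is recorded, as homotopy asks for no
  more.\<close>

locale low_trivial_fibration = S: low_kan S + T: low_kan T for S :: "'s sset" and T :: "'t sset" +
  fixes F :: "nat \<Rightarrow> 's \<Rightarrow> 't"
  assumes F_closed: "x \<in> simplices S n \<Longrightarrow> F n x \<in> simplices T n"
    and F_face: "x \<in> simplices S (Suc n) \<Longrightarrow> i \<le> Suc n \<Longrightarrow> face T (Suc n) i (F (Suc n) x) = F n (face S (Suc n) i x)"
    and F_degen: "x \<in> simplices S 0 \<Longrightarrow> degen T 0 0 (F 0 x) = F 1 (degen S 0 0 x)"
    and lift_0: "y \<in> simplices T 0 \<Longrightarrow> \<exists>x\<in>simplices S 0. F 0 x = y"
    and lift_1: "\<lbrakk>x \<in> simplices S 0; x' \<in> simplices S 0; g \<in> edges T (F 0 x) (F 0 x')\<rbrakk> \<Longrightarrow>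
      \<exists>e\<in>edges S x x'. F 1 e = g"
    and lift_2: "\<lbrakk>a \<in> simplices S 1; b \<in> simplices S 1; c \<in> simplices S 1;
      S.tgt c = S.src a; S.src b = S.src c; S.tgt b = S.tgt a; T.triangle (F 1 a) (F 1 b) (F 1 c)\<rbrakk> \<Longrightarrow>
      S.triangle a b c"
begin

lemma F_ends: "g \<in> simplices S 1 \<Longrightarrow> T.src (F 1 g) = F 0 (S.src g)" "g \<in> simplices S 1 \<Longrightarrow> T.tgt (F 1 g) = F 0 (S.tgt g)"
  using F_face[of g 0] by simp_all

lemma F_triangle: "S.triangle a b c \<Longrightarrow> T.triangle (F 1 a) (F 1 b) (F 1 c)"
proof -
  assume "S.triangle a b c"
  then obtain h where h: "h \<in> simplices S 2" "face S 2 0 h = a" "face S 2 1 h = b" "face S 2 2 h = c"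
    by (auto simp: S.triangle_def)
  then show ?thesis
    using F_closed[OF h(1)] F_face[of h 1]
    unfolding T.triangle_def by (intro bexI[of _ "F 2 h"]) (simp_all add: numeral_2_eq_2)
qed

lemma F_edges: "g \<in> edges S x y \<Longrightarrow> F 1 g \<in> edges T (F 0 x) (F 0 y)"
  using F_ends F_closed by (auto simp: edges_def)

lemma F_homotopy: "(g, g') \<in> edge_homotopy S \<Longrightarrow> (F 1 g, F 1 g') \<in> edge_homotopy T"
  using F_triangle[of "S.ide (S.tgt g)" g' g] F_degen S.edge_ends F_ends
  by (auto simp: S.homotopy_iff intro!: T.homotopyI)

lemma fundamental_map_cls: "g \<in> simplices S 1 \<Longrightarrow> fundamental_map T F (S.cls g) = T.cls (F 1 g)"
  using F_homotopy S.homotopy_refl T.homotopy_trans T.homotopy_sym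
  unfolding fundamental_map_def by blast

theorem surjective_equivalence_fundamental:
  "surjective_equivalence (fundamental_groupoid S) (fundamental_groupoid T) (F 0) (fundamental_map T F)"
proof -
  have Obj: "Obj (fundamental_groupoid S) = simplices S 0" "Obj (fundamental_groupoid T) = simplices T 0"
    by (simp_all add: fundamental_groupoid_def)
  interpret S': groupoid "fundamental_groupoid S"
    by (rule S.groupoid_fundamental_groupoid)
  interpret T': groupoid "fundamental_groupoid T"
    by (rule T.groupoid_fundamental_groupoid)
  have is_functor: "groupoid_functor (fundamental_groupoid S) (fundamental_groupoid T) (F 0) (fundamental_map T F)"
  proof
    fix x y f assume "f \<in> Hom S.FG x y"
    then obtain g where "g \<in> edges S x y" "f = S.cls g"
      by (auto simp: S.Hom_eq)
    then show "fundamental_map T F f \<in> Hom T.FG (F 0 x) (F 0 y)"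
      using F_edges[of g x y] S.edgesD[of g x y] by (auto simp: T.Hom_eq fundamental_map_cls)
  next
    fix x y z f g assume "f \<in> Hom S.FG x y" "g \<in> Hom S.FG y z"
    then obtain c a where ca: "c \<in> edges S x y" "f = S.cls c" "a \<in> edges S y z" "g = S.cls a"
      by (auto simp: S.Hom_eq)
    then obtain b where b: "S.triangle a b c"
      using S.triangle_compose[of a c] S.edgesD by metis
    show "fundamental_map T F (Comp S.FG g f) = Comp T.FG (fundamental_map T F g) (fundamental_map T F f)"
      using S.triangleD(1-3)[OF b]
      by (simp only: ca S.Comp_cls[OF b] fundamental_map_cls T.Comp_cls[OF F_triangle[OF b]])
  next
    fix x assume "x \<in> Obj S.FG"
    then show "fundamental_map T F (Idt S.FG x) = Idt T.FG (F 0 x)"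
      by (simp only: Obj S.Idt_eq T.Idt_eq fundamental_map_cls[OF S.ide_edge(1)] F_degen)
  qed (auto simp: Obj F_closed)
  have full: "fundamental_map T F ` Hom S.FG x y = Hom T.FG (F 0 x) (F 0 y)"
    if "x \<in> simplices S 0" "y \<in> simplices S 0" for x y
  proof -
    have "fundamental_map T F ` Hom S.FG x y = T.cls ` F 1 ` edges S x y"
      unfolding S.Hom_eq image_image using S.edgesD by (intro image_cong) (auto simp: fundamental_map_cls)
    also have "F 1 ` edges S x y = edges T (F 0 x) (F 0 y)"
      using F_edges lift_1[OF that] by blast
    finally show ?thesis
      by (simp add: T.Hom_eq)
  qed
  have faithful: "inj_on (fundamental_map T F) (Hom S.FG x y)" for x y
  proof (rule inj_onI)
    fix f f' assume "f \<in> Hom S.FG x y" "f' \<in> Hom S.FG x y" and eq: "fundamental_map T F f = fundamental_map T F f'"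
    then obtain g g' where g: "g \<in> edges S x y" "f = S.cls g" "g' \<in> edges S x y" "f' = S.cls g'"
      by (auto simp: S.Hom_eq)
    have g1: "g \<in> simplices S 1" "g' \<in> simplices S 1" "S.src g = x" "S.tgt g = y" "S.src g' = x" "S.tgt g' = y"
      using S.edgesD[OF g(1)] S.edgesD[OF g(3)] by auto
    have y: "y \<in> simplices S 0"
      using S.edge_ends(2)[OF g1(1)] g1 by simp
    have "(F 1 g, F 1 g') \<in> edge_homotopy T"
      using eq g g1 F_closed by (simp add: fundamental_map_cls T.cls_eq_iff)
    \<comment> \<open>A homotopy of the images is a triangle with a degenerate edge, and that edge
      is itself the image of a degenerate edge, so \<open>lift_2\<close> applies.\<close>
    then have "T.triangle (F 1 (S.ide y)) (F 1 g') (F 1 g)"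
      using F_degen[OF y] F_ends(2)[OF g1(1)] g1 by (simp add: T.homotopy_iff)
    then have "S.triangle (S.ide y) g' g"
      using S.ide_edge[OF y] g1 by (intro lift_2) auto
    then have "(g, g') \<in> edge_homotopy S"
      by (rule S.homotopyI) (use g1 in simp)
    then show "f = f'"
      using g g1 by (simp add: S.cls_eq_iff)
  qed
  have onto: "F 0 ` simplices S 0 = simplices T 0"
    using F_closed lift_0 by blast
  have dense: "\<exists>x\<in>simplices S 0. Hom T.FG (F 0 x) z \<noteq> {}" if "z \<in> simplices T 0" for z
    using lift_0[OF that] T'.Idt_closed[of z] that by (auto simp: Obj)
  show ?thesis
    unfolding surjective_equivalence_def Obj
    by (intro conjI ballI is_functor full faithful dense onto)
qed

end

section \<open>The simplicial set of homomorphisms\<close>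

definition skip :: "nat \<Rightarrow> nat \<Rightarrow> nat" where
  "skip i v = (if v < i then v else Suc v)"

text \<open>The codegeneracy that takes the value \<open>i\<close> twice. Away from \<open>i\<close>
  it inverts the coface map \<open>skip i\<close>, and so identifies the simplices avoiding
  \<open>i\<close> with those of a standard simplex of one dimension less.\<close>

definition squeeze :: "nat \<Rightarrow> nat \<Rightarrow> nat" where
  "squeeze i v = (if v \<le> i then v else v - 1)"

lemma squeeze_skip: "squeeze i (skip i v) = v"
  by (simp add: squeeze_def skip_def)

lemma skip_squeeze: "v \<noteq> i \<Longrightarrow> skip i (squeeze i v) = v"
  by (auto simp: squeeze_def skip_def)

lemma map_squeeze_skip: "map (squeeze i) (map (skip i) y) = y"
  by (simp add: squeeze_skip o_def)

lemma map_skip_squeeze: "i \<notin> set x \<Longrightarrow> map (skip i) (map (squeeze i) x) = x"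
  by (auto simp: o_def intro!: map_idI skip_squeeze)

lemma notin_map_skip: "i \<notin> set (map (skip i) y)"
  by (auto simp: skip_def split: if_splits)

lemma squeeze_nondeg:
  assumes "x \<in> nondeg (Suc m)" "i \<notin> set x" "i \<le> Suc m"
  shows "map (squeeze i) x \<in> nondeg m"
proof -
  have "sorted_wrt (\<lambda>u v. squeeze i u < squeeze i v) x"
  proof (rule sorted_wrt_mono_rel[of x "(<)"])
    fix u v assume "u \<in> set x" "v \<in> set x" "u < v"
    moreover from this have "u \<noteq> i" "v \<noteq> i"
      using assms(2) by auto
    ultimately show "squeeze i u < squeeze i v"
      by (auto simp: squeeze_def)
  qed (use assms(1) in \<open>simp add: nondeg_def\<close>)
  moreover have "squeeze i u \<le> m" if "u \<in> set x" for u
  proof -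
    have "u \<noteq> i" "u \<le> Suc m"
      using that assms(1,2) by (auto simp: nondeg_def)
    then show ?thesis
      using assms(3) by (auto simp: squeeze_def)
  qed
  ultimately show ?thesis
    using assms(1) by (auto simp: nondeg_def sorted_wrt_map)
qed

lemma skip_nondeg:
  assumes "y \<in> nondeg m"
  shows "map (skip i) y \<in> nondeg (Suc m)"
proof -
  have "sorted_wrt (\<lambda>u v. skip i u < skip i v) y"
    by (rule sorted_wrt_mono_rel[of y "(<)"]) (use assms in \<open>auto simp: nondeg_def skip_def\<close>)
  then show ?thesis
    using assms by (auto simp: nondeg_def sorted_wrt_map skip_def)
qed

lemma squeeze_squeeze: "i < j \<Longrightarrow> v \<noteq> i \<Longrightarrow> v \<noteq> j \<Longrightarrow> squeeze (j - 1) (squeeze i v) = squeeze i (squeeze j v)"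
  by (auto simp: squeeze_def)

lemma squeeze_neq: "i < j \<Longrightarrow> v \<noteq> i \<Longrightarrow> v \<noteq> j \<Longrightarrow> squeeze j v \<noteq> i \<and> squeeze i v \<noteq> j - 1"
  by (auto simp: squeeze_def)

definition face_family :: "nat \<Rightarrow> nat set \<Rightarrow> nat list set" where
  "face_family n J = {x \<in> nondeg n. \<exists>i\<in>J. i \<notin> set x}"

lemma subcomplex_face_family: "subcomplex (face_family n J)"
  by (rule subcomplexI_nondeg[of _ n]) (use nondeg_subseq set_mono_subseq in \<open>fastforce simp: face_family_def\<close>)+

lemma horn_eq: "horn n k = face_family n ({..n} - {k})"
  and boundary_eq: "boundary n = face_family n {..n}"
  by (auto simp: horn_def boundary_def face_family_def)

text \<open>Product, differential, unit and degree at \<open>x\<close> involve only faces of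
  \<open>x\<close>. Being a homomorphism is therefore a local condition on subcomplexes.\<close>

lemma dg_hom_glue:
  assumes A: "dg_ring A" and B: "dg_ring B" and L: "subcomplex L"
    and local: "\<And>x. x \<in> L \<Longrightarrow> \<exists>M g. subcomplex M \<and> x \<in> M \<and> dg_hom A (cochains M B) g \<and>
      (\<forall>a\<in>carrier A. \<forall>y\<in>M. G a y = g a y)"
    and outside: "\<And>a x. a \<in> carrier A \<Longrightarrow> x \<notin> L \<Longrightarrow> G a x = \<zero>\<^bsub>B\<^esub>"
  shows "dg_hom A (cochains L B) G"
proof -
  interpret A: dg_ring A by fact
  interpret B: dg_ring B by fact
  interpret L: cochain_algebra B L
    using B L by (simp add: cochain_algebra_def cochain_algebra_axioms_def)
  have closed: "G a x \<in> carrier B" if a: "a \<in> carrier A" for a x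
  proof (cases "x \<in> L")
    case True
    then obtain M g where "x \<in> M" "dg_hom A (cochains M B) g" "\<forall>a\<in>carrier A. \<forall>y\<in>M. G a y = g a y"
      using local by blast
    then show ?thesis
      using a dg_hom_closed[of A "cochains M B" g a] by (simp add: cochains_simps)
  qed (simp add: outside a)
  have mult: "G (a \<otimes>\<^bsub>A\<^esub> b) x = cup B (G a) (G b) x" and add: "G (a \<oplus>\<^bsub>A\<^esub> b) x = G a x \<oplus>\<^bsub>B\<^esub> G b x"
    and diff: "G (differential A a) x = total_diff B (G a) x"
    and one: "G \<one>\<^bsub>A\<^esub> x = (if length x = Suc 0 then \<one>\<^bsub>B\<^esub> else \<zero>\<^bsub>B\<^esub>)"
    and deg: "a \<in> grading A i \<Longrightarrow> G a x \<in> grading B (i + 1 - int (length x))"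
    if x: "x \<in> L" and ab: "a \<in> carrier A" "b \<in> carrier A" for a b x i
  proof -
    obtain M g where M: "subcomplex M" "x \<in> M" and g: "dg_hom A (cochains M B) g"
      and eq: "\<And>a y. a \<in> carrier A \<Longrightarrow> y \<in> M \<Longrightarrow> G a y = g a y"
      using local[OF x] by blast
    interpret M: cochain_algebra B M
      using B M by (simp add: cochain_algebra_def cochain_algebra_axioms_def)
    have "G (a \<otimes>\<^bsub>A\<^esub> b) x = cup B (g a) (g b) x"
      using eq[OF _ M(2)] ab M(2) dg_hom_mult[OF g ab] by (simp add: cochains_simps)
    also have "\<dots> = cup B (G a) (G b) x"
      by (rule cup_cong) (use eq ab M.L_subseq[OF M(2)] in auto)
    finally show "G (a \<otimes>\<^bsub>A\<^esub> b) x = cup B (G a) (G b) x" .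
    show "G (a \<oplus>\<^bsub>A\<^esub> b) x = G a x \<oplus>\<^bsub>B\<^esub> G b x"
      using eq[OF _ M(2)] ab dg_hom_add[OF g ab] by (simp add: cochains_simps)
    have "G (differential A a) x = total_diff B (g a) x"
      using eq[OF _ M(2)] ab M(2) dg_hom_differential[OF g ab(1)] by (simp add: cochains_simps)
    also have "\<dots> = total_diff B (G a) x"
    proof (rule total_diff_cong_subseq)
      fix y assume "subseq y x"
      then show "g a y = G a y"
        using eq[OF ab(1), of y] M.L_subseq[OF M(2), of y] outside[OF ab(1) L.Nil_notin]
          dg_hom_closed[OF g ab(1)] M.Nil_notin by (cases "y = []") (auto simp: cochains_simps)
    qed
    finally show "G (differential A a) x = total_diff B (G a) x" .
    show "G \<one>\<^bsub>A\<^esub> x = (if length x = Suc 0 then \<one>\<^bsub>B\<^esub> else \<zero>\<^bsub>B\<^esub>)"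
      using eq[OF _ M(2)] M(2) dg_hom_one[OF g] by (simp add: cochains_simps)
    show "G a x \<in> grading B (i + 1 - int (length x))" if "a \<in> grading A i"
      using eq[OF ab(1) M(2)] dg_hom_degree[OF g that] by (simp add: cochains_simps)
  qed
  show ?thesis
    unfolding dg_hom_def
  proof (intro conjI allI ballI image_subsetI)
    show "G \<in> ring_hom A (cochains L B)"
    proof (rule ring_hom_memI)
      fix a b assume "a \<in> carrier A" "b \<in> carrier A"
      then show "G (a \<otimes>\<^bsub>A\<^esub> b) = G a \<otimes>\<^bsub>cochains L B\<^esub> G b"
        using mult outside by (auto simp: cochains_simps fun_eq_iff)
    next
      fix a b assume ab: "a \<in> carrier A" "b \<in> carrier A"
      have "G (a \<oplus>\<^bsub>A\<^esub> b) x = G a x \<oplus>\<^bsub>B\<^esub> G b x" for x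
        using add[OF _ ab, of x] outside[of _ x] ab by (cases "x \<in> L") auto
      then show "G (a \<oplus>\<^bsub>A\<^esub> b) = G a \<oplus>\<^bsub>cochains L B\<^esub> G b"
        by (simp add: cochains_simps fun_eq_iff)
    next
      show "G \<one>\<^bsub>A\<^esub> = \<one>\<^bsub>cochains L B\<^esub>"
      proof
        fix x
        show "G \<one>\<^bsub>A\<^esub> x = \<one>\<^bsub>cochains L B\<^esub> x"
          using one[OF _ A.one_closed A.one_closed, of x] outside[OF A.one_closed, of x]
          by (cases "x \<in> L") (simp_all add: cochains_simps)
      qed
    qed (auto simp: cochains_simps closed outside)
  next
    fix i a assume "a \<in> grading A i"
    then show "G a \<in> grading (cochains L B) i"
      using deg[of _ a a i] outside[of a] A.grading_closed[of a i] unfolding cochains_simps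
      by (auto 0 3) (metis B.grading_zero)
  next
    fix a assume "a \<in> carrier A"
    then show "G (differential A a) = differential (cochains L B) (G a)"
      using diff outside by (auto simp: cochains_simps fun_eq_iff)
  qed
qed

lemma dg_hom_glue_faces:
  assumes A: "dg_ring A" and B: "dg_ring B" and J: "J \<subseteq> {..Suc m}"
    and f: "\<And>i. i \<in> J \<Longrightarrow> dg_hom A (cochains (nondeg m) B) (f i)"
    and compatible: "\<And>a i j x. \<lbrakk>a \<in> carrier A; i \<in> J; j \<in> J; i < j; x \<in> nondeg (Suc m); i \<notin> set x; j \<notin> set x\<rbrakk> \<Longrightarrow>
      f i a (map (squeeze i) x) = f j a (map (squeeze j) x)"
  shows "\<exists>G. dg_hom A (cochains (face_family (Suc m) J) B) G \<and>
    (\<forall>a\<in>carrier A. \<forall>i\<in>J. \<forall>x\<in>nondeg (Suc m). i \<notin> set x \<longrightarrow> G a x = f i a (map (squeeze i) x))"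
proof -
  interpret A: dg_ring A by fact
  interpret B: dg_ring B by fact
  let ?L = "face_family (Suc m) J"
  \<comment> \<open>The value is taken from an arbitrary face of the family containing
    \<open>x\<close>; compatibility makes the choice immaterial.\<close>
  define G where "G a x = (if x \<in> ?L then let i = SOME i. i \<in> J \<and> i \<notin> set x in f i a (map (squeeze i) x)
    else \<zero>\<^bsub>B\<^esub>)" for a x
  have G_eq: "G a x = f i a (map (squeeze i) x)" if "a \<in> carrier A" "i \<in> J" "x \<in> nondeg (Suc m)" "i \<notin> set x" for a i x
  proof -
    define j where "j = (SOME i. i \<in> J \<and> i \<notin> set x)"
    have "\<exists>i. i \<in> J \<and> i \<notin> set x"
      using that by blast
    from someI_ex[OF this] have j: "j \<in> J" "j \<notin> set x"
      unfolding j_def by blast+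
    have "f j a (map (squeeze j) x) = f i a (map (squeeze i) x)"
    proof (cases i j rule: linorder_cases)
      case less
      show ?thesis
        by (rule compatible[OF that(1,2) j(1) less that(3,4) j(2), symmetric])
    next
      case equal
      then show ?thesis
        by (simp only:)
    next
      case greater
      show ?thesis
        by (rule compatible[OF that(1) j(1) that(2) greater that(3) j(2) that(4)])
    qed
    moreover have "x \<in> ?L"
      unfolding face_family_def using that by blast
    then have "G a x = f j a (map (squeeze j) x)"
      by (simp add: G_def Let_def j_def)
    ultimately show ?thesis
      by simp
  qed
  have "dg_hom A (cochains ?L B) G"
  proof (rule dg_hom_glue[OF A B subcomplex_face_family])
    fix x assume "x \<in> ?L"
    then obtain i where i: "i \<in> J" "i \<notin> set x" "x \<in> nondeg (Suc m)"
      by (auto simp: face_family_def)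
    let ?M = "face_family (Suc m) {i}"
    have "dg_hom (cochains (nondeg m) B) (cochains ?M B) (pullback ?M B (squeeze i))"
      using i J by (intro dg_hom_pullback[OF B subcomplex_face_family subcomplex_nondeg] squeeze_nondeg)
        (auto simp: face_family_def)
    from dg_hom_comp[OF f[OF i(1)] this]
    have hom: "dg_hom A (cochains ?M B) (\<lambda>a. pullback ?M B (squeeze i) (f i a))" .
    have eq: "G a y = pullback ?M B (squeeze i) (f i a) y" if "a \<in> carrier A" "y \<in> ?M" for a y
      using that G_eq[of a i y] i by (simp add: pullback_def face_family_def)
    have "x \<in> ?M"
      using i by (simp add: face_family_def)
    then show "\<exists>M g. subcomplex M \<and> x \<in> M \<and> dg_hom A (cochains M B) g \<and> (\<forall>a\<in>carrier A. \<forall>y\<in>M. G a y = g a y)"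
      using hom eq subcomplex_face_family by blast
  qed (simp add: G_def)
  then show ?thesis
    using G_eq by blast
qed

section \<open>Simplices as cochain-valued homomorphisms\<close>

locale shom = A: dg_ring A + B: dg_ring B
  for A :: "('a, 'k) dgring_scheme" and B :: "('b, 'm) dgring_scheme"
begin

abbreviation "S \<equiv> SHom A B"

lemma SHom_simps: "simplices S q = dg_Hom A (Cyl q B)"
  "simplicial_op S q \<theta> g = compose (carrier A) (Cyl_op B \<theta>) g"
  by (simp_all add: SHom_def)

lemma value_hom: "g \<in> simplices S q \<Longrightarrow> dg_hom A (cochains (nondeg q) B) (\<lambda>a. cyl_value B (g a))"
  by (rule dg_hom_comp[OF _ cylinder.dg_hom_cyl_value[OF cylinderI[OF B.dg_ring_axioms]]])
    (simp add: SHom_simps dg_Hom_def)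

lemma value_in_cochains: "g \<in> simplices S q \<Longrightarrow> a \<in> carrier A \<Longrightarrow> cyl_value B (g a) \<in> carrier (cochains (nondeg q) B)"
  by (rule dg_hom_closed[OF value_hom])

lemma value_outside: "g \<in> simplices S q \<Longrightarrow> a \<in> carrier A \<Longrightarrow> x \<notin> nondeg q \<Longrightarrow> cyl_value B (g a) x = \<zero>\<^bsub>B\<^esub>"
  using value_in_cochains by (simp add: cochains_simps)

text \<open>The map \<open>expand\<close> inverts \<open>cyl_value\<close>; restricting to the
  carrier accounts for the extensionality built into \<open>dg_Hom\<close>.\<close>

lemma simplex_of_hom:
  assumes h: "dg_hom A (cochains (nondeg q) B) h"
  shows "\<exists>g\<in>simplices S q. \<forall>a\<in>carrier A. cyl_value B (g a) = h a"
proof -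
  interpret Q: cylinder B q
    by (rule cylinderI[OF B.dg_ring_axioms])
  let ?g = "\<lambda>a. Q.cls (Q.expand (h a))"
  have "dg_hom A (Cyl q B) ?g"
    by (rule dg_hom_comp[OF h Q.dg_hom_expand])
  then have "dg_hom A (Cyl q B) (restrict ?g (carrier A))"
    by (rule dg_hom_cong[OF A.dg_ring_axioms]) simp
  moreover have "cyl_value B (restrict ?g (carrier A) a) = h a" if "a \<in> carrier A" for a
    using that Q.cyl_value_expand[OF dg_hom_closed[OF h that]] by simp
  ultimately show ?thesis
    by (intro bexI[of _ "restrict ?g (carrier A)"]) (auto simp: SHom_simps dg_Hom_def)
qed

lemma simplex_eqI:
  assumes "g \<in> simplices S q" "g' \<in> simplices S q"
    "\<And>a x. a \<in> carrier A \<Longrightarrow> x \<in> nondeg q \<Longrightarrow> cyl_value B (g a) x = cyl_value B (g' a) x"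
  shows "g = g'"
proof (rule extensionalityI[of _ "carrier A"])
  interpret Q: cylinder B q
    by (rule cylinderI[OF B.dg_ring_axioms])
  fix a assume a: "a \<in> carrier A"
  have "cyl_value B (g a) x = cyl_value B (g' a) x" for x
    using assms(3)[OF a, of x] value_outside[OF assms(1) a, of x] value_outside[OF assms(2) a, of x]
    by (cases "x \<in> nondeg q") auto
  moreover have "g a \<in> carrier (Cyl q B)" "g' a \<in> carrier (Cyl q B)"
    using assms(1,2) a dg_hom_closed by (auto simp: SHom_simps dg_Hom_def)
  ultimately show "g a = g' a"
    by (intro Q.cyl_value_inj) auto
qed (use assms(1,2) in \<open>auto simp: SHom_simps dg_Hom_def\<close>)

text \<open>The pulled-back values come from some simplex \<open>g'\<close>, and injectivity of
  \<open>cyl_value\<close> identifies \<open>g'\<close> with the image of \<open>g\<close>. This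
  proves the image to be a homomorphism.\<close>

lemma op_simplex:
  assumes \<theta>: "\<theta> \<in> monotone_maps p q" and g: "g \<in> simplices S q"
  shows "simplicial_op S q \<theta> g \<in> simplices S p"
    and "a \<in> carrier A \<Longrightarrow> x \<in> nondeg p \<Longrightarrow>
      cyl_value B (simplicial_op S q \<theta> g a) x = cyl_value B (g a) (map ((!) \<theta>) x)"
proof -
  interpret Q: cylinder B p
    by (rule cylinderI[OF B.dg_ring_axioms])
  have g_closed: "g a \<in> carrier (Cyl q B)" if "a \<in> carrier A" for a
    using g that dg_hom_closed by (auto simp: SHom_simps dg_Hom_def)
  have val: "cyl_value B (simplicial_op S q \<theta> g a) = pullback (nondeg p) B ((!) \<theta>) (cyl_value B (g a))"
    if "a \<in> carrier A" for a
    using that B.cyl_value_Cyl_op(2)[OF \<theta> g_closed[OF that]] by (simp add: SHom_simps compose_def)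
  have "dg_hom (cochains (nondeg q) B) (cochains (nondeg p) B) (pullback (nondeg p) B ((!) \<theta>))"
    by (rule dg_hom_pullback[OF B.dg_ring_axioms subcomplex_nondeg subcomplex_nondeg]) (rule nth_nondeg[OF \<theta>])
  from dg_hom_comp[OF value_hom[OF g] this]
  obtain g' where g': "g' \<in> simplices S p"
    "\<And>a. a \<in> carrier A \<Longrightarrow> cyl_value B (g' a) = pullback (nondeg p) B ((!) \<theta>) (cyl_value B (g a))"
    using simplex_of_hom by blast
  have "simplicial_op S q \<theta> g = g'"
  proof (rule extensionalityI[of _ "carrier A"])
    fix a assume a: "a \<in> carrier A"
    have "g' a \<in> carrier (Cyl p B)"
      using g' a dg_hom_closed by (auto simp: SHom_simps dg_Hom_def)
    moreover have "simplicial_op S q \<theta> g a \<in> carrier (Cyl p B)"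
      using a B.cyl_value_Cyl_op(1)[OF \<theta> g_closed[OF a]] by (simp add: SHom_simps compose_def)
    ultimately show "simplicial_op S q \<theta> g a = g' a"
      using val[OF a] g'(2)[OF a] by (intro Q.cyl_value_inj) auto
  qed (use g' in \<open>auto simp: SHom_simps dg_Hom_def compose_def\<close>)
  then show "simplicial_op S q \<theta> g \<in> simplices S p"
    using g' by simp
  show "a \<in> carrier A \<Longrightarrow> x \<in> nondeg p \<Longrightarrow>
      cyl_value B (simplicial_op S q \<theta> g a) x = cyl_value B (g a) (map ((!) \<theta>) x)"
    by (simp add: val pullback_def)
qed

lemma face_map: "i \<le> Suc m \<Longrightarrow> [0..<i] @ [Suc i..<Suc (Suc m)] \<in> monotone_maps m (Suc m)"
  by (auto simp: monotone_maps_def sorted_append simp del: upt_Suc)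

lemma face_simplex:
  assumes "g \<in> simplices S (Suc m)" "i \<le> Suc m"
  shows "face S (Suc m) i g \<in> simplices S m"
    and "a \<in> carrier A \<Longrightarrow> y \<in> nondeg m \<Longrightarrow> cyl_value B (face S (Suc m) i g a) y = cyl_value B (g a) (map (skip i) y)"
proof -
  note \<theta> = face_map[OF assms(2)]
  show "face S (Suc m) i g \<in> simplices S m"
    unfolding face_def by (rule op_simplex(1)[OF \<theta> assms(1)])
  assume a: "a \<in> carrier A" and y: "y \<in> nondeg m"
  have "map ((!) ([0..<i] @ [Suc i..<Suc (Suc m)])) y = map (skip i) y"
    using y assms(2) by (auto simp: nondeg_def skip_def nth_append simp del: upt_Suc)
  then show "cyl_value B (face S (Suc m) i g a) y = cyl_value B (g a) (map (skip i) y)"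
    by (simp only: face_def op_simplex(2)[OF \<theta> assms(1) a y])
qed

lemma simplicial_set_SHom: "simplicial_set S"
proof
  show "simplicial_op S n \<theta> x \<in> simplices S m" if "\<theta> \<in> monotone_maps m n" "x \<in> simplices S n" for \<theta> m n x
    using that by (rule op_simplex(1))
next
  fix g n assume g: "g \<in> simplices S n"
  have \<theta>: "[0..<Suc n] \<in> monotone_maps n n"
    by (auto simp: monotone_maps_def simp del: upt_Suc)
  have "map ((!) [0..<Suc n]) x = x" if "x \<in> nondeg n" for x
    using that by (auto simp: nondeg_def less_Suc_eq_le subset_iff simp del: upt_Suc intro!: map_idI)
  then show "simplicial_op S n [0..<Suc n] g = g"
    by (intro simplex_eqI[OF op_simplex(1)[OF \<theta> g] g]) (simp add: op_simplex(2)[OF \<theta> g] del: upt_Suc)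
next
  fix \<theta> m n \<eta> l g
  assume \<theta>: "\<theta> \<in> monotone_maps m n" and \<eta>: "\<eta> \<in> monotone_maps l m" and g: "g \<in> simplices S n"
  note \<theta>\<eta> = monotone_comp_closed[OF \<theta> \<eta>]
  note g' = op_simplex(1)[OF \<theta> g]
  show "simplicial_op S n (monotone_comp \<theta> \<eta>) g = simplicial_op S m \<eta> (simplicial_op S n \<theta> g)"
  proof (rule simplex_eqI[OF op_simplex(1)[OF \<theta>\<eta> g] op_simplex(1)[OF \<eta> g']])
    fix a x assume a: "a \<in> carrier A" and x: "x \<in> nondeg l"
    have xl: "map ((!) (monotone_comp \<theta> \<eta>)) x = map ((!) \<theta>) (map ((!) \<eta>) x)"
      using x \<eta> by (auto simp: nondeg_def monotone_maps_def monotone_comp_def subset_iff less_Suc_eq_le)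
    show "cyl_value B (simplicial_op S n (monotone_comp \<theta> \<eta>) g a) x =
        cyl_value B (simplicial_op S m \<eta> (simplicial_op S n \<theta> g) a) x"
    proof (cases "map ((!) \<eta>) x \<in> nondeg m")
      case True
      then show ?thesis
        using a x by (simp add: op_simplex(2)[OF \<theta>\<eta> g] op_simplex(2)[OF \<eta> g'] op_simplex(2)[OF \<theta> g] xl)
    next
      \<comment> \<open>If \<open>\<eta>\<close> makes the list degenerate, so does the composite,
        and both values are zero.\<close>
      case False
      then have "\<not> distinct_adj (map ((!) \<eta>) x)"
        using nth_nondeg[OF \<eta> x] by blast
      then have "map ((!) \<theta>) (map ((!) \<eta>) x) \<notin> nondeg n"
        using distinct_adj_mapD[of "(!) \<theta>"] by (auto simp: nondeg_iff simp del: map_map)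
      then show ?thesis
        using a x False value_outside[OF g a] value_outside[OF g' a]
        by (simp add: op_simplex(2)[OF \<theta>\<eta> g] op_simplex(2)[OF \<eta> g'] xl del: map_map)
    qed
  qed
qed

text \<open>As \<open>x\<close> avoids both \<open>i\<close> and \<open>j\<close>, it comes from the
  common face of the two simplices; both values equal the value of that face at the list with both
  indices squeezed out.\<close>

lemma face_compatible:
  assumes f: "fi \<in> simplices S (Suc m)" "fj \<in> simplices S (Suc m)" and ij: "i < j" "j \<le> Suc (Suc m)"
    and eq: "face S (Suc m) i fj = face S (Suc m) (j - 1) fi"
    and x: "x \<in> nondeg (Suc (Suc m))" "i \<notin> set x" "j \<notin> set x" and a: "a \<in> carrier A"
  shows "cyl_value B (fi a) (map (squeeze i) x) = cyl_value B (fj a) (map (squeeze j) x)"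
proof -
  have xj: "map (squeeze j) x \<in> nondeg (Suc m)" and xi: "map (squeeze i) x \<in> nondeg (Suc m)"
    using squeeze_nondeg x ij by auto
  have "squeeze j u \<noteq> i \<and> squeeze i u \<noteq> j - 1" if "u \<in> set x" for u
    using squeeze_neq[OF ij(1), of u] that x by metis
  then have i: "i \<notin> set (map (squeeze j) x)" and j: "j - 1 \<notin> set (map (squeeze i) x)"
    unfolding set_map by (metis imageE)+
  define y where "y = map (squeeze i) (map (squeeze j) x)"
  have y: "y \<in> nondeg m"
    unfolding y_def using squeeze_nondeg[OF xj i] ij by simp
  have y': "y = map (squeeze (j - 1)) (map (squeeze i) x)"
    unfolding y_def map_map
  proof (rule map_cong[OF refl])
    fix u assume "u \<in> set x"
    then have "u \<noteq> i" "u \<noteq> j"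
      using x by auto
    then show "(squeeze i \<circ> squeeze j) u = (squeeze (j - 1) \<circ> squeeze i) u"
      using squeeze_squeeze[OF ij(1), of u] by simp
  qed
  have "cyl_value B (fj a) (map (squeeze j) x) = cyl_value B (fj a) (map (skip i) y)"
    unfolding y_def map_skip_squeeze[OF i] ..
  also have "\<dots> = cyl_value B (face S (Suc m) i fj a) y"
    using face_simplex(2)[OF f(2) _ a y, of i] ij by simp
  also have "\<dots> = cyl_value B (face S (Suc m) (j - 1) fi a) y"
    by (simp only: eq)
  also have "\<dots> = cyl_value B (fi a) (map (skip (j - 1)) y)"
    using face_simplex(2)[OF f(1) _ a y, of "j - 1"] ij by simp
  also have "\<dots> = cyl_value B (fi a) (map (squeeze i) x)"
    unfolding y' map_skip_squeeze[OF j] ..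
  finally show ?thesis ..
qed

lemma face_eqI:
  assumes h: "h \<in> simplices S (Suc m)" and f: "f \<in> simplices S m" and i: "i \<le> Suc m"
    and eq: "\<And>a x. a \<in> carrier A \<Longrightarrow> x \<in> nondeg (Suc m) \<Longrightarrow> i \<notin> set x \<Longrightarrow>
      cyl_value B (h a) x = cyl_value B (f a) (map (squeeze i) x)"
  shows "face S (Suc m) i h = f"
proof (rule simplex_eqI[OF face_simplex(1)[OF h i] f])
  fix a y assume a: "a \<in> carrier A" and y: "y \<in> nondeg m"
  have "cyl_value B (h a) (map (skip i) y) = cyl_value B (f a) (map (squeeze i) (map (skip i) y))"
    by (rule eq[OF a skip_nondeg[OF y] notin_map_skip])
  then show "cyl_value B (face S (Suc m) i h a) y = cyl_value B (f a) y"
    unfolding map_squeeze_skip face_simplex(2)[OF h i a y] .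
qed

text \<open>Glue, extend, and read the faces back. The dimension is at least 2, so the given
  simplices have faces on which their agreement can be expressed.\<close>

lemma fills_horn_SHom:
  assumes A: "semi_free A" and k: "k \<le> Suc (Suc m)"
  shows "fills_horn S (Suc (Suc m)) k"
  unfolding fills_horn_def
proof (intro allI impI, elim conjE)
  let ?n = "Suc (Suc m)"
  fix f assume f: "\<forall>i\<le>?n. i \<noteq> k \<longrightarrow> f i \<in> simplices S (?n - 1)"
    and compat: "\<forall>i j. i < j \<and> j \<le> ?n \<and> i \<noteq> k \<and> j \<noteq> k \<longrightarrow> face S (?n - 1) i (f j) = face S (?n - 1) (j - 1) (f i)"
  have fS: "f i \<in> simplices S (Suc m)" if "i \<in> {..?n} - {k}" for i
    using f that by simp
  have "\<exists>G. dg_hom A (cochains (face_family ?n ({..?n} - {k})) B) G \<and>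
    (\<forall>a\<in>carrier A. \<forall>i\<in>{..?n} - {k}. \<forall>x\<in>nondeg ?n. i \<notin> set x \<longrightarrow> G a x = cyl_value B (f i a) (map (squeeze i) x))"
  proof (rule dg_hom_glue_faces[OF A.dg_ring_axioms B.dg_ring_axioms])
    show "dg_hom A (cochains (nondeg (Suc m)) B) (\<lambda>a. cyl_value B (f i a))" if "i \<in> {..?n} - {k}" for i
      by (rule value_hom[OF fS[OF that]])
  next
    fix a i j x
    assume *: "a \<in> carrier A" "i \<in> {..?n} - {k}" "j \<in> {..?n} - {k}" "i < j" "x \<in> nondeg ?n" "i \<notin> set x" "j \<notin> set x"
    then show "cyl_value B (f i a) (map (squeeze i) x) = cyl_value B (f j a) (map (squeeze j) x)"
      using compat by (intro face_compatible[OF fS fS]) auto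
  qed auto
  then obtain G where G: "dg_hom A (cochains (horn ?n k) B) G"
    and G_eq: "\<And>a i x. \<lbrakk>a \<in> carrier A; i \<in> {..?n} - {k}; x \<in> nondeg ?n; i \<notin> set x\<rbrakk> \<Longrightarrow>
      G a x = cyl_value B (f i a) (map (squeeze i) x)"
    unfolding horn_eq by blast
  obtain h where h: "dg_hom A (cochains (nondeg ?n) B) h" "\<And>a x. a \<in> carrier A \<Longrightarrow> x \<in> horn ?n k \<Longrightarrow> h a x = G a x"
    using horn_extension[OF A.dg_ring_axioms A B.dg_ring_axioms k _ G] by blast
  obtain H where H: "H \<in> simplices S ?n" "\<And>a. a \<in> carrier A \<Longrightarrow> cyl_value B (H a) = h a"
    using simplex_of_hom[OF h(1)] by blast
  have "face S ?n i H = f i" if i: "i \<in> {..?n} - {k}" for i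
  proof (rule face_eqI[OF H(1) fS[OF i]])
    fix a x assume a: "a \<in> carrier A" and x: "x \<in> nondeg ?n" "i \<notin> set x"
    then have "x \<in> horn ?n k"
      using i by (auto simp: horn_def)
    then show "cyl_value B (H a) x = cyl_value B (f i a) (map (squeeze i) x)"
      using a x i by (simp add: H(2) h(2) G_eq)
  qed (use i in auto)
  then show "\<exists>h\<in>simplices S ?n. \<forall>i\<le>?n. i \<noteq> k \<longrightarrow> face S ?n i h = f i"
    using H(1) by auto
qed

lemma low_kan_SHom:
  assumes "semi_free A"
  shows "low_kan S"
proof -
  interpret simplicial_set S
    by (rule simplicial_set_SHom)
  show ?thesis
    using fills_horn_SHom[OF assms, of _ 0] fills_horn_SHom[OF assms, of _ 1]
    by unfold_locales (simp_all add: numeral_2_eq_2 numeral_3_eq_3)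
qed

end

section \<open>The simplicial map induced by a homomorphism of coefficients\<close>

locale shom_map = S: shom A B' + T: shom A B
  for A :: "('a, 'k) dgring_scheme" and B' :: "('b, 'm) dgring_scheme" and B :: "('c, 'n) dgring_scheme" +
  fixes v :: "'b \<Rightarrow> 'c"
  assumes v: "dg_hom B' B v"
begin

abbreviation "F \<equiv> SHom_map A B v"

lemma map_simplex:
  assumes g: "g \<in> simplices S.S q"
  shows "F q g \<in> simplices T.S q"
    and "a \<in> carrier A \<Longrightarrow> cyl_value B (F q g a) x = v (cyl_value B' (g a) x)"
proof -
  interpret Q: cylinder B q
    by (rule cylinderI[OF T.B.dg_ring_axioms])
  note cyl_map = cyl_value_Cyl_map[OF S.B.dg_ring_axioms T.B.dg_ring_axioms v]
  have g_closed: "g a \<in> carrier (Cyl q B')" if "a \<in> carrier A" for a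
    using g that dg_hom_closed by (auto simp: S.SHom_simps dg_Hom_def)
  have val: "cyl_value B (F q g a) = (\<lambda>x. v (cyl_value B' (g a) x))" if "a \<in> carrier A" for a
    using that cyl_map(2)[OF g_closed[OF that]] by (simp add: SHom_map_def compose_def)
  from dg_hom_comp[OF S.value_hom[OF g] dg_hom_coefficients[OF S.B.dg_ring_axioms T.B.dg_ring_axioms v subcomplex_nondeg]]
  obtain g' where g': "g' \<in> simplices T.S q"
    "\<And>a. a \<in> carrier A \<Longrightarrow> cyl_value B (g' a) = (\<lambda>x. v (cyl_value B' (g a) x))"
    using T.simplex_of_hom by blast
  have "F q g = g'"
  proof (rule extensionalityI[of _ "carrier A"])
    fix a assume a: "a \<in> carrier A"
    have "g' a \<in> carrier (Cyl q B)"
      using g' a dg_hom_closed by (auto simp: T.SHom_simps dg_Hom_def)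
    moreover have "F q g a \<in> carrier (Cyl q B)"
      using a cyl_map(1)[OF g_closed[OF a]] by (simp add: SHom_map_def compose_def)
    ultimately show "F q g a = g' a"
      using val[OF a] g'(2)[OF a] by (intro Q.cyl_value_inj) auto
  qed (use g' in \<open>auto simp: SHom_map_def T.SHom_simps dg_Hom_def compose_def\<close>)
  then show "F q g \<in> simplices T.S q"
    using g' by simp
  show "a \<in> carrier A \<Longrightarrow> cyl_value B (F q g a) x = v (cyl_value B' (g a) x)"
    by (simp add: val)
qed

lemma map_op:
  assumes \<theta>: "\<theta> \<in> monotone_maps p q" and g: "g \<in> simplices S.S q"
  shows "simplicial_op T.S q \<theta> (F q g) = F p (simplicial_op S.S q \<theta> g)"
  by (rule T.simplex_eqI[OF T.op_simplex(1)[OF \<theta> map_simplex(1)[OF g]] map_simplex(1)[OF S.op_simplex(1)[OF \<theta> g]]])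
    (simp add: T.op_simplex(2)[OF \<theta> map_simplex(1)[OF g]] map_simplex(2)[OF g]
      map_simplex(2)[OF S.op_simplex(1)[OF \<theta> g]] S.op_simplex(2)[OF \<theta> g])

context
  assumes A: "semi_free A" and surj: "v ` carrier B' = carrier B" and qi: "quasi_iso B' B v"
begin

lemma extend:
  assumes "dg_hom A (cochains (boundary q) B') G" "y \<in> simplices T.S q"
    "\<And>a x. a \<in> carrier A \<Longrightarrow> x \<in> boundary q \<Longrightarrow> v (G a x) = cyl_value B (y a) x"
  obtains h where "dg_hom A (cochains (nondeg q) B') h"
    "\<And>a x. a \<in> carrier A \<Longrightarrow> x \<in> boundary q \<Longrightarrow> h a x = G a x"
    "\<And>a x. a \<in> carrier A \<Longrightarrow> v (h a x) = cyl_value B (y a) x"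
proof -
  have "\<exists>h. dg_hom A (cochains (nondeg q) B') h \<and>
      (\<forall>a\<in>carrier A. (\<forall>x\<in>boundary q. h a x = G a x) \<and> (\<forall>x. v (h a x) = cyl_value B (y a) x))"
    by (rule boundary_extension[OF S.A.dg_ring_axioms A S.B.dg_ring_axioms T.B.dg_ring_axioms v _
        assms(1) T.value_hom[OF assms(2)] assms(3)])
      (rule quasi_iso_lift[OF S.B.dg_ring_axioms T.B.dg_ring_axioms v surj qi])
  then obtain h where "dg_hom A (cochains (nondeg q) B') h \<and>
      (\<forall>a\<in>carrier A. (\<forall>x\<in>boundary q. h a x = G a x) \<and> (\<forall>x. v (h a x) = cyl_value B (y a) x))"
    by (elim exE)
  then show thesis
    by (intro that[of h]) simp_all
qed

lemma lift_vertex: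
  assumes y: "y \<in> simplices T.S 0"
  shows "\<exists>x\<in>simplices S.S 0. F 0 x = y"
proof -
  have empty: "boundary 0 = {}"
    unfolding boundary_def nondeg_def by (auto simp: subset_singleton_iff)
  \<comment> \<open>Cochains on the empty complex form the zero ring, and the zero map is a
    homomorphism to it.\<close>
  have "dg_hom A (cochains (boundary 0) B') (\<lambda>a x. \<zero>\<^bsub>B'\<^esub>)"
    by (rule dg_hom_glue[OF S.A.dg_ring_axioms S.B.dg_ring_axioms subcomplex_boundary]) (simp_all add: empty)
  then obtain h where h: "dg_hom A (cochains (nondeg 0) B') h"
    "\<And>a x. a \<in> carrier A \<Longrightarrow> v (h a x) = cyl_value B (y a) x"
    by (rule extend[OF _ y]) (simp_all add: empty)
  obtain H where H: "H \<in> simplices S.S 0" "\<And>a. a \<in> carrier A \<Longrightarrow> cyl_value B' (H a) = h a"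
    using S.simplex_of_hom[OF h(1)] by blast
  have "F 0 H = y"
    by (rule T.simplex_eqI[OF map_simplex(1)[OF H(1)] y]) (simp add: map_simplex(2)[OF H(1)] H(2) h(2))
  then show ?thesis
    using H(1) by blast
qed

text \<open>Agreement of the \<open>f i\<close> is stated through values instead of faces, which
  covers \<open>m = 0\<close>, where vertices have no faces.\<close>

lemma lift_simplex:
  assumes f: "\<And>i. i \<le> Suc m \<Longrightarrow> f i \<in> simplices S.S m"
    and compat: "\<And>a i j x. \<lbrakk>a \<in> carrier A; j \<le> Suc m; i < j; x \<in> nondeg (Suc m); i \<notin> set x; j \<notin> set x\<rbrakk> \<Longrightarrow>
      cyl_value B' (f i a) (map (squeeze i) x) = cyl_value B' (f j a) (map (squeeze j) x)"
    and y: "y \<in> simplices T.S (Suc m)" "\<And>i. i \<le> Suc m \<Longrightarrow> face T.S (Suc m) i y = F m (f i)"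
  shows "\<exists>H\<in>simplices S.S (Suc m). (\<forall>i\<le>Suc m. face S.S (Suc m) i H = f i) \<and> F (Suc m) H = y"
proof -
  have "\<exists>G. dg_hom A (cochains (face_family (Suc m) {..Suc m}) B') G \<and>
    (\<forall>a\<in>carrier A. \<forall>i\<in>{..Suc m}. \<forall>x\<in>nondeg (Suc m). i \<notin> set x \<longrightarrow> G a x = cyl_value B' (f i a) (map (squeeze i) x))"
    by (rule dg_hom_glue_faces[OF S.A.dg_ring_axioms S.B.dg_ring_axioms]) (auto intro!: S.value_hom f compat)
  then obtain G where G: "dg_hom A (cochains (boundary (Suc m)) B') G"
    and G_eq: "\<And>a i x. \<lbrakk>a \<in> carrier A; i \<le> Suc m; x \<in> nondeg (Suc m); i \<notin> set x\<rbrakk> \<Longrightarrow>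
      G a x = cyl_value B' (f i a) (map (squeeze i) x)"
    unfolding boundary_eq by blast
  have G_v: "v (G a x) = cyl_value B (y a) x" if a: "a \<in> carrier A" and xb: "x \<in> boundary (Suc m)" for a x
  proof -
    obtain i where i: "i \<le> Suc m" "x \<in> nondeg (Suc m)" "i \<notin> set x"
      using xb by (auto simp: boundary_def)
    have sq: "map (squeeze i) x \<in> nondeg m"
      by (rule squeeze_nondeg[OF i(2,3,1)])
    have "v (G a x) = cyl_value B (F m (f i) a) (map (squeeze i) x)"
      using G_eq[OF a i] map_simplex(2)[OF f[OF i(1)] a] by simp
    also have "\<dots> = cyl_value B (y a) (map (skip i) (map (squeeze i) x))"
      using T.face_simplex(2)[OF y(1) i(1) a sq] y(2)[OF i(1)] by simp
    finally show ?thesis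
      by (simp only: map_skip_squeeze[OF i(3)])
  qed
  obtain h where
    h: "dg_hom A (cochains (nondeg (Suc m)) B') h" "\<And>a x. a \<in> carrier A \<Longrightarrow> x \<in> boundary (Suc m) \<Longrightarrow> h a x = G a x"
    "\<And>a x. a \<in> carrier A \<Longrightarrow> v (h a x) = cyl_value B (y a) x"
    by (rule extend[OF G y(1)]) (simp_all add: G_v)
  obtain H where H: "H \<in> simplices S.S (Suc m)" "\<And>a. a \<in> carrier A \<Longrightarrow> cyl_value B' (H a) = h a"
    using S.simplex_of_hom[OF h(1)] by blast
  have "F (Suc m) H = y"
    by (rule T.simplex_eqI[OF map_simplex(1)[OF H(1)] y(1)]) (simp add: map_simplex(2)[OF H(1)] H(2) h(3))
  moreover have "face S.S (Suc m) i H = f i" if i: "i \<le> Suc m" for i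
  proof (rule S.face_eqI[OF H(1) f[OF i] i])
    fix a x assume a: "a \<in> carrier A" and x: "x \<in> nondeg (Suc m)" "i \<notin> set x"
    then have "x \<in> boundary (Suc m)"
      using i by (auto simp: boundary_def)
    then show "cyl_value B' (H a) x = cyl_value B' (f i a) (map (squeeze i) x)"
      using a x i by (simp add: H(2) h(2) G_eq)
  qed
  ultimately show ?thesis
    using H(1) by blast
qed

lemma low_trivial_fibration_SHom: "low_trivial_fibration S.S T.S F"
proof (intro low_trivial_fibration.intro low_trivial_fibration_axioms.intro S.low_kan_SHom[OF A] T.low_kan_SHom[OF A])
  interpret S': low_kan S.S
    by (rule S.low_kan_SHom[OF A])
  interpret T': low_kan T.S
    by (rule T.low_kan_SHom[OF A])
  show "F n x \<in> simplices T.S n" if "x \<in> simplices S.S n" for x n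
    by (rule map_simplex(1)[OF that])
  show "face T.S (Suc n) i (F (Suc n) x) = F n (face S.S (Suc n) i x)"
    if "x \<in> simplices S.S (Suc n)" "i \<le> Suc n" for x n i
    unfolding face_def by (rule map_op[OF S.face_map[OF that(2)] that(1)])
  show "degen T.S 0 0 (F 0 x) = F 1 (degen S.S 0 0 x)" if "x \<in> simplices S.S 0" for x
    unfolding degen_def by (rule map_op[OF _ that]) (simp add: monotone_maps_def)
  show "\<exists>x\<in>simplices S.S 0. F 0 x = y" if "y \<in> simplices T.S 0" for y
    by (rule lift_vertex[OF that])
  show "\<exists>e\<in>edges S.S x x'. F 1 e = g"
    if x: "x \<in> simplices S.S 0" "x' \<in> simplices S.S 0" and g: "g \<in> edges T.S (F 0 x) (F 0 x')" for x x' g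
  proof -
    let ?f = "\<lambda>i::nat. if i = 0 then x' else x"
    have "\<exists>H\<in>simplices S.S (Suc 0). (\<forall>i\<le>Suc 0. face S.S (Suc 0) i H = ?f i) \<and> F (Suc 0) H = g"
    proof (rule lift_simplex)
      fix i j :: nat and z :: "nat list"
      assume "j \<le> Suc 0" "i < j" "z \<in> nondeg (Suc 0)" "i \<notin> set z" "j \<notin> set z"
      \<comment> \<open>A nonempty list on two vertices contains one of them, so the two endpoints
        of an edge are always compatible.\<close>
      moreover from this have "set z \<subseteq> {0, 1}" "i = 0" "j = 1" "z \<noteq> []"
        by (auto simp: nondeg_def)
      ultimately have False
        by (cases z) auto
      then show "cyl_value B' (?f i a) (map (squeeze i) z) = cyl_value B' (?f j a) (map (squeeze j) z)" for a ..
    next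
      fix i :: nat assume "i \<le> Suc 0"
      then show "face T.S (Suc 0) i g = F 0 (?f i)"
        using g by (auto simp: edges_def le_Suc_eq)
    qed (use x g in \<open>auto simp: edges_def\<close>)
    then obtain H where H: "H \<in> simplices S.S (Suc 0)" "\<forall>i\<le>Suc 0. face S.S (Suc 0) i H = ?f i" "F (Suc 0) H = g"
      by blast
    then show ?thesis
      using H(2)[rule_format, of 0] H(2)[rule_format, of 1] by (intro bexI[of _ H]) (auto simp: edges_def)
  qed
  show "S'.triangle a b c"
    if abc: "a \<in> simplices S.S 1" "b \<in> simplices S.S 1" "c \<in> simplices S.S 1"
      "S'.tgt c = S'.src a" "S'.src b = S'.src c" "S'.tgt b = S'.tgt a"
      and tri: "T'.triangle (F 1 a) (F 1 b) (F 1 c)" for a b c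
  proof -
    obtain y where y: "y \<in> simplices T.S 2" "face T.S 2 0 y = F 1 a" "face T.S 2 1 y = F 1 b" "face T.S 2 2 y = F 1 c"
      using tri by (auto simp: T'.triangle_def)
    let ?f = "\<lambda>i::nat. if i = 0 then a else if i = 1 then b else c"
    have "\<exists>H\<in>simplices S.S (Suc 1). (\<forall>i\<le>Suc 1. face S.S (Suc 1) i H = ?f i) \<and> F (Suc 1) H = y"
    proof (rule lift_simplex)
      fix d i j and z :: "nat list"
      assume d: "d \<in> carrier A" "j \<le> Suc 1" "i < j" "z \<in> nondeg (Suc 1)" "i \<notin> set z" "j \<notin> set z"
      have "i = 0 \<and> j = 1 \<or> i = 0 \<and> j = 2 \<or> i = 1 \<and> j = 2"
        using d(2,3) by linarith
      then have "face S.S (Suc 0) i (?f j) = face S.S (Suc 0) (j - 1) (?f i)"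
        using abc by auto
      then show "cyl_value B' (?f i d) (map (squeeze i) z) = cyl_value B' (?f j d) (map (squeeze j) z)"
        using d abc by (intro S.face_compatible[of _ 0]) auto
    next
      fix i :: nat assume "i \<le> Suc 1"
      then have "i = 0 \<or> i = 1 \<or> i = 2"
        by linarith
      then show "face T.S (Suc 1) i y = F 1 (?f i)"
        using y by (auto simp: numeral_2_eq_2)
    qed (use abc y in \<open>auto simp: numeral_2_eq_2\<close>)
    then obtain H where H: "H \<in> simplices S.S 2" "\<forall>i\<le>2. face S.S 2 i H = ?f i"
      by (auto simp: numeral_2_eq_2)
    have "face S.S 2 0 H = a" "face S.S 2 1 H = b" "face S.S 2 2 H = c"
      using H(2)[rule_format, of 0] H(2)[rule_format, of 1] H(2)[rule_format, of 2] by simp_all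
    then show ?thesis
      using H(1) unfolding S'.triangle_def by blast
  qed
qed

end

end

theorem theorem0p6:
  fixes A :: "('a, 'k) dgring_scheme"
    and B' :: "('b, 'm) dgring_scheme"
    and B :: "('c, 'n) dgring_scheme"
    and v :: "'b \<Rightarrow> 'c"
  assumes "dg_ring A" and "semi_free A"
    and "dg_ring B'" and "dg_ring B"
    and "dg_hom B' B v"
    and "v ` carrier B' = carrier B"
    and "quasi_iso B' B v"
  shows "surjective_equivalence (SHom1 A B') (SHom1 A B) (SHom1_map_obj A B v) (SHom1_map_mor A B v)"
proof -
  interpret shom_map A B' B v
    using assms(1,3-5) by (simp add: shom_map_def shom_map_axioms_def shom_def)
  interpret low_trivial_fibration "SHom A B'" "SHom A B" "SHom_map A B v"
    by (rule low_trivial_fibration_SHom[OF assms(2,6,7)])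
  show ?thesis
    unfolding SHom1_def SHom1_map_obj_def[abs_def] SHom1_map_mor_def[abs_def]
    by (rule surjective_equivalence_fundamental)
qed

end
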